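(* Let $H\in(1/2,1)$ and let $G=\{G(t),t\in[0,T]\}$ be a continuous adapted centered Gaussian process such that: (A) there exist $C_1,C_2>0$ such that for all $s,t\in[0,T]$, $C_1|t-s|^{2H}\le \mathbf{E}|G(t)-G(s)|^2\le C_2|t-s|^{2H}$; (B) for all $0\le s_1\le t_1\le s_2\le t_2\le T$, $\mathbf{E}\,(G(t_1)-G(s_1))(G(t_2)-G(s_2))\ge 0$. Let $\xi$ be a random variable such that there exist $r>0$ and an adapted $r$-Hölder continuous process $Z=\{Z(t),t\in[0,T]\}$ with $Z(T)=\xi$. Then there exists a bounded adapted process $\psi=\{\psi(t),t\in[0,T]\}$ such that $\|\psi\|_{\alpha,T}<\infty$ for some $\alpha\in(1-H,1)$ and $$\xi=\int_0^T\psi(s)\,dG(s)$$ almost surely.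
   Context: $(\Omega,\mathcal{F},\mathbf{P})$ is a complete probability space with a filtration $\mathbb{F}=\{\mathcal{F}_t,t\in[0,T]\}$ satisfying the standard assumptions (completeness and right-continuity); a process $X$ is adapted if $X(t)$ is $\mathcal{F}_t$-measurable for every $t\in[0,T]$. Hölder continuity of a process is understood pathwise, almost surely, with a possibly random Hölder constant. A process $\psi$ is bounded if $\sup_{t\in[0,T]}|\psi(t)|<\infty$ almost surely. For $f:[0,T]\to\mathbb{R}$ and $\alpha\in(0,1)$, $$\|f\|_{\alpha,T}=\int_0^T\left(\frac{|f(s)|}{s^\alpha}+\int_0^s\frac{|f(s)-f(z)|}{(s-z)^{1+\alpha}}dz\right)ds .$$ The integral is the pathwise generalized Lebesgue--Stieltjes integral: for $\alpha\in(0,1)$ and $x\in(a,b)$, $$(\mathcal{D}_{a+}^{\alpha}f)(x)=\frac{1}{\Gamma(1-\alpha)}\left(\frac{f(x)}{(x-a)^\alpha}+\alpha\int_a^x\frac{f(x)-f(u)}{(x-u)^{1+\alpha}}du\right),$$ $$(\mathcal{D}_{b-}^{\alpha}g)(x)=\frac{1}{\Gamma(1-\alpha)}\left(\frac{g(x)}{(b-x)^\alpha}+\alpha\int_x^b\frac{g(x)-g(u)}{(u-x)^{1+\alpha}}du\right),$$ and, with $g_{b-}(x)=g(x)-g(b)$, if $\mathcal{D}_{a+}^{\alpha}f\in L_1[a,b]$ and $\mathcal{D}_{b-}^{1-\alpha}g_{b-}\in L_\infty[a,b]$, then $$\int_a^bf(x)\,dg(x)=\int_a^b(\mathcal{D}_{a+}^{\alpha}f)(x)\,(\mathcal{D}_{b-}^{1-\alpha}g_{b-})(x)\,dx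 .$$ *)

theory Defs
  imports "HOL-Probability.Probability"
begin

section \<open>Filtrations and processes on a compact time interval\<close>

text \<open>Only the indices in \<open>{0..T}\<close> matter; outside this interval \<open>F\<close> is unconstrained.\<close>

definition standard_filtration :: "'a measure \<Rightarrow> real \<Rightarrow> (real \<Rightarrow> 'a measure) \<Rightarrow> bool" where
  "standard_filtration M T F \<longleftrightarrow>
     (\<forall>t\<in>{0..T}. subalgebra M (F t)) \<and>
     (\<forall>s\<in>{0..T}. \<forall>t\<in>{0..T}. s \<le> t \<longrightarrow> sets (F s) \<subseteq> sets (F t)) \<and>
     (\<forall>t\<in>{0..<T}. sets (F t) = (\<Inter>u\<in>{t<..T}. sets (F u))) \<and>
     null_sets M \<subseteq> sets (F 0)"

definition adapted_process :: "real \<Rightarrow> (real \<Rightarrow> 'a measure) \<Rightarrow> (real \<Rightarrow> 'a \<Rightarrow> real) \<Rightarrow> bool" where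
  "adapted_process T F X \<longleftrightarrow> (\<forall>t\<in>{0..T}. X t \<in> borel_measurable (F t))"

definition continuous_process :: "'a measure \<Rightarrow> real \<Rightarrow> (real \<Rightarrow> 'a \<Rightarrow> real) \<Rightarrow> bool" where
  "continuous_process M T X \<longleftrightarrow> (AE \<omega> in M. continuous_on {0..T} (\<lambda>t. X t \<omega>))"

definition hoelder_process :: "'a measure \<Rightarrow> real \<Rightarrow> real \<Rightarrow> (real \<Rightarrow> 'a \<Rightarrow> real) \<Rightarrow> bool" where
  "hoelder_process M T r X \<longleftrightarrow>
     (AE \<omega> in M. \<exists>C. \<forall>s\<in>{0..T}. \<forall>t\<in>{0..T}. \<bar>X t \<omega> - X s \<omega>\<bar> \<le> C * \<bar>t - s\<bar> powr r)"

definition bounded_process :: "'a measure \<Rightarrow> real \<Rightarrow> (real \<Rightarrow> 'a \<Rightarrow> real) \<Rightarrow> bool" where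
  "bounded_process M T X \<longleftrightarrow> (AE \<omega> in M. bounded ((\<lambda>t. X t \<omega>) ` {0..T}))"

section \<open>Centered Gaussian processes\<close>

text \<open>The first disjunct is the degenerate law with variance 0, which \<open>normal_density\<close> cannot
  express. It is needed below because linear combinations may vanish.\<close>

definition centered_gaussian :: "'a measure \<Rightarrow> ('a \<Rightarrow> real) \<Rightarrow> bool" where
  "centered_gaussian M X \<longleftrightarrow> X \<in> borel_measurable M \<and>
     ((AE \<omega> in M. X \<omega> = 0) \<or>
      (\<exists>\<sigma>>0. distributed M lborel X (\<lambda>x. ennreal (normal_density 0 \<sigma> x))))"

definition centered_gaussian_process :: "'a measure \<Rightarrow> real \<Rightarrow> (real \<Rightarrow> 'a \<Rightarrow> real) \<Rightarrow> bool" where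
  "centered_gaussian_process M T G \<longleftrightarrow>
     (\<forall>I (c :: real \<Rightarrow> real). finite I \<and> I \<subseteq> {0..T} \<longrightarrow>
        centered_gaussian M (\<lambda>\<omega>. \<Sum>t\<in>I. c t * G t \<omega>))"

section \<open>The generalized Lebesgue--Stieltjes integral\<close>

definition frac_norm :: "real \<Rightarrow> real \<Rightarrow> (real \<Rightarrow> real) \<Rightarrow> ennreal" where
  "frac_norm \<alpha> T f =
     (\<integral>\<^sup>+s\<in>{0..T}. (ennreal (\<bar>f s\<bar> / s powr \<alpha>) +
        (\<integral>\<^sup>+z\<in>{0..s}. ennreal (\<bar>f s - f z\<bar> / (s - z) powr (1 + \<alpha>)) \<partial>lebesgue)) \<partial>lebesgue)"

text \<open>On nonmeasurable functions \<open>nn_integral\<close> is only a lower integral, so finiteness of the norm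
  is required together with measurability.\<close>

definition finite_frac_norm :: "real \<Rightarrow> real \<Rightarrow> (real \<Rightarrow> real) \<Rightarrow> bool" where
  "finite_frac_norm \<alpha> T f \<longleftrightarrow>
     f \<in> borel_measurable (lebesgue_on {0..T}) \<and> frac_norm \<alpha> T f < \<infinity>"

definition frac_deriv_left :: "real \<Rightarrow> real \<Rightarrow> (real \<Rightarrow> real) \<Rightarrow> real \<Rightarrow> real" where
  "frac_deriv_left \<alpha> a f x =
     1 / Gamma (1 - \<alpha>) * (f x / (x - a) powr \<alpha> +
       \<alpha> * (LINT u:{a<..<x}|lebesgue. (f x - f u) / (x - u) powr (1 + \<alpha>)))"

definition frac_deriv_right :: "real \<Rightarrow> real \<Rightarrow> (real \<Rightarrow> real) \<Rightarrow> real \<Rightarrow> real" where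
  "frac_deriv_right \<alpha> b g x =
     1 / Gamma (1 - \<alpha>) * (g x / (b - x) powr \<alpha> +
       \<alpha> * (LINT u:{x<..<b}|lebesgue. (g x - g u) / (u - x) powr (1 + \<alpha>)))"

text \<open>Membership of the fractional derivatives in \<open>L\<^sub>1[a,b]\<close> and in \<open>L\<^sub>\<infinity>[a,b]\<close>. Since the Bochner
  integral of a nonintegrable function is 0 by convention, convergence of the inner integral at
  almost every point is stated explicitly.\<close>

definition frac_deriv_left_L1 :: "real \<Rightarrow> real \<Rightarrow> real \<Rightarrow> (real \<Rightarrow> real) \<Rightarrow> bool" where
  "frac_deriv_left_L1 \<alpha> a b f \<longleftrightarrow>
     (AE x in lebesgue. x \<in> {a<..<b} \<longrightarrow>
        set_integrable lebesgue {a<..<x} (\<lambda>u. (f x - f u) / (x - u) powr (1 + \<alpha>))) \<and>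
     set_integrable lebesgue {a<..<b} (frac_deriv_left \<alpha> a f)"

definition frac_deriv_right_Linf :: "real \<Rightarrow> real \<Rightarrow> real \<Rightarrow> (real \<Rightarrow> real) \<Rightarrow> bool" where
  "frac_deriv_right_Linf \<alpha> a b g \<longleftrightarrow>
     (AE x in lebesgue. x \<in> {a<..<b} \<longrightarrow>
        set_integrable lebesgue {x<..<b} (\<lambda>u. (g x - g u) / (u - x) powr (1 + \<alpha>))) \<and>
     set_borel_measurable lebesgue {a<..<b} (frac_deriv_right \<alpha> b g) \<and>
     (\<exists>C. AE x in lebesgue. x \<in> {a<..<b} \<longrightarrow> \<bar>frac_deriv_right \<alpha> b g x\<bar> \<le> C)"

definition gls_integrable :: "real \<Rightarrow> real \<Rightarrow> real \<Rightarrow> (real \<Rightarrow> real) \<Rightarrow> (real \<Rightarrow> real) \<Rightarrow> bool" where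
  "gls_integrable \<alpha> a b f g \<longleftrightarrow>
     frac_deriv_left_L1 \<alpha> a b f \<and> frac_deriv_right_Linf (1 - \<alpha>) a b (\<lambda>x. g x - g b)"

text \<open>Sign convention: \<open>frac_deriv_right\<close> omits the customary complex factor with base -1 and
  exponent \<open>\<alpha>\<close>, so this integral is minus the Riemann--Stieltjes integral for smooth \<open>f\<close> and \<open>g\<close>.
  Statements asserting the existence of an integrand are unaffected, by passing from \<open>f\<close> to \<open>-f\<close>.\<close>

definition gls_integral :: "real \<Rightarrow> real \<Rightarrow> real \<Rightarrow> (real \<Rightarrow> real) \<Rightarrow> (real \<Rightarrow> real) \<Rightarrow> real" where
  "gls_integral \<alpha> a b f g =
     (LINT x:{a<..<b}|lebesgue.
        frac_deriv_left \<alpha> a f x * frac_deriv_right (1 - \<alpha>) b (\<lambda>y. g y - g b) x)"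

end

theory Submission
  imports Defs
begin

text \<open>
  Why every such variable is an integral. Approach \<open>T\<close> along \<open>t_n = T (1 - 2^(-n))\<close> and cut
  \<open>[t_n, t_{n+1})\<close> into \<open>N_n = 2^(p n)\<close> cells of equal length \<open>d_n\<close>. On a cell \<open>[a, b)\<close> of this block
  the integrand is \<open>m_n (G(s) - G(a))\<close>, with an amplitude \<open>m_n\<close> known at time \<open>t_n\<close>. Because \<open>G\<close> is
  Hoelder continuous of an order above \<open>1/2\<close>, the chain rule has no correction term, and the block
  contributes \<open>m_n Q_n / 2\<close> up to sign, where \<open>Q_n\<close> is the sum of the squared increments of \<open>G\<close>
  over the cells.

  The random variable \<open>Q_n\<close> is nearly deterministic. By Wick's formula its variance is twice the sum
  of the squared covariances of the increments; these covariances are nonnegative by (B), so the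
  sum is at most the largest variance times the variance of \<open>G(t_{n+1}) - G(t_n)\<close>. With
  \<open>S_n = E Q_n\<close> this gives \<open>E (Q_n / S_n - 1)^2 \<le> c N_n^(2 H - 2)\<close>, which is summable, and \<open>Q_n / S_n\<close> tends
  to 1 almost surely (\<open>ratio_variance\<close>, \<open>ratio_tendsto\<close>). Let \<open>D_n\<close> be the amount by which the
  integral up to \<open>t_n\<close> falls short of \<open>Z(t_n)\<close>, and choose \<open>m_n\<close> so that the block contributes
  \<open>D_n Q_n / S_n\<close>. Then \<open>D_{n+1} = D_n (1 - Q_n / S_n) + Z(t_{n+1}) - Z(t_n)\<close>: the old deficit is multiplied
  by a factor tending to 0, and the new one is of order \<open>2^(-r n)\<close>. Hence \<open>D_n = O(2^(-r n))\<close>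
  (\<open>linear_recursion_bound\<close>), and the integral up to \<open>t_n\<close> converges to \<open>Z(T) = \<xi>\<close>.

  It remains to see that the integrand is bounded and has finite norm. By (A), \<open>S_n\<close> is at least of
  order \<open>N_n d_n^(2 H)\<close>, which controls \<open>m_n\<close>. Put \<open>\<kappa> = 1 + p\<close>, so that \<open>d_n\<close> is of order \<open>2^(-\<kappa> n)\<close>,
  \<open>\<gamma> = H - \<epsilon>\<close> for the Hoelder exponent of the paths, and \<open>\<alpha> = 1 - H + 2\<epsilon>\<close>. The size of the
  integrand on the block is at most of order \<open>2\<close> to the power \<open>n (1 - \<kappa> (1 - H) + \<kappa>\<epsilon> - r)\<close>, and its
  norm is at most of order \<open>2\<close> to the power \<open>n (3\<kappa>\<epsilon> - r)\<close>; both are harmless once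
  \<open>\<kappa> (1 - H) \<ge> 1\<close> and \<open>4\<kappa>\<epsilon> \<le> r\<close>.

  The analytic input is that \<open>f \<mapsto> \<integral> f dg\<close> is continuous in the fractional norm (\<open>L_bound\<close>,
  \<open>L_series\<close>) and takes the expected values on indicators of intervals, which is the inversion
  formula for fractional derivatives (\<open>inversion\<close>). The chain rule (\<open>L_piece\<close>) follows by Riemann
  sums. The regularity of the paths of \<open>G\<close> comes from Gaussian moments and dyadic chaining
  (\<open>gaussian_holder_paths\<close>).
\<close>

section \<open>The fractional norm as a Borel integral\<close>

lemma nn_integral_reflect:
  fixes f :: "real \<Rightarrow> ennreal"
  assumes [measurable]: "f \<in> borel_measurable borel"
  shows "(\<integral>\<^sup>+x. f (s - x) \<partial>lborel) = (\<integral>\<^sup>+x. f x \<partial>lborel)"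
  using nn_integral_real_affine[of f "-1" s] by simp

lemma nn_integral_shift:
  fixes f :: "real \<Rightarrow> ennreal"
  assumes [measurable]: "f \<in> borel_measurable borel"
  shows "(\<integral>\<^sup>+x. f (x - s) \<partial>lborel) = (\<integral>\<^sup>+x. f x \<partial>lborel)"
  using nn_integral_real_affine[of f 1 "- s"] by simp

lemma nn_integral_powr_Ioo:
  fixes p l :: real
  assumes "-1 < p" "0 \<le> l"
  shows "(\<integral>\<^sup>+y\<in>{0<..<l}. ennreal (y powr p) \<partial>lborel) = ennreal (l powr (p + 1) / (p + 1))"
proof -
  have "(\<integral>\<^sup>+y\<in>{0<..<l}. ennreal (y powr p) \<partial>lborel) = (\<integral>\<^sup>+y\<in>{0..l}. ennreal (y powr p) \<partial>lborel)"
    by (intro nn_integral_cong_AE, use AE_lborel_singleton[of 0] AE_lborel_singleton[of l] in eventually_elim)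
      (auto split: split_indicator)
  also have "\<dots> = ennreal (l powr (p + 1) / (p + 1))"
    using has_integral_powr_from_0 assms by (intro nn_integral_has_integral_lebesgue') auto
  finally show ?thesis .
qed

lemma nn_integral_powr_Ici:
  fixes p l :: real
  assumes "p < -1" "0 < l"
  shows "(\<integral>\<^sup>+y\<in>{l..}. ennreal (y powr p) \<partial>lborel) = ennreal (- (l powr (p + 1)) / (p + 1))"
  using has_integral_powr_to_inf assms by (intro nn_integral_has_integral_lebesgue') auto

lemma nn_integral_powr_below:
  fixes c s p :: real
  assumes "-1 < p" "c \<le> s"
  shows "(\<integral>\<^sup>+z\<in>{c<..<s}. ennreal ((s - z) powr p) \<partial>lborel) = ennreal ((s - c) powr (p + 1) / (p + 1))"
  using nn_integral_reflect[of "\<lambda>y. ennreal (y powr p) * indicator {0<..<s - c} y" s]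
    nn_integral_powr_Ioo[of p "s - c"] assms by (simp add: indicator_def conj_commute)

lemma nn_integral_powr_above:
  fixes c b p :: real
  assumes "-1 < p" "c \<le> b"
  shows "(\<integral>\<^sup>+u\<in>{c<..<b}. ennreal ((u - c) powr p) \<partial>lborel) = ennreal ((b - c) powr (p + 1) / (p + 1))"
  using nn_integral_shift[of "\<lambda>y. ennreal (y powr p) * indicator {0<..<b - c} y" c]
    nn_integral_powr_Ioo[of p "b - c"] assms by (simp add: indicator_def)

lemma nn_integral_powr_tail_below:
  fixes c s p :: real
  assumes "p < -1" "c < s"
  shows "(\<integral>\<^sup>+z\<in>{..c}. ennreal ((s - z) powr p) \<partial>lborel) = ennreal (- ((s - c) powr (p + 1)) / (p + 1))"
  using nn_integral_reflect[of "\<lambda>y. ennreal (y powr p) * indicator {s - c..} y" s]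
    nn_integral_powr_Ici[of p "s - c"] assms by (simp add: indicator_def)

lemma nn_integral_powr_tail_above:
  fixes b z p :: real
  assumes "p < -1" "z < b"
  shows "(\<integral>\<^sup>+s\<in>{b..}. ennreal ((s - z) powr p) \<partial>lborel) = ennreal (- ((b - z) powr (p + 1)) / (p + 1))"
  using nn_integral_shift[of "\<lambda>y. ennreal (y powr p) * indicator {b - z..} y" z]
    nn_integral_powr_Ici[of p "b - z"] assms by (simp add: indicator_def)

text \<open>The two integrals that make up the norm, over Lebesgue-Borel measure and open intervals: in
  contrast to Lebesgue measure, parameter integrals of Borel functions are then measurable by the
  product measure theory.\<close>

definition frac_inner :: "real \<Rightarrow> (real \<Rightarrow> real) \<Rightarrow> real \<Rightarrow> ennreal" where
  "frac_inner \<alpha> f s = (\<integral>\<^sup>+z\<in>{0<..<s}. ennreal (\<bar>f s - f z\<bar> / (s - z) powr (1 + \<alpha>)) \<partial>lborel)"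

definition frac_nn :: "real \<Rightarrow> real \<Rightarrow> (real \<Rightarrow> real) \<Rightarrow> ennreal" where
  "frac_nn \<alpha> T f = (\<integral>\<^sup>+s\<in>{0<..<T}. (ennreal (\<bar>f s\<bar> / s powr \<alpha>) + frac_inner \<alpha> f s) \<partial>lborel)"

lemma frac_inner_measurable [measurable]:
  assumes [measurable]: "f \<in> borel_measurable borel"
  shows "frac_inner \<alpha> f \<in> borel_measurable borel"
proof -
  have "(\<lambda>s. \<integral>\<^sup>+z. (if 0 < z \<and> z < s then ennreal (\<bar>f s - f z\<bar> / (s - z) powr (1 + \<alpha>)) else 0) \<partial>lborel) \<in> borel_measurable borel"
    by measurable
  moreover have "frac_inner \<alpha> f = (\<lambda>s. \<integral>\<^sup>+z. (if 0 < z \<and> z < s then ennreal (\<bar>f s - f z\<bar> / (s - z) powr (1 + \<alpha>)) else 0) \<partial>lborel)"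
    unfolding frac_inner_def by (intro ext nn_integral_cong) (auto split: split_indicator)
  ultimately show ?thesis by simp
qed

lemma frac_norm_eq_frac_nn:
  assumes [measurable]: "f \<in> borel_measurable borel"
  shows "frac_norm \<alpha> T f = frac_nn \<alpha> T f"
proof -
  have inner: "(\<integral>\<^sup>+z\<in>{0..s}. ennreal (\<bar>f s - f z\<bar> / (s - z) powr (1 + \<alpha>)) \<partial>lebesgue) = frac_inner \<alpha> f s" for s
  proof -
    have "AE z in lborel. z \<noteq> 0 \<and> z \<noteq> s"
      using AE_lborel_singleton[of 0] AE_lborel_singleton[of s] by eventually_elim auto
    then show ?thesis
      unfolding frac_inner_def nn_integral_completion
      by (intro nn_integral_cong_AE) (auto split: split_indicator)
  qed
  have "AE z in lborel. z \<noteq> 0 \<and> z \<noteq> T"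
    using AE_lborel_singleton[of 0] AE_lborel_singleton[of T] by eventually_elim auto
  then show ?thesis
    unfolding frac_norm_def frac_nn_def inner
    unfolding nn_integral_completion
    by (intro nn_integral_cong_AE) (auto split: split_indicator)
qed

lemma ennreal_abs_le_suminf:
  fixes f :: "nat \<Rightarrow> real"
  assumes "f sums S"
  shows "ennreal \<bar>S\<bar> \<le> (\<Sum>n. ennreal \<bar>f n\<bar>)"
proof (rule LIMSEQ_le_const2)
  show "(\<lambda>n. ennreal \<bar>\<Sum>i<n. f i\<bar>) \<longlonglongrightarrow> ennreal \<bar>S\<bar>"
    using assms unfolding sums_def by (intro tendsto_ennrealI tendsto_rabs)
  have "ennreal \<bar>\<Sum>i<n. f i\<bar> \<le> (\<Sum>n. ennreal \<bar>f n\<bar>)" for n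
  proof -
    have "ennreal \<bar>\<Sum>i<n. f i\<bar> \<le> ennreal (\<Sum>i<n. \<bar>f i\<bar>)"
      by (intro ennreal_leI sum_abs)
    also have "\<dots> = (\<Sum>i<n. ennreal \<bar>f i\<bar>)" by simp
    also have "\<dots> \<le> (\<Sum>n. ennreal \<bar>f n\<bar>)" by (intro sum_le_suminf) auto
    finally show ?thesis .
  qed
  then show "\<exists>N. \<forall>n\<ge>N. ennreal \<bar>\<Sum>i<n. f i\<bar> \<le> (\<Sum>n. ennreal \<bar>f n\<bar>)" by blast
qed

lemma ennreal_abs_divide_le_suminf:
  fixes f :: "nat \<Rightarrow> real"
  assumes "f sums S" "0 \<le> c"
  shows "ennreal (\<bar>S\<bar> / c) \<le> (\<Sum>n. ennreal (\<bar>f n\<bar> / c))"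
  using ennreal_abs_le_suminf[OF sums_divide[OF assms(1), of c]] assms(2) by (simp add: abs_divide)

text \<open>Countable subadditivity is what allows an integrand with infinitely many jumps accumulating at
  \<open>T\<close> to be handled cell by cell.\<close>

lemma frac_nn_series:
  assumes [measurable]: "\<And>n. f n \<in> borel_measurable borel"
    and S: "\<And>s. (\<lambda>n. f n s) sums F s"
  shows "frac_nn \<alpha> T F \<le> (\<Sum>n. frac_nn \<alpha> T (f n))"
proof -
  have inner: "frac_inner \<alpha> F s \<le> (\<Sum>n. frac_inner \<alpha> (f n) s)" for s
  proof -
    have "frac_inner \<alpha> F s \<le> (\<integral>\<^sup>+z. (\<Sum>n. ennreal (\<bar>f n s - f n z\<bar> / (s - z) powr (1 + \<alpha>)) * indicator {0<..<s} z) \<partial>lborel)"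
      unfolding frac_inner_def
    proof (intro nn_integral_mono)
      fix z
      have "ennreal (\<bar>F s - F z\<bar> / (s - z) powr (1 + \<alpha>)) \<le> (\<Sum>n. ennreal (\<bar>f n s - f n z\<bar> / (s - z) powr (1 + \<alpha>)))"
        by (rule ennreal_abs_divide_le_suminf[OF sums_diff[OF S S]]) simp
      then show "ennreal (\<bar>F s - F z\<bar> / (s - z) powr (1 + \<alpha>)) * indicator {0<..<s} z
        \<le> (\<Sum>n. ennreal (\<bar>f n s - f n z\<bar> / (s - z) powr (1 + \<alpha>)) * indicator {0<..<s} z)"
        by (simp split: split_indicator)
    qed
    also have "\<dots> = (\<Sum>n. frac_inner \<alpha> (f n) s)"
      unfolding frac_inner_def by (intro nn_integral_suminf) measurable
    finally show ?thesis .
  qed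
  have "frac_nn \<alpha> T F \<le> (\<integral>\<^sup>+s. (\<Sum>n. (ennreal (\<bar>f n s\<bar> / s powr \<alpha>) + frac_inner \<alpha> (f n) s) * indicator {0<..<T} s) \<partial>lborel)"
    unfolding frac_nn_def
  proof (intro nn_integral_mono)
    fix s
    have "ennreal (\<bar>F s\<bar> / s powr \<alpha>) + frac_inner \<alpha> F s
       \<le> (\<Sum>n. ennreal (\<bar>f n s\<bar> / s powr \<alpha>)) + (\<Sum>n. frac_inner \<alpha> (f n) s)"
      by (rule add_mono[OF ennreal_abs_divide_le_suminf[OF S] inner]) simp
    also have "\<dots> = (\<Sum>n. ennreal (\<bar>f n s\<bar> / s powr \<alpha>) + frac_inner \<alpha> (f n) s)"
      by (intro suminf_add) auto
    finally show "(ennreal (\<bar>F s\<bar> / s powr \<alpha>) + frac_inner \<alpha> F s) * indicator {0<..<T} s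
      \<le> (\<Sum>n. (ennreal (\<bar>f n s\<bar> / s powr \<alpha>) + frac_inner \<alpha> (f n) s) * indicator {0<..<T} s)"
      by (auto split: split_indicator)
  qed
  also have "\<dots> = (\<Sum>n. frac_nn \<alpha> T (f n))"
    unfolding frac_nn_def by (intro nn_integral_suminf) measurable
  finally show ?thesis .
qed

lemma frac_nn_zero [simp]: "frac_nn \<alpha> T (\<lambda>_. 0) = 0"
  by (simp add: frac_nn_def frac_inner_def)

lemma frac_nn_cmult:
  assumes [measurable]: "f \<in> borel_measurable borel"
  shows "frac_nn \<alpha> T (\<lambda>s. c * f s) = ennreal \<bar>c\<bar> * frac_nn \<alpha> T f"
proof -
  have e: "ennreal (\<bar>c * x\<bar> / y) = ennreal \<bar>c\<bar> * ennreal (\<bar>x\<bar> / y)"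
    "ennreal (\<bar>c * x - c * x'\<bar> / y) = ennreal \<bar>c\<bar> * ennreal (\<bar>x - x'\<bar> / y)" for x x' y
    by (simp_all add: abs_mult right_diff_distrib[symmetric] ennreal_mult'[symmetric])
  have inner: "frac_inner \<alpha> (\<lambda>s. c * f s) s = ennreal \<bar>c\<bar> * frac_inner \<alpha> f s" for s
    unfolding frac_inner_def e mult.assoc
    by (rule nn_integral_cmult) measurable
  show ?thesis
    unfolding frac_nn_def inner e distrib_left[symmetric] mult.assoc
    by (rule nn_integral_cmult) measurable
qed

lemma frac_nn_sum:
  fixes f :: "nat \<Rightarrow> real \<Rightarrow> real"
  assumes "\<And>i. i < n \<Longrightarrow> f i \<in> borel_measurable borel"
  shows "frac_nn \<alpha> T (\<lambda>s. \<Sum>i<n. f i s) \<le> (\<Sum>i<n. frac_nn \<alpha> T (f i))"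
proof -
  let ?f = "\<lambda>i. if i < n then f i else (\<lambda>_. 0)"
  have "frac_nn \<alpha> T (\<lambda>s. \<Sum>i<n. f i s) \<le> (\<Sum>i. frac_nn \<alpha> T (?f i))"
  proof (rule frac_nn_series)
    show "(\<lambda>i. ?f i s) sums (\<Sum>i<n. f i s)" for s
      using sums_finite[of "{..<n}" "\<lambda>i. ?f i s"] by simp
  qed (use assms in auto)
  also have "\<dots> = (\<Sum>i<n. frac_nn \<alpha> T (?f i))"
    by (rule suminf_finite) auto
  finally show ?thesis by simp
qed

text \<open>The cost of one cell. There are three contributions: points inside the cell seen from the cell
  (Hoelder continuity makes the kernel integrable since \<open>\<alpha> < \<gamma>\<close>), points to the left of the cell
  (the jump at \<open>a\<close>), and points to the right of it, where interchanging the integrals is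
  simplest. What matters is the exponent of the length: with \<open>B\<close> of order \<open>K (b - a)^\<gamma>\<close>
  it exceeds 1, so that refining a partition makes the total cost small. Indicators are
  the case \<open>K = 0\<close>.\<close>

lemma frac_nn_piece_bound:
  fixes f :: "real \<Rightarrow> real"
  assumes [measurable]: "f \<in> borel_measurable borel"
    and "0 < \<alpha>" "\<alpha> < 1" "\<alpha> < \<gamma>" "0 \<le> a" "a \<le> b" "0 \<le> B" "0 \<le> K"
    and out: "\<And>s. s \<notin> {a..<b} \<Longrightarrow> f s = 0"
    and bd: "\<And>s. s \<in> {a..<b} \<Longrightarrow> \<bar>f s\<bar> \<le> B"
    and hoe: "\<And>s z. s \<in> {a..<b} \<Longrightarrow> z \<in> {a..<b} \<Longrightarrow> \<bar>f s - f z\<bar> \<le> K * \<bar>s - z\<bar> powr \<gamma>"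
  shows "frac_nn \<alpha> T f \<le> ennreal ((1 + 2 / \<alpha>) / (1 - \<alpha>) * B * (b - a) powr (1 - \<alpha>)
    + 1 / (\<gamma> - \<alpha>) * K * (b - a) powr (1 + \<gamma> - \<alpha>))"
proof -
  let ?J = "\<lambda>s z. ennreal (B * (s - z) powr (- 1 - \<alpha>)) * indicator {a<..<b} z * indicator {b..} s"
  let ?k = "K * (b - a) powr (\<gamma> - \<alpha>) / (\<gamma> - \<alpha>)" and ?b = "(b - a) powr (1 - \<alpha>) / (1 - \<alpha>)"
    and ?a = "\<lambda>s. (s - a) powr (- \<alpha>) / \<alpha>" and ?R = "\<lambda>s. \<integral>\<^sup>+z. ?J s z \<partial>lborel"
  have pw: "1 / (s - z) powr (1 + \<alpha>) = (s - z) powr (- 1 - \<alpha>)" for s z :: real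
    by (simp add: powr_minus_divide[symmetric])
  have inside: "ennreal (\<bar>f s\<bar> / s powr \<alpha>) + frac_inner \<alpha> f s \<le>
      ennreal ((1 + 1 / \<alpha>) * B * (s - a) powr (- \<alpha>)) + ennreal ?k"
    if s: "s \<in> {a<..<b}" for s
  proof -
    have "frac_inner \<alpha> f s \<le> (\<integral>\<^sup>+z. ennreal B * (ennreal ((s - z) powr (- 1 - \<alpha>)) * indicator {..a} z)
        + ennreal K * (ennreal ((s - z) powr (\<gamma> - \<alpha> - 1)) * indicator {a<..<s} z) \<partial>lborel)"
      unfolding frac_inner_def
    proof (intro nn_integral_mono_AE, use AE_lborel_singleton[of a] in eventually_elim)
      fix z :: real assume za: "z \<noteq> a"
      consider "z \<notin> {0<..<s}" | "z \<in> {0<..<s}" "z < a" | "z \<in> {0<..<s}" "a < z"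
        using za by force
      then show "ennreal (\<bar>f s - f z\<bar> / (s - z) powr (1 + \<alpha>)) * indicator {0<..<s} z \<le>
        ennreal B * (ennreal ((s - z) powr (- 1 - \<alpha>)) * indicator {..a} z)
        + ennreal K * (ennreal ((s - z) powr (\<gamma> - \<alpha> - 1)) * indicator {a<..<s} z)"
      proof cases
        case 2
        have "\<bar>f s - f z\<bar> / (s - z) powr (1 + \<alpha>) \<le> B * (1 / (s - z) powr (1 + \<alpha>))"
          using bd[of s] s out[of z] 2 by (auto simp: divide_right_mono)
        then show ?thesis using 2 \<open>0 \<le> B\<close> unfolding pw
          by (auto simp: ennreal_mult'[symmetric] intro!: ennreal_leI)
      next
        case 3
        have "\<bar>f s - f z\<bar> / (s - z) powr (1 + \<alpha>) \<le> K * (s - z) powr \<gamma> * (1 / (s - z) powr (1 + \<alpha>))"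
          using hoe[of s z] s 3 by (auto simp: divide_right_mono)
        also have "\<dots> = K * (s - z) powr (\<gamma> - \<alpha> - 1)"
          unfolding pw using 3 by (simp add: powr_add[symmetric] algebra_simps)
        finally show ?thesis using 3 \<open>0 \<le> K\<close>
          by (auto simp: ennreal_mult'[symmetric] intro!: ennreal_leI)
      qed simp
    qed
    also have "\<dots> = ennreal B * (\<integral>\<^sup>+z. ennreal ((s - z) powr (- 1 - \<alpha>)) * indicator {..a} z \<partial>lborel)
        + ennreal K * (\<integral>\<^sup>+z. ennreal ((s - z) powr (\<gamma> - \<alpha> - 1)) * indicator {a<..<s} z \<partial>lborel)"
      by (subst nn_integral_add) (auto simp: nn_integral_cmult)
    also have "\<dots> = ennreal B * ennreal (?a s) + ennreal K * ennreal ((s - a) powr (\<gamma> - \<alpha>) / (\<gamma> - \<alpha>))"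
      using assms s by (subst nn_integral_powr_below, simp_all) (subst nn_integral_powr_tail_below, simp_all)
    also have "\<dots> \<le> ennreal (B * (?a s)) + ennreal ?k"
      using assms s
      by (auto simp: ennreal_mult'[symmetric] intro!: add_mono ennreal_leI divide_right_mono mult_left_mono powr_mono2)
    finally have 1: "frac_inner \<alpha> f s \<le> ennreal (B * (?a s)) + ennreal ?k" .
    have "\<bar>f s\<bar> / s powr \<alpha> \<le> B * (s - a) powr (- \<alpha>)"
    proof -
      have "\<bar>f s\<bar> / s powr \<alpha> \<le> B / (s - a) powr \<alpha>"
        using s bd[of s] assms by (intro frac_le powr_mono2) auto
      then show ?thesis by (simp add: powr_minus_divide)
    qed
    then have "ennreal (\<bar>f s\<bar> / s powr \<alpha>) + frac_inner \<alpha> f s \<le> ennreal (B * (s - a) powr (- \<alpha>)) +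
      (ennreal (B * (?a s)) + ennreal ?k)"
      by (intro add_mono 1 ennreal_leI)
    also have "\<dots> = ennreal ((1 + 1 / \<alpha>) * B * (s - a) powr (- \<alpha>)) + ennreal ?k"
    proof -
      have "ennreal ((1 + 1 / \<alpha>) * B * (s - a) powr (- \<alpha>)) = ennreal (B * (s - a) powr (- \<alpha>) + B * (?a s))"
        by (simp add: algebra_simps)
      also have "\<dots> = ennreal (B * (s - a) powr (- \<alpha>)) + ennreal (B * (?a s))"
        using assms by (intro ennreal_plus) auto
      finally show ?thesis by (simp only: add.assoc)
    qed
    finally show ?thesis .
  qed
  have right: "ennreal (\<bar>f s\<bar> / s powr \<alpha>) + frac_inner \<alpha> f s \<le> ?R s" if "b < s" for s
  proof -
    have "frac_inner \<alpha> f s \<le> ?R s"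
      unfolding frac_inner_def
    proof (intro nn_integral_mono_AE, use AE_lborel_singleton[of a] in eventually_elim)
      fix z :: real assume za: "z \<noteq> a"
      have "\<bar>f s - f z\<bar> / (s - z) powr (1 + \<alpha>) \<le> B * (1 / (s - z) powr (1 + \<alpha>))" if "z \<in> {a<..<b}"
        using bd[of z] out[of s] that \<open>b < s\<close> by (auto simp: divide_right_mono)
      then have "\<bar>f s - f z\<bar> / (s - z) powr (1 + \<alpha>) \<le> B * (s - z) powr (- 1 - \<alpha>)" if "z \<in> {a<..<b}"
        using that unfolding pw by blast
      moreover have "f s = 0" using \<open>b < s\<close> out by auto
      moreover have "f z = 0" if "z \<notin> {a<..<b}" using that za out[of z] by auto
      ultimately show "ennreal (\<bar>f s - f z\<bar> / (s - z) powr (1 + \<alpha>)) * indicator {0<..<s} z \<le> ?J s z"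
        using \<open>b < s\<close> by (cases "z \<in> {a<..<b}") (auto split: split_indicator intro!: ennreal_leI)
    qed
    then show ?thesis using out[of s] that by simp
  qed
  have left: "ennreal (\<bar>f s\<bar> / s powr \<alpha>) + frac_inner \<alpha> f s = 0" if "s < a" for s
  proof -
    have "f s = 0" using out that by auto
    moreover have "f z = 0" if "z < s" for z using out[of z] that \<open>s < a\<close> by auto
    ultimately show ?thesis
      by (auto simp: frac_inner_def nn_integral_0_iff_AE split: split_indicator)
  qed
  have "frac_nn \<alpha> T f \<le> (\<integral>\<^sup>+s. ennreal ((1 + 1 / \<alpha>) * B) * (ennreal ((s - a) powr (- \<alpha>)) * indicator {a<..<b} s)
      + ennreal ?k * indicator {a<..<b} s + ?R s \<partial>lborel)"
    unfolding frac_nn_def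
  proof (intro nn_integral_mono_AE, use AE_lborel_singleton[of a] AE_lborel_singleton[of b] in eventually_elim)
    fix s :: real assume "s \<noteq> a" "s \<noteq> b"
    then consider "s < a" | "s \<in> {a<..<b}" | "b < s" by force
    then show "(ennreal (\<bar>f s\<bar> / s powr \<alpha>) + frac_inner \<alpha> f s) * indicator {0<..<T} s \<le>
      ennreal ((1 + 1 / \<alpha>) * B) * (ennreal ((s - a) powr (- \<alpha>)) * indicator {a<..<b} s)
      + ennreal ?k * indicator {a<..<b} s + ?R s"
    proof cases
      case 1 then show ?thesis by (subst left) simp_all
    next
      case 2
      have "(ennreal (\<bar>f s\<bar> / s powr \<alpha>) + frac_inner \<alpha> f s) * indicator {0<..<T} s \<le> ennreal (\<bar>f s\<bar> / s powr \<alpha>) + frac_inner \<alpha> f s"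
        by (auto split: split_indicator)
      also have "\<dots> \<le> ennreal ((1 + 1 / \<alpha>) * B * (s - a) powr (- \<alpha>)) + ennreal ?k"
        using inside 2 by blast
      also have "\<dots> \<le> ennreal ((1 + 1 / \<alpha>) * B) * (ennreal ((s - a) powr (- \<alpha>)) * indicator {a<..<b} s)
      + ennreal ?k * indicator {a<..<b} s + ?R s"
        using 2 assms by (simp add: ennreal_mult' )
      finally show ?thesis .
    next
      case 3
      then have "(ennreal (\<bar>f s\<bar> / s powr \<alpha>) + frac_inner \<alpha> f s) * indicator {0<..<T} s \<le> ?R s"
        using right[of s] by (auto split: split_indicator)
      then show ?thesis using 3 by simp
    qed
  qed
  also have "\<dots> = ennreal ((1 + 1 / \<alpha>) * B) * (\<integral>\<^sup>+s. ennreal ((s - a) powr (- \<alpha>)) * indicator {a<..<b} s \<partial>lborel)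
      + ennreal ?k * emeasure lborel {a<..<b} + (\<integral>\<^sup>+s. ?R s \<partial>lborel)"
    by (simp add: nn_integral_add nn_integral_cmult)
  also have "(\<integral>\<^sup>+s. ?R s \<partial>lborel) = (\<integral>\<^sup>+z. (\<integral>\<^sup>+s. ?J s z \<partial>lborel) \<partial>lborel)"
    by (rule lborel_pair.Fubini') measurable
  also have "(\<integral>\<^sup>+z. (\<integral>\<^sup>+s. ?J s z \<partial>lborel) \<partial>lborel) = (\<integral>\<^sup>+z. ennreal (B / \<alpha>) * (ennreal ((b - z) powr (- \<alpha>)) * indicator {a<..<b} z) \<partial>lborel)"
  proof (intro nn_integral_cong)
    fix z
    have "(\<integral>\<^sup>+s. ?J s z \<partial>lborel) = ennreal B * indicator {a<..<b} z * (\<integral>\<^sup>+s. ennreal ((s - z) powr (- 1 - \<alpha>)) * indicator {b..} s \<partial>lborel)"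
      using \<open>0 \<le> B\<close> by (subst nn_integral_cmult[symmetric]) (auto intro!: nn_integral_cong simp: ennreal_mult' ac_simps)
    also have "\<dots> = ennreal (B / \<alpha>) * (ennreal ((b - z) powr (- \<alpha>)) * indicator {a<..<b} z)"
      using assms by (cases "z \<in> {a<..<b}") (auto simp: nn_integral_powr_tail_above ennreal_mult'[symmetric])
    finally show "(\<integral>\<^sup>+s. ?J s z \<partial>lborel) = ennreal (B / \<alpha>) * (ennreal ((b - z) powr (- \<alpha>)) * indicator {a<..<b} z)" .
  qed
  also have "\<dots> = ennreal (B / \<alpha>) * ennreal ?b"
    using assms by (subst nn_integral_cmult) (auto simp: nn_integral_powr_below)
  also have "(\<integral>\<^sup>+s. ennreal ((s - a) powr (- \<alpha>)) * indicator {a<..<b} s \<partial>lborel) = ennreal ?b"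
    using assms by (subst nn_integral_powr_above) auto
  also have "ennreal ((1 + 1 / \<alpha>) * B) * ennreal ?b + ennreal ?k * emeasure lborel {a<..<b}
     + ennreal (B / \<alpha>) * ennreal ?b =
     ennreal ((1 + 1 / \<alpha>) * B * ?b + ?k * (b - a)
     + (B / \<alpha>) * ?b)"
    using assms by (simp add: ennreal_mult'[symmetric] ennreal_plus[symmetric] del: ennreal_plus)
  also have "?k * (b - a) = 1 / (\<gamma> - \<alpha>) * K * (b - a) powr (1 + \<gamma> - \<alpha>)"
  proof (cases "a = b")
    case False
    then have "(b - a) powr (\<gamma> - \<alpha>) * (b - a) powr 1 = (b - a) powr (\<gamma> - \<alpha> + 1)"
      by (simp only: powr_add)
    then have "(b - a) powr (\<gamma> - \<alpha>) * (b - a) = (b - a) powr (1 + \<gamma> - \<alpha>)"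
      using False \<open>a \<le> b\<close> by (simp add: algebra_simps)
    then show ?thesis by simp
  qed auto
  also have "(1 + 1 / \<alpha>) * B * ?b + 1 / (\<gamma> - \<alpha>) * K * (b - a) powr (1 + \<gamma> - \<alpha>)
     + (B / \<alpha>) * ?b = (1 + 2 / \<alpha>) / (1 - \<alpha>) * B * (b - a) powr (1 - \<alpha>)
    + 1 / (\<gamma> - \<alpha>) * K * (b - a) powr (1 + \<gamma> - \<alpha>)"
    by (simp add: divide_inverse algebra_simps)
  finally show ?thesis .
qed

section \<open>The integral as a continuous linear functional of the integrand\<close>

text \<open>The integrands of the left-sided and of the right-sided fractional derivative.\<close>

abbreviation lker :: "real \<Rightarrow> (real \<Rightarrow> real) \<Rightarrow> real \<Rightarrow> real \<Rightarrow> real" where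
  "lker \<alpha> f x u \<equiv> (f x - f u) / (x - u) powr (1 + \<alpha>)"

abbreviation rker :: "real \<Rightarrow> (real \<Rightarrow> real) \<Rightarrow> real \<Rightarrow> real \<Rightarrow> real" where
  "rker \<beta> h x u \<equiv> (h x - h u) / (u - x) powr (1 + \<beta>)"

lemma set_integral_lebesgue_eq_lborel:
  fixes f :: "real \<Rightarrow> real"
  assumes [measurable]: "A \<in> sets borel" "f \<in> borel_measurable borel"
  shows "(LINT x:A|lebesgue. f x) = (LINT x:A|lborel. f x)"
  unfolding set_lebesgue_integral_def by (rule integral_completion) simp

lemma set_integrable_lebesgue_eq_lborel:
  fixes f :: "real \<Rightarrow> real"
  assumes [measurable]: "A \<in> sets borel" "f \<in> borel_measurable borel"
  shows "set_integrable lebesgue A f \<longleftrightarrow> set_integrable lborel A f"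
  unfolding set_integrable_def by (rule integrable_completion) simp

lemma frac_deriv_left_lborel:
  assumes [measurable]: "f \<in> borel_measurable borel"
  shows "frac_deriv_left \<alpha> a f x = 1 / Gamma (1 - \<alpha>) * (f x / (x - a) powr \<alpha> +
       \<alpha> * (LINT u:{a<..<x}|lborel. lker \<alpha> f x u))"
  unfolding frac_deriv_left_def by (subst set_integral_lebesgue_eq_lborel) auto

lemma frac_deriv_left_measurable [measurable]:
  assumes [measurable]: "f \<in> borel_measurable borel"
  shows "frac_deriv_left \<alpha> a f \<in> borel_measurable borel"
proof -
  have eq: "(LINT u:{a<..<x}|lborel. lker \<alpha> f x u) =
      (LINT u|lborel. (if a < u \<and> u < x then lker \<alpha> f x u else 0))" for x
    unfolding set_lebesgue_integral_def by (intro Bochner_Integration.integral_cong) auto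
  have "(\<lambda>x. 1 / Gamma (1 - \<alpha>) * (f x / (x - a) powr \<alpha> +
       \<alpha> * (LINT u|lborel. (if a < u \<and> u < x then lker \<alpha> f x u else 0))))
     \<in> borel_measurable borel"
    by measurable
  then show ?thesis
    unfolding frac_deriv_left_lborel[OF assms, abs_def] eq .
qed

lemma nn_integral_norm_lker:
  "(\<integral>\<^sup>+u. ennreal (norm (indicat_real {0<..<x} u *\<^sub>R (lker \<alpha> f x u))) \<partial>lborel) = frac_inner \<alpha> f x"
  unfolding frac_inner_def by (intro nn_integral_cong) (auto split: split_indicator)

lemma frac_inner_finite_imp_integrable:
  assumes [measurable]: "f \<in> borel_measurable borel" and fin: "frac_inner \<alpha> f x < \<infinity>"
  shows "set_integrable lborel {0<..<x} (\<lambda>u. lker \<alpha> f x u)"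
  unfolding set_integrable_def by (rule integrableI_bounded) (use fin in \<open>simp_all only: nn_integral_norm_lker, measurable\<close>)

text \<open>Where the inner integral diverges, the right-hand side is infinite.\<close>

lemma frac_deriv_left_bound:
  assumes [measurable]: "f \<in> borel_measurable borel" and \<alpha>: "0 < \<alpha>" "\<alpha> < 1" and "0 < x"
  shows "ennreal \<bar>frac_deriv_left \<alpha> 0 f x\<bar> \<le>
    ennreal (1 / Gamma (1 - \<alpha>)) * (ennreal (\<bar>f x\<bar> / x powr \<alpha>) + frac_inner \<alpha> f x)"
proof (cases "frac_inner \<alpha> f x < \<infinity>")
  case True
  let ?I = "LINT u:{0<..<x}|lborel. lker \<alpha> f x u"
  have G: "0 < Gamma (1 - \<alpha>)" using \<alpha> by (intro Gamma_real_pos) auto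
  have "ennreal \<bar>?I\<bar> \<le> frac_inner \<alpha> f x"
  proof -
    have "ennreal (norm ?I) \<le> (\<integral>\<^sup>+u. ennreal (norm (indicat_real {0<..<x} u *\<^sub>R (lker \<alpha> f x u))) \<partial>lborel)"
      unfolding set_lebesgue_integral_def
      using frac_inner_finite_imp_integrable[OF assms(1) True]
      by (intro integral_norm_bound_ennreal) (auto simp: set_integrable_def)
    also note nn_integral_norm_lker
    finally show ?thesis by simp
  qed
  moreover have "ennreal (\<alpha> * \<bar>?I\<bar>) \<le> ennreal \<bar>?I\<bar>"
    using \<alpha> by (intro ennreal_leI mult_left_le_one_le) auto
  ultimately have *: "ennreal (\<alpha> * \<bar>?I\<bar>) \<le> frac_inner \<alpha> f x" by (rule order_trans[rotated])
  have "\<bar>frac_deriv_left \<alpha> 0 f x\<bar> \<le> 1 / Gamma (1 - \<alpha>) * (\<bar>f x\<bar> / x powr \<alpha> + \<alpha> * \<bar>?I\<bar>)"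
  proof -
    have "\<bar>f x / (x - 0) powr \<alpha> + \<alpha> * ?I\<bar> \<le> \<bar>f x / x powr \<alpha>\<bar> + \<bar>\<alpha> * ?I\<bar>"
      using abs_triangle_ineq[of "f x / x powr \<alpha>" "\<alpha> * ?I"] by simp
    also have "\<dots> = \<bar>f x\<bar> / x powr \<alpha> + \<alpha> * \<bar>?I\<bar>" using \<alpha> by (simp add: abs_mult)
    finally show ?thesis
      unfolding frac_deriv_left_lborel[OF assms(1)] abs_mult using G
      by (intro mult_mono) auto
  qed
  then have "ennreal \<bar>frac_deriv_left \<alpha> 0 f x\<bar> \<le> ennreal (1 / Gamma (1 - \<alpha>) * (\<bar>f x\<bar> / x powr \<alpha> + \<alpha> * \<bar>?I\<bar>))"
    by (rule ennreal_leI)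
  also have "\<dots> = ennreal (1 / Gamma (1 - \<alpha>)) * (ennreal (\<bar>f x\<bar> / x powr \<alpha>) + ennreal (\<alpha> * \<bar>?I\<bar>))"
  proof -
    have p: "0 \<le> \<bar>f x\<bar> / x powr \<alpha>" "0 \<le> \<alpha> * \<bar>?I\<bar>" "0 \<le> 1 / Gamma (1 - \<alpha>)" using G \<alpha> by auto
    show ?thesis by (simp only: ennreal_plus[OF p(1,2)] ennreal_mult'[OF p(3)])
  qed
  also have "\<dots> \<le> ennreal (1 / Gamma (1 - \<alpha>)) * (ennreal (\<bar>f x\<bar> / x powr \<alpha>) + frac_inner \<alpha> f x)"
    by (intro mult_left_mono add_left_mono *) simp
  finally show ?thesis .
next
  case False
  have "0 < Gamma (1 - \<alpha>)" using \<alpha> by (intro Gamma_real_pos) auto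
  with False show ?thesis by (simp add: ennreal_mult_top not_less top_unique)
qed

lemma AE_frac_inner_finite:
  assumes [measurable]: "f \<in> borel_measurable borel" and fin: "frac_nn \<alpha> T f < \<infinity>"
  shows "AE x in lborel. x \<in> {0<..<T} \<longrightarrow> frac_inner \<alpha> f x < \<infinity>"
proof -
  have "AE x in lborel. (ennreal (\<bar>f x\<bar> / x powr \<alpha>) + frac_inner \<alpha> f x) * indicator {0<..<T} x \<noteq> \<infinity>"
    using fin unfolding frac_nn_def by (intro nn_integral_noteq_infinite) auto
  then show ?thesis
    by eventually_elim (auto simp: less_top)
qed

lemma nn_integral_frac_deriv_left:
  assumes [measurable]: "f \<in> borel_measurable borel" and \<alpha>: "0 < \<alpha>" "\<alpha> < 1"
  shows "(\<integral>\<^sup>+x. ennreal \<bar>indicat_real {0<..<T} x * frac_deriv_left \<alpha> 0 f x\<bar> \<partial>lborel)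
    \<le> ennreal (1 / Gamma (1 - \<alpha>)) * frac_nn \<alpha> T f"
proof -
  have "(\<integral>\<^sup>+x. ennreal \<bar>indicat_real {0<..<T} x * frac_deriv_left \<alpha> 0 f x\<bar> \<partial>lborel) \<le>
    (\<integral>\<^sup>+x. ennreal (1 / Gamma (1 - \<alpha>)) * ((ennreal (\<bar>f x\<bar> / x powr \<alpha>) + frac_inner \<alpha> f x) * indicator {0<..<T} x) \<partial>lborel)"
    using frac_deriv_left_bound[OF assms] by (intro nn_integral_mono) (auto split: split_indicator)
  also have "\<dots> = ennreal (1 / Gamma (1 - \<alpha>)) * frac_nn \<alpha> T f"
    unfolding frac_nn_def by (rule nn_integral_cmult) measurable
  finally show ?thesis .
qed

lemma frac_deriv_left_L1I:
  assumes [measurable]: "f \<in> borel_measurable borel" and \<alpha>: "0 < \<alpha>" "\<alpha> < 1" and fin: "frac_nn \<alpha> T f < \<infinity>"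
  shows "frac_deriv_left_L1 \<alpha> 0 T f" "set_integrable lborel {0<..<T} (frac_deriv_left \<alpha> 0 f)"
proof -
  show i: "set_integrable lborel {0<..<T} (frac_deriv_left \<alpha> 0 f)"
    unfolding set_integrable_def
  proof (rule integrableI_bounded)
    have "ennreal (1 / Gamma (1 - \<alpha>)) * frac_nn \<alpha> T f < \<infinity>"
      using fin by (simp add: ennreal_mult_less_top)
    with nn_integral_frac_deriv_left[OF assms(1-3), of T]
    show "(\<integral>\<^sup>+x. ennreal (norm (indicat_real {0<..<T} x *\<^sub>R frac_deriv_left \<alpha> 0 f x)) \<partial>lborel) < \<infinity>"
      by simp
  qed simp
  have "AE x in lebesgue. x \<in> {0<..<T} \<longrightarrow> frac_inner \<alpha> f x < \<infinity>"
    using AE_frac_inner_finite[OF assms(1) fin] by (rule AE_completion)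
  then have "AE x in lebesgue. x \<in> {0<..<T} \<longrightarrow> set_integrable lebesgue {0<..<x} (\<lambda>u. lker \<alpha> f x u)"
    by eventually_elim (auto simp: set_integrable_lebesgue_eq_lborel intro!: frac_inner_finite_imp_integrable)
  then show "frac_deriv_left_L1 \<alpha> 0 T f"
    using i unfolding frac_deriv_left_L1_def by (simp add: set_integrable_lebesgue_eq_lborel)
qed

lemma AE_frac_deriv_left_add:
  assumes [measurable]: "f \<in> borel_measurable borel" "g \<in> borel_measurable borel"
    and fin: "frac_nn \<alpha> T f < \<infinity>" "frac_nn \<alpha> T g < \<infinity>"
  shows "AE x in lborel. x \<in> {0<..<T} \<longrightarrow>
    frac_deriv_left \<alpha> 0 (\<lambda>s. f s + g s) x = frac_deriv_left \<alpha> 0 f x + frac_deriv_left \<alpha> 0 g x"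
  using AE_frac_inner_finite[OF assms(1) fin(1)] AE_frac_inner_finite[OF assms(2) fin(2)]
proof eventually_elim
  case (elim x)
  show ?case
  proof
    assume x: "x \<in> {0<..<T}"
    have e: "(f x + g x - (f u + g u)) / (x - u) powr (1 + \<alpha>) =
        lker \<alpha> f x u + lker \<alpha> g x u" for u
      by (simp add: add_divide_distrib[symmetric])
    have "(LINT u:{0<..<x}|lborel. (f x + g x - (f u + g u)) / (x - u) powr (1 + \<alpha>)) =
        (LINT u:{0<..<x}|lborel. lker \<alpha> f x u) +
        (LINT u:{0<..<x}|lborel. lker \<alpha> g x u)"
      unfolding e using x elim by (intro set_integral_add frac_inner_finite_imp_integrable) auto
    then show "frac_deriv_left \<alpha> 0 (\<lambda>s. f s + g s) x = frac_deriv_left \<alpha> 0 f x + frac_deriv_left \<alpha> 0 g x"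
      by (simp add: frac_deriv_left_lborel add_divide_distrib distrib_left)
  qed
qed

lemma frac_deriv_left_cmult:
  "frac_deriv_left \<alpha> a (\<lambda>s. c * f s) x = c * frac_deriv_left \<alpha> a f x"
  unfolding frac_deriv_left_def right_diff_distrib[symmetric] times_divide_eq_right[symmetric]
  by (simp add: distrib_left mult.left_commute del: times_divide_eq_right)

lemma enn2real_tail_tendsto_0:
  fixes g :: "nat \<Rightarrow> ennreal"
  assumes fin: "(\<Sum>n. g n) < \<infinity>"
  shows "(\<lambda>n. enn2real (\<Sum>k. g (k + n))) \<longlonglongrightarrow> 0"
proof -
  have split: "(\<Sum>n. g n) = (\<Sum>k. g (k + n)) + (\<Sum>i<n. g i)" for n
    by (rule suminf_offset) (simp add: summableI)
  have "(\<Sum>k. g (k + n)) < \<infinity>" "(\<Sum>i<n. g i) < \<infinity>" for n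
    using fin unfolding split[of n] by auto
  then have en: "enn2real (\<Sum>n. g n) = enn2real (\<Sum>k. g (k + n)) + enn2real (\<Sum>i<n. g i)" for n
    unfolding split[of n] by (intro enn2real_plus) auto
  then have e: "enn2real (\<Sum>k. g (k + n)) = enn2real (\<Sum>n. g n) - enn2real (\<Sum>i<n. g i)" for n
    using en[of n] by linarith
  have lim: "(\<lambda>n. \<Sum>i<n. g i) \<longlonglongrightarrow> (\<Sum>n. g n)"
    using summableI[of g] by (rule summable_LIMSEQ)
  have "(\<lambda>n. enn2real (\<Sum>n. g n) - enn2real (\<Sum>i<n. g i)) \<longlonglongrightarrow> enn2real (\<Sum>n. g n) - enn2real (\<Sum>n. g n)"
    using fin lim by (intro tendsto_diff tendsto_const tendsto_enn2real) auto
  then show ?thesis unfolding e by simp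
qed

text \<open>The integrator enters the integral only through its right-sided fractional derivative, which for
  a Hoelder path is a bounded function \<open>w\<close>. The functional \<open>L\<close> below is the integral seen
  as a function of the integrand alone.\<close>

locale bounded_weight =
  fixes \<alpha> T C :: real and w :: "real \<Rightarrow> real"
  assumes \<alpha>: "0 < \<alpha>" "\<alpha> < 1"
    and w_measurable [measurable]: "w \<in> borel_measurable borel"
    and w_bound: "\<And>x. x \<in> {0<..<T} \<Longrightarrow> \<bar>w x\<bar> \<le> C" and C_nonneg: "0 \<le> C"
begin

definition L :: "(real \<Rightarrow> real) \<Rightarrow> real" where
  "L f = (LINT x:{0<..<T}|lborel. frac_deriv_left \<alpha> 0 f x * w x)"

lemma L_integrable:
  assumes [measurable]: "f \<in> borel_measurable borel" and fin: "frac_nn \<alpha> T f < \<infinity>"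
  shows "set_integrable lborel {0<..<T} (\<lambda>x. frac_deriv_left \<alpha> 0 f x * w x)"
proof -
  have "integrable lborel (\<lambda>x. C * (indicat_real {0<..<T} x *\<^sub>R frac_deriv_left \<alpha> 0 f x))"
    using frac_deriv_left_L1I(2)[OF assms(1) \<alpha> fin] unfolding set_integrable_def by simp
  then show ?thesis
    unfolding set_integrable_def
  proof (rule Bochner_Integration.integrable_bound)
    have "\<bar>frac_deriv_left \<alpha> 0 f x * w x\<bar> \<le> \<bar>C * frac_deriv_left \<alpha> 0 f x\<bar>" if "x \<in> {0<..<T}" for x
      using w_bound[OF that] C_nonneg by (simp add: abs_mult mult.commute[of _ "\<bar>w x\<bar>"] mult_right_mono)
    then show "AE x in lborel. norm (indicat_real {0<..<T} x *\<^sub>R (frac_deriv_left \<alpha> 0 f x * w x))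
       \<le> norm (C * (indicat_real {0<..<T} x *\<^sub>R frac_deriv_left \<alpha> 0 f x))"
      by (intro AE_I2) (auto split: split_indicator)
  qed simp
qed

lemma L_bound:
  assumes [measurable]: "f \<in> borel_measurable borel" and fin: "frac_nn \<alpha> T f < \<infinity>"
  shows "ennreal \<bar>L f\<bar> \<le> ennreal (C / Gamma (1 - \<alpha>)) * frac_nn \<alpha> T f"
proof -
  let ?f = "\<lambda>x. indicat_real {0<..<T} x * frac_deriv_left \<alpha> 0 f x"
  have "ennreal (norm (L f)) \<le> (\<integral>\<^sup>+x. ennreal (norm (indicat_real {0<..<T} x *\<^sub>R (frac_deriv_left \<alpha> 0 f x * w x))) \<partial>lborel)"
    unfolding L_def set_lebesgue_integral_def
    using L_integrable[OF assms] by (intro integral_norm_bound_ennreal) (simp add: set_integrable_def)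
  also have "\<dots> \<le> (\<integral>\<^sup>+x. ennreal C * ennreal \<bar>?f x\<bar> \<partial>lborel)"
    using w_bound C_nonneg
    by (intro nn_integral_mono)
       (auto split: split_indicator simp: abs_mult ennreal_mult'[symmetric] mult.commute[of _ "\<bar>w _\<bar>"] intro!: ennreal_leI mult_right_mono)
  also have "\<dots> = ennreal C * (\<integral>\<^sup>+x. ennreal \<bar>?f x\<bar> \<partial>lborel)"
    by (rule nn_integral_cmult) measurable
  also have "\<dots> \<le> ennreal C * (ennreal (1 / Gamma (1 - \<alpha>)) * frac_nn \<alpha> T f)"
    by (intro mult_left_mono nn_integral_frac_deriv_left \<alpha> assms) simp
  also have "\<dots> = ennreal (C / Gamma (1 - \<alpha>)) * frac_nn \<alpha> T f"
    using C_nonneg \<alpha> by (simp add: mult.assoc[symmetric] ennreal_mult'[symmetric])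
  finally show ?thesis by simp
qed

lemma L_add:
  assumes [measurable]: "f \<in> borel_measurable borel" "g \<in> borel_measurable borel"
    and fin: "frac_nn \<alpha> T f < \<infinity>" "frac_nn \<alpha> T g < \<infinity>"
  shows "L (\<lambda>s. f s + g s) = L f + L g"
proof -
  have "L (\<lambda>s. f s + g s) = (LINT x:{0<..<T}|lborel. frac_deriv_left \<alpha> 0 f x * w x + frac_deriv_left \<alpha> 0 g x * w x)"
    unfolding L_def using AE_frac_deriv_left_add[OF assms]
    by (intro set_lebesgue_integral_cong_AE) (auto simp: distrib_right)
  also have "\<dots> = L f + L g"
    unfolding L_def by (intro set_integral_add L_integrable assms)
  finally show ?thesis .
qed

lemma L_cmult: "L (\<lambda>s. c * f s) = c * L f"
  unfolding L_def frac_deriv_left_cmult by (simp add: mult.assoc)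

lemma L_zero [simp]: "L (\<lambda>_. 0) = 0"
  using L_cmult[of 0 "\<lambda>_. 0"] by simp

lemma frac_nn_sum_finite:
  fixes f :: "nat \<Rightarrow> real \<Rightarrow> real"
  assumes "\<And>i. i < n \<Longrightarrow> f i \<in> borel_measurable borel" "\<And>i. i < n \<Longrightarrow> frac_nn \<alpha> T (f i) < \<infinity>"
  shows "frac_nn \<alpha> T (\<lambda>s. \<Sum>i<n. f i s) < \<infinity>"
proof -
  have "frac_nn \<alpha> T (\<lambda>s. \<Sum>i<n. f i s) \<le> (\<Sum>i<n. frac_nn \<alpha> T (f i))"
    by (rule frac_nn_sum) (use assms in auto)
  also have "\<dots> < \<infinity>" using assms by simp
  finally show ?thesis .
qed

lemma L_sum:
  fixes f :: "nat \<Rightarrow> real \<Rightarrow> real"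
  assumes "\<And>i. i < n \<Longrightarrow> f i \<in> borel_measurable borel" "\<And>i. i < n \<Longrightarrow> frac_nn \<alpha> T (f i) < \<infinity>"
  shows "L (\<lambda>s. \<Sum>i<n. f i s) = (\<Sum>i<n. L (f i))"
  using assms
proof (induction n)
  case (Suc n)
  have "L (\<lambda>s. (\<Sum>i<n. f i s) + f n s) = L (\<lambda>s. \<Sum>i<n. f i s) + L (f n)"
    by (intro L_add borel_measurable_sum frac_nn_sum_finite) (use Suc.prems in auto)
  then show ?case using Suc by simp
qed simp

text \<open>The remainder after \<open>n\<close> terms is itself a convergent series, whose norm is bounded by a tail of
  the series of norms; continuity of \<open>L\<close> then gives countable additivity.\<close>

lemma L_series:
  assumes [measurable]: "\<And>n. f n \<in> borel_measurable borel"
    and S: "\<And>s. (\<lambda>n. f n s) sums F s" and fin: "(\<Sum>n. frac_nn \<alpha> T (f n)) < \<infinity>"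
  shows "(\<lambda>n. L (f n)) sums L F"
proof -
  have [measurable]: "F \<in> borel_measurable borel"
    by (rule borel_measurable_LIMSEQ_real[OF S[unfolded sums_def]]) simp
  have finn: "frac_nn \<alpha> T (f n) < \<infinity>" for n
  proof (rule ccontr)
    assume "\<not> frac_nn \<alpha> T (f n) < \<infinity>"
    moreover have "(\<Sum>i\<in>{n}. frac_nn \<alpha> T (f i)) \<le> (\<Sum>n. frac_nn \<alpha> T (f n))"
      by (intro sum_le_suminf) auto
    ultimately show False using fin by (simp add: not_less top_unique)
  qed
  have S': "(\<lambda>k. f (k + n) s) sums (F s - (\<Sum>i<n. f i s))" for n s
    using S by (subst sums_iff_shift) simp
  have R: "frac_nn \<alpha> T (\<lambda>s. F s - (\<Sum>i<n. f i s)) \<le> (\<Sum>k. frac_nn \<alpha> T (f (k + n)))" for n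
    by (rule frac_nn_series[OF _ S']) simp
  let ?t = "\<lambda>n. \<Sum>k. frac_nn \<alpha> T (f (k + n))"
  have bnd: "\<bar>L F - (\<Sum>i<n. L (f i))\<bar> \<le> C / Gamma (1 - \<alpha>) * enn2real (?t n)" for n
  proof -
    have tf: "?t n < \<infinity>"
      using fin by (subst (asm) suminf_offset[OF summableI, of _ n]) simp
    have lt: "frac_nn \<alpha> T (\<lambda>s. F s - (\<Sum>i<n. f i s)) < \<infinity>"
      using R[of n] tf by (rule order_le_less_trans)
    have "L F = L (\<lambda>s. (F s - (\<Sum>i<n. f i s)) + (\<Sum>i<n. f i s))" by simp
    also have "\<dots> = L (\<lambda>s. F s - (\<Sum>i<n. f i s)) + L (\<lambda>s. \<Sum>i<n. f i s)"
      by (intro L_add lt frac_nn_sum_finite finn) auto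
    also have "L (\<lambda>s. \<Sum>i<n. f i s) = (\<Sum>i<n. L (f i))"
      by (intro L_sum finn) auto
    finally have "ennreal \<bar>L F - (\<Sum>i<n. L (f i))\<bar> = ennreal \<bar>L (\<lambda>s. F s - (\<Sum>i<n. f i s))\<bar>"
      by simp
    also have "\<dots> \<le> ennreal (C / Gamma (1 - \<alpha>)) * frac_nn \<alpha> T (\<lambda>s. F s - (\<Sum>i<n. f i s))"
      by (rule L_bound[OF _ lt]) simp
    also have "\<dots> \<le> ennreal (C / Gamma (1 - \<alpha>)) * ?t n"
      by (intro mult_left_mono R) simp
    also have "\<dots> = ennreal (C / Gamma (1 - \<alpha>) * enn2real (?t n))"
    proof -
      have "ennreal (C / Gamma (1 - \<alpha>)) * ?t n =
          ennreal (C / Gamma (1 - \<alpha>)) * ennreal (enn2real (?t n))"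
        using tf by simp
      then show ?thesis by (simp only: ennreal_mult''[OF enn2real_nonneg])
    qed
    finally show ?thesis
      using C_nonneg \<alpha> by (subst (asm) ennreal_le_iff) (auto intro!: mult_nonneg_nonneg divide_nonneg_pos Gamma_real_pos)
  qed
  have "(\<lambda>n. L F - (\<Sum>i<n. L (f i))) \<longlonglongrightarrow> 0"
  proof (rule Lim_null_comparison)
    show "\<forall>\<^sub>F n in sequentially. norm (L F - (\<Sum>i<n. L (f i))) \<le> C / Gamma (1 - \<alpha>) * enn2real (?t n)"
      unfolding real_norm_def by (rule always_eventually, rule allI, rule bnd)
    have "(\<lambda>n. C / Gamma (1 - \<alpha>) * enn2real (?t n)) \<longlonglongrightarrow> C / Gamma (1 - \<alpha>) * 0"
      by (rule tendsto_mult[OF tendsto_const enn2real_tail_tendsto_0[OF fin]])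
    then show "(\<lambda>n. C / Gamma (1 - \<alpha>) * enn2real (?t n)) \<longlonglongrightarrow> 0"
      by simp
  qed
  then have "(\<lambda>n. L F - (L F - (\<Sum>i<n. L (f i)))) \<longlonglongrightarrow> L F - 0"
    by (intro tendsto_diff tendsto_const)
  then show ?thesis by (simp add: sums_def)
qed

end

section \<open>Inversion of the right-sided fractional derivative\<close>

lemma powr_above_integral:
  fixes c b p :: real
  assumes "-1 < p" "c \<le> b"
  shows "set_integrable lborel {c<..<b} (\<lambda>u. (u - c) powr p)"
    and "(LINT u:{c<..<b}|lborel. (u - c) powr p) = (b - c) powr (p + 1) / (p + 1)"
proof -
  have "has_bochner_integral lborel (\<lambda>u. indicat_real {c<..<b} u *\<^sub>R (u - c) powr p) ((b - c) powr (p + 1) / (p + 1))"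
  proof (rule has_bochner_integral_nn_integral)
    have "(\<integral>\<^sup>+u. ennreal (indicat_real {c<..<b} u *\<^sub>R (u - c) powr p) \<partial>lborel) = (\<integral>\<^sup>+u\<in>{c<..<b}. ennreal ((u - c) powr p) \<partial>lborel)"
      by (intro nn_integral_cong) (auto split: split_indicator)
    then show "(\<integral>\<^sup>+u. ennreal (indicat_real {c<..<b} u *\<^sub>R (u - c) powr p) \<partial>lborel) = ennreal ((b - c) powr (p + 1) / (p + 1))"
      using nn_integral_powr_above[OF assms] by simp
  qed (use assms in auto)
  then show "set_integrable lborel {c<..<b} (\<lambda>u. (u - c) powr p)"
    "(LINT u:{c<..<b}|lborel. (u - c) powr p) = (b - c) powr (p + 1) / (p + 1)"
    unfolding set_integrable_def set_lebesgue_integral_def by (auto simp: has_bochner_integral_iff)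
qed

text \<open>The composition of the kernels of two fractional integrals of orders adding up to 1 is constant:
  this is Euler's Beta integral after an affine substitution.\<close>

lemma nn_integral_beta_kernel:
  fixes a u \<alpha> :: real
  assumes "0 < \<alpha>" "\<alpha> < 1" "a < u"
  shows "(\<integral>\<^sup>+x\<in>{a<..<u}. ennreal ((x - a) powr (- \<alpha>) * (u - x) powr (\<alpha> - 1)) \<partial>lborel) = ennreal (Gamma (1 - \<alpha>) * Gamma \<alpha>)"
proof -
  let ?g = "\<lambda>t. ((a + (u - a) * t) - a) powr (- \<alpha>) * (u - (a + (u - a) * t)) powr (\<alpha> - 1)"
  let ?B = "\<lambda>t :: real. t powr ((1 - \<alpha>) - 1) * (1 - t) powr (\<alpha> - 1)"
  have "(\<integral>\<^sup>+x\<in>{a<..<u}. ennreal ((x - a) powr (- \<alpha>) * (u - x) powr (\<alpha> - 1)) \<partial>lborel) =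
    ennreal \<bar>u - a\<bar> * (\<integral>\<^sup>+t. ennreal (?g t) *
       indicator {a<..<u} (a + (u - a) * t) \<partial>lborel)"
    using assms by (intro nn_integral_real_affine) auto
  also have "\<dots> = (\<integral>\<^sup>+t. ennreal \<bar>u - a\<bar> * (ennreal (?g t) *
       indicator {a<..<u} (a + (u - a) * t)) \<partial>lborel)"
    by (rule nn_integral_cmult[symmetric]) measurable
  also have "\<dots> = (\<integral>\<^sup>+t. ennreal (?B t) * indicator {0..1} t \<partial>lborel)"
  proof (intro nn_integral_cong_AE, use AE_lborel_singleton[of 0] AE_lborel_singleton[of 1] in eventually_elim)
    fix t :: real assume t: "t \<noteq> 0" "t \<noteq> 1"
    have ind: "indicator {a<..<u} (a + (u - a) * t) = (indicator {0..1} t :: ennreal)"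
      using assms t by (auto split: split_indicator simp: zero_less_mult_iff)
        (smt (verit, ccfv_SIG) mult_le_cancel_left1 mult_less_cancel_left1 mult_left_le)+
    show "ennreal \<bar>u - a\<bar> * (ennreal (?g t) *
       indicator {a<..<u} (a + (u - a) * t)) = ennreal (?B t) * indicator {0..1} t"
    proof (cases "t \<in> {0..1}")
      case True
      have "u - (a + (u - a) * t) = (u - a) * (1 - t)" by (simp add: algebra_simps)
      then have "(u - a) * (?g t) =
          ((u - a) powr 1 * (u - a) powr (- \<alpha>) * (u - a) powr (\<alpha> - 1)) * ?B t"
        using assms True by (simp add: powr_mult)
      also have "(u - a) powr 1 * (u - a) powr (- \<alpha>) * (u - a) powr (\<alpha> - 1) = 1"
        using assms by (simp only: powr_add[symmetric]) simp
      finally show ?thesis unfolding ind using True assms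
        by (simp add: ennreal_mult'[symmetric])
    qed (simp add: ind)
  qed
  also have "\<dots> = ennreal (Beta (1 - \<alpha>) \<alpha>)"
    using has_integral_Beta_real[of "1 - \<alpha>" \<alpha>] assms by (intro nn_integral_has_integral_lebesgue') auto
  also have "Beta (1 - \<alpha>) \<alpha> = Gamma (1 - \<alpha>) * Gamma \<alpha>"
    by (simp add: Beta_def)
  finally show ?thesis .
qed

lemma frac_deriv_right_lborel:
  assumes [measurable]: "h \<in> borel_measurable borel"
  shows "frac_deriv_right \<beta> b h x = 1 / Gamma (1 - \<beta>) * (h x / (b - x) powr \<beta> +
       \<beta> * (LINT u:{x<..<b}|lborel. rker \<beta> h x u))"
  unfolding frac_deriv_right_def by (subst set_integral_lebesgue_eq_lborel) auto

lemma frac_deriv_right_measurable [measurable]: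
  assumes [measurable]: "h \<in> borel_measurable borel"
  shows "frac_deriv_right \<beta> b h \<in> borel_measurable borel"
proof -
  have eq: "(LINT u:{x<..<b}|lborel. rker \<beta> h x u) =
      (LINT u|lborel. (if x < u \<and> u < b then rker \<beta> h x u else 0))" for x
    unfolding set_lebesgue_integral_def by (intro Bochner_Integration.integral_cong) auto
  have "(\<lambda>x. 1 / Gamma (1 - \<beta>) * (h x / (b - x) powr \<beta> +
       \<beta> * (LINT u|lborel. (if x < u \<and> u < b then rker \<beta> h x u else 0))))
     \<in> borel_measurable borel"
    by measurable
  then show ?thesis
    unfolding frac_deriv_right_lborel[OF assms, abs_def] eq .
qed

lemma holder_continuous:
  fixes h :: "real \<Rightarrow> real"
  assumes "0 < \<gamma>" and "\<And>x y. \<bar>h x - h y\<bar> \<le> K * \<bar>x - y\<bar> powr \<gamma>"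
  shows "continuous_on UNIV h"
proof (rule continuous_at_imp_continuous_on, rule ballI)
  fix x
  have "((\<lambda>y. K * \<bar>y - x\<bar> powr \<gamma>) \<longlongrightarrow> K * \<bar>x - x\<bar> powr \<gamma>) (at x)"
    using assms(1) by (intro tendsto_intros tendsto_powr') auto
  then have "((\<lambda>y. K * \<bar>y - x\<bar> powr \<gamma>) \<longlongrightarrow> 0) (at x)" using assms(1) by simp
  then have "((\<lambda>y. h y - h x) \<longlongrightarrow> 0) (at x)"
    by (rule Lim_null_comparison[rotated]) (use assms(2) in \<open>auto intro!: always_eventually\<close>)
  then show "isCont h x" unfolding isCont_def by (simp add: LIM_zero_iff)
qed

text \<open>The function \<open>h\<close> stands for the integrator minus its value at the right end point.\<close>

locale holder_fun =
  fixes h :: "real \<Rightarrow> real" and K \<gamma> \<beta> T :: real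
  assumes holder: "\<And>x y. \<bar>h x - h y\<bar> \<le> K * \<bar>x - y\<bar> powr \<gamma>"
    and K: "0 \<le> K" and \<beta>: "0 < \<beta>" "\<beta> < 1" and \<gamma>: "\<beta> < \<gamma>" and hT: "h T = 0"
begin

lemma h_continuous: "continuous_on A h"
  using holder_continuous[OF _ holder] \<beta> \<gamma> by (auto intro: continuous_on_subset)

lemma h_measurable [measurable]: "h \<in> borel_measurable borel"
  by (intro borel_measurable_continuous_onI h_continuous)

lemma kernel_bound:
  assumes "x < u"
  shows "\<bar>rker \<beta> h x u\<bar> \<le> K * (u - x) powr (\<gamma> - \<beta> - 1)"
proof -
  have "\<bar>rker \<beta> h x u\<bar> \<le> K * (u - x) powr \<gamma> / (u - x) powr (1 + \<beta>)"
    using holder[of x u] assms by (simp add: abs_divide abs_minus_commute divide_right_mono)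
  also have "\<dots> = K * (u - x) powr (\<gamma> - \<beta> - 1)"
  proof -
    have "\<gamma> - \<beta> - 1 = \<gamma> - (1 + \<beta>)" by simp
    then show ?thesis by (simp only: powr_diff times_divide_eq_right)
  qed
  finally show ?thesis .
qed

lemma kernel_integrable:
  assumes "x \<le> b"
  shows "set_integrable lborel {x<..<b} (\<lambda>u. rker \<beta> h x u)"
proof -
  have "set_integrable lborel {x<..<b} (\<lambda>u. K * (u - x) powr (\<gamma> - \<beta> - 1))"
    using powr_above_integral(1)[of "\<gamma> - \<beta> - 1" x b] \<gamma> assms by simp
  then show ?thesis
  proof (rule set_integrable_bound)
    show "set_borel_measurable lborel {x<..<b} (\<lambda>u. rker \<beta> h x u)"
      unfolding set_borel_measurable_def by simp
    show "AE u in lborel. u \<in> {x<..<b} \<longrightarrow> norm (rker \<beta> h x u) \<le> norm (K * (u - x) powr (\<gamma> - \<beta> - 1))"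
      using kernel_bound K by (auto simp: abs_mult)
  qed
qed

lemma kernel_integral_bound:
  assumes "x \<le> b"
  shows "\<bar>LINT u:{x<..<b}|lborel. rker \<beta> h x u\<bar> \<le> K * (b - x) powr (\<gamma> - \<beta>) / (\<gamma> - \<beta>)"
proof -
  have "norm (LINT u:{x<..<b}|lborel. rker \<beta> h x u)
     \<le> (LINT u:{x<..<b}|lborel. K * (u - x) powr (\<gamma> - \<beta> - 1))"
    unfolding set_lebesgue_integral_def
  proof (rule order_trans[OF integral_norm_bound], rule integral_mono)
    show "integrable lborel (\<lambda>u. norm (indicat_real {x<..<b} u *\<^sub>R (rker \<beta> h x u)))"
      using kernel_integrable[OF assms] unfolding set_integrable_def by (rule integrable_norm)
    show "integrable lborel (\<lambda>u. indicat_real {x<..<b} u *\<^sub>R (K * (u - x) powr (\<gamma> - \<beta> - 1)))"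
      using powr_above_integral(1)[of "\<gamma> - \<beta> - 1" x b] \<gamma> assms
      unfolding set_integrable_def[symmetric] by simp
  qed (use kernel_bound in \<open>auto split: split_indicator\<close>)
  also have "\<dots> = K * (b - x) powr (\<gamma> - \<beta>) / (\<gamma> - \<beta>)"
    using powr_above_integral(2)[of "\<gamma> - \<beta> - 1" x b] \<gamma> assms by simp
  finally show ?thesis by simp
qed

definition wbound :: real where
  "wbound = 1 / Gamma (1 - \<beta>) * (K * T powr (\<gamma> - \<beta>) + \<beta> * (K * T powr (\<gamma> - \<beta>) / (\<gamma> - \<beta>)))"

lemma frac_deriv_right_bound:
  assumes "x \<in> {0<..<T}"
  shows "\<bar>frac_deriv_right \<beta> T h x\<bar> \<le> wbound"
proof -
  have G: "0 < Gamma (1 - \<beta>)" using \<beta> by (intro Gamma_real_pos) auto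
  have mono: "(T - x) powr (\<gamma> - \<beta>) \<le> T powr (\<gamma> - \<beta>)"
    using assms \<gamma> by (intro powr_mono2) auto
  have 1: "\<bar>h x / (T - x) powr \<beta>\<bar> \<le> K * T powr (\<gamma> - \<beta>)"
  proof -
    have "\<bar>h x / (T - x) powr \<beta>\<bar> \<le> K * (T - x) powr \<gamma> / (T - x) powr \<beta>"
      using holder[of x T] hT assms by (simp add: abs_divide abs_minus_commute divide_right_mono)
    also have "\<dots> = K * (T - x) powr (\<gamma> - \<beta>)" by (simp add: powr_diff)
    also have "\<dots> \<le> K * T powr (\<gamma> - \<beta>)" using mono K by (rule mult_left_mono)
    finally show ?thesis .
  qed
  have 2: "\<bar>\<beta> * (LINT u:{x<..<T}|lborel. rker \<beta> h x u)\<bar> \<le> \<beta> * (K * T powr (\<gamma> - \<beta>) / (\<gamma> - \<beta>))"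
  proof -
    have "\<bar>LINT u:{x<..<T}|lborel. rker \<beta> h x u\<bar> \<le> K * (T - x) powr (\<gamma> - \<beta>) / (\<gamma> - \<beta>)"
      using assms by (intro kernel_integral_bound) auto
    also have "\<dots> \<le> K * T powr (\<gamma> - \<beta>) / (\<gamma> - \<beta>)"
      using mono K \<gamma> by (intro divide_right_mono mult_left_mono) auto
    finally show ?thesis unfolding abs_mult using \<beta> by (intro mult_mono) auto
  qed
  have "\<bar>h x / (T - x) powr \<beta> + \<beta> * (LINT u:{x<..<T}|lborel. rker \<beta> h x u)\<bar>
     \<le> K * T powr (\<gamma> - \<beta>) + \<beta> * (K * T powr (\<gamma> - \<beta>) / (\<gamma> - \<beta>))"
    using 1 2 by (rule order_trans[OF abs_triangle_ineq add_mono])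
  then show ?thesis
    unfolding wbound_def frac_deriv_right_lborel[OF h_measurable] abs_mult using G by (intro mult_mono) auto
qed

lemma wbound_nonneg: "0 \<le> wbound"
  unfolding wbound_def using \<beta> \<gamma> K
  by (intro mult_nonneg_nonneg add_nonneg_nonneg divide_nonneg_nonneg) (auto intro!: Gamma_real_pos less_imp_le)

text \<open>Integration by parts turns the singular difference quotient into a fractional integral of the
  derivative. The boundary term at \<open>x\<close> vanishes because \<open>\<beta> < \<gamma>\<close>.\<close>

lemma frac_deriv_right_smooth:
  assumes der: "\<And>x. (h has_real_derivative h' x) (at x)" and cont: "continuous_on UNIV h'" and "x < T"
  shows "frac_deriv_right \<beta> T h x = - 1 / Gamma (1 - \<beta>) * (LINT u:{x<..<T}|lborel. h' u * (u - x) powr (- \<beta>))"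
proof -
  let ?F = "\<lambda>u. (h x - h u) * (u - x) powr (- \<beta>)"
  let ?k = "\<lambda>u. rker \<beta> h x u"
  have [measurable]: "h' \<in> borel_measurable borel"
    using cont by (rule borel_measurable_continuous_onI)
  have cF: "continuous_on {x..T} ?F"
    unfolding continuous_on_def
  proof (rule ballI)
    fix v assume v: "v \<in> {x..T}"
    show "(?F \<longlongrightarrow> ?F v) (at v within {x..T})"
    proof (cases "v = x")
      case True
      have "((\<lambda>u. K * \<bar>u - x\<bar> powr (\<gamma> - \<beta>)) \<longlongrightarrow> K * \<bar>x - x\<bar> powr (\<gamma> - \<beta>)) (at x within {x..T})"
        using \<gamma> by (intro tendsto_intros tendsto_powr') auto
      then have lim: "((\<lambda>u. K * \<bar>u - x\<bar> powr (\<gamma> - \<beta>)) \<longlongrightarrow> 0) (at x within {x..T})"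
        using \<gamma> by simp
      have "norm (?F u) \<le> K * \<bar>u - x\<bar> powr (\<gamma> - \<beta>)" if "u \<in> {x..T}" "u \<noteq> x" for u
      proof -
        have "norm (?F u) \<le> K * (u - x) powr \<gamma> * (u - x) powr (- \<beta>)"
          using holder[of x u] that by (simp add: abs_mult abs_minus_commute mult_right_mono)
        also have "\<dots> = K * \<bar>u - x\<bar> powr (\<gamma> - \<beta>)"
          using that by (simp add: powr_add[symmetric])
        finally show ?thesis .
      qed
      then have "(?F \<longlongrightarrow> 0) (at x within {x..T})"
        by (intro Lim_null_comparison[OF _ lim]) (auto simp: eventually_at_filter)
      then show ?thesis using True by simp
    next
      case False
      have "(h \<longlongrightarrow> h v) (at v within {x..T})"
        using h_continuous[of "{x..T}"] v unfolding continuous_on_def by blast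
      then show ?thesis using False v by (intro tendsto_intros) auto
    qed
  qed
  have dF: "(?F has_vector_derivative (- (h' u * (u - x) powr (- \<beta>)) - \<beta> * ?k u)) (at u)" if "u \<in> {x<..<T}" for u
  proof -
    have "((\<lambda>u. (u - x) powr (- \<beta>)) has_real_derivative (- \<beta> * (u - x) powr (- \<beta> - 1)) * (1 - 0)) (at u)"
      using that by (intro DERIV_chain2[where g = "\<lambda>u. u - x"] has_real_derivative_powr DERIV_diff DERIV_ident DERIV_const) auto
    then have "(?F has_real_derivative (0 - h' u) * (u - x) powr (- \<beta>) + ((- \<beta> * (u - x) powr (- \<beta> - 1)) * (1 - 0)) * (h x - h u)) (at u)"
      by (intro DERIV_mult DERIV_diff DERIV_const der)
    also have "(0 - h' u) * (u - x) powr (- \<beta>) + ((- \<beta> * (u - x) powr (- \<beta> - 1)) * (1 - 0)) * (h x - h u)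
        = - (h' u * (u - x) powr (- \<beta>)) - \<beta> * ?k u"
    proof -
      have "(u - x) powr (- \<beta> - 1) = 1 / (u - x) powr (1 + \<beta>)"
      proof -
        have "- \<beta> - 1 = - (1 + \<beta>)" by simp
        then show ?thesis by (simp only: powr_minus_divide)
      qed
      then show ?thesis by (simp add: algebra_simps)
    qed
    finally show ?thesis by (simp add: has_real_derivative_iff_has_vector_derivative)
  qed
  have "((\<lambda>u. - (h' u * (u - x) powr (- \<beta>)) - \<beta> * ?k u) has_integral (?F T - ?F x)) {x..T}"
    using \<open>x < T\<close> cF dF by (intro fundamental_theorem_of_calculus_interior) auto
  then have hi: "integral {x<..<T} (\<lambda>u. - (h' u * (u - x) powr (- \<beta>)) - \<beta> * ?k u) = ?F T"
    unfolding has_integral_Icc_iff_Ioo by (simp add: integral_unique)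
  have i1: "set_integrable lborel {x<..<T} (\<lambda>u. h' u * (u - x) powr (- \<beta>))"
  proof -
    have "bounded (h' ` {x..T})"
      by (intro compact_imp_bounded compact_continuous_image continuous_on_subset[OF cont]) auto
    then obtain D where "\<forall>u\<in>{x..T}. \<bar>h' u\<bar> \<le> D"
      by (auto simp: bounded_iff)
    then have D: "\<bar>h' u\<bar> \<le> D" if "u \<in> {x..T}" for u using that by blast
    have "set_integrable lborel {x<..<T} (\<lambda>u. D * (u - x) powr (- \<beta>))"
      using powr_above_integral(1)[of "- \<beta>" x T] \<beta> \<open>x < T\<close> by simp
    then show ?thesis
    proof (rule set_integrable_bound)
      show "set_borel_measurable lborel {x<..<T} (\<lambda>u. h' u * (u - x) powr (- \<beta>))"
        unfolding set_borel_measurable_def by simp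
      have "\<bar>h' u\<bar> \<le> \<bar>D\<bar>" if "u \<in> {x<..<T}" for u using D[of u] that by auto
      then show "AE u in lborel. u \<in> {x<..<T} \<longrightarrow> norm (h' u * (u - x) powr (- \<beta>)) \<le> norm (D * (u - x) powr (- \<beta>))"
        by (auto simp: abs_mult intro!: mult_right_mono)
    qed
  qed
  have i2: "set_integrable lborel {x<..<T} (\<lambda>u. \<beta> * ?k u)"
    by (intro set_integrable_mult_right kernel_integrable) (use \<open>x < T\<close> in simp)
  have i12: "set_integrable lborel {x<..<T} (\<lambda>u. - (h' u * (u - x) powr (- \<beta>)) - \<beta> * ?k u)"
    by (intro set_integral_diff(1) i2) (use i1 in \<open>simp add: set_integrable_def\<close>)
  have "?F T = (LINT u:{x<..<T}|lborel. - (h' u * (u - x) powr (- \<beta>)) - \<beta> * ?k u)"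
    using set_borel_integral_eq_integral(2)[OF i12] hi by simp
  also have "\<dots> = (LINT u:{x<..<T}|lborel. - (h' u * (u - x) powr (- \<beta>))) - (LINT u:{x<..<T}|lborel. \<beta> * ?k u)"
    by (intro set_integral_diff(2) i2) (use i1 in \<open>simp add: set_integrable_def\<close>)
  also have "\<dots> = - (LINT u:{x<..<T}|lborel. h' u * (u - x) powr (- \<beta>)) - \<beta> * (LINT u:{x<..<T}|lborel. ?k u)"
    by (simp only: set_integral_uminus[OF i1] set_integral_mult_right)
  finally have "h x / (T - x) powr \<beta> + \<beta> * (LINT u:{x<..<T}|lborel. ?k u) = - (LINT u:{x<..<T}|lborel. h' u * (u - x) powr (- \<beta>))"
    using hT by (simp add: powr_minus_divide)
  then show ?thesis
    unfolding frac_deriv_right_lborel[OF h_measurable] by simp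
qed

text \<open>Fubini's theorem and the Beta integral reduce the identity to the fundamental theorem of calculus.\<close>

lemma inversion_smooth:
  assumes der: "\<And>x. (h has_real_derivative h' x) (at x)" and cont: "continuous_on UNIV h'" and "a < T"
  shows "(LINT x:{a<..<T}|lborel. (x - a) powr (\<beta> - 1) * frac_deriv_right \<beta> T h x) = Gamma \<beta> * h a"
proof -
  let ?\<Gamma> = "Gamma \<beta> * Gamma (1 - \<beta>)"
  have [measurable]: "h' \<in> borel_measurable borel"
    using cont by (rule borel_measurable_continuous_onI)
  have "bounded (h' ` {a..T})"
    by (intro compact_imp_bounded compact_continuous_image continuous_on_subset[OF cont]) auto
  then obtain D where "\<forall>u\<in>{a..T}. \<bar>h' u\<bar> \<le> D"
    by (auto simp: bounded_iff)
  then have D: "\<bar>h' u\<bar> \<le> D" if "u \<in> {a..T}" for u using that by blast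
  define k where "k = (\<lambda>u x. if a < x \<and> x < u then (x - a) powr (\<beta> - 1) * (u - x) powr (- \<beta>) else 0 :: real)"
  define f where "f = (\<lambda>u x. (if u < T then h' u else 0) * k u x)"
  have k_meas [measurable]: "(\<lambda>p. k (fst p) (snd p)) \<in> borel_measurable (lborel \<Otimes>\<^sub>M lborel)" unfolding k_def by measurable
  have f_meas [measurable]: "(\<lambda>p. f (fst p) (snd p)) \<in> borel_measurable (lborel \<Otimes>\<^sub>M lborel)"
    unfolding f_def by measurable
  have k_nonneg: "0 \<le> k u x" for u x unfolding k_def by auto
  have nk: "(\<integral>\<^sup>+x. ennreal (k u x) \<partial>lborel) = ennreal ?\<Gamma> * indicator {a<..} u" for u
  proof (cases "a < u")
    case True
    have "(\<integral>\<^sup>+x. ennreal (k u x) \<partial>lborel) = (\<integral>\<^sup>+x\<in>{a<..<u}. ennreal ((x - a) powr (- (1 - \<beta>)) * (u - x) powr ((1 - \<beta>) - 1)) \<partial>lborel)"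
      by (intro nn_integral_cong) (auto simp: k_def split: split_indicator)
    also have "\<dots> = ennreal ?\<Gamma>"
      using nn_integral_beta_kernel[of "1 - \<beta>" a u] \<beta> True by simp
    finally show ?thesis using True by simp
  next
    case False
    then have "k u x = 0" for x unfolding k_def by auto
    then show ?thesis using False by simp
  qed
  have G: "0 < Gamma \<beta>" "0 < Gamma (1 - \<beta>)" using \<beta> by (auto intro!: Gamma_real_pos)
  have lk: "(LINT x|lborel. k u x) = (if a < u then Gamma \<beta> * Gamma (1 - \<beta>) else 0)" for u
  proof -
    have "k u \<in> borel_measurable lborel" using k_meas by (simp add: k_def)
    then show ?thesis
      using nk[of u] k_nonneg G by (subst integral_eq_nn_integral) (auto split: split_indicator)
  qed
  have "integrable (lborel \<Otimes>\<^sub>M lborel) (case_prod f)"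
  proof (rule integrableI_bounded)
    show "case_prod f \<in> borel_measurable (lborel \<Otimes>\<^sub>M lborel)" using f_meas by (simp add: case_prod_beta')
    have "(\<integral>\<^sup>+p. ennreal (norm (case_prod f p)) \<partial>(lborel \<Otimes>\<^sub>M lborel)) = (\<integral>\<^sup>+u. (\<integral>\<^sup>+x. ennreal (norm (f u x)) \<partial>lborel) \<partial>lborel)"
      using f_meas by (subst lborel.nn_integral_fst[symmetric]) (auto simp: case_prod_beta')
    also have "\<dots> \<le> (\<integral>\<^sup>+u. ennreal (D * ?\<Gamma>) * indicator {a..T} u \<partial>lborel)"
    proof (intro nn_integral_mono)
      fix u
      have "norm (f u x) \<le> D * k u x" if "u \<in> {a..T}" for x
        using D[of u] that k_nonneg[of u x] by (auto simp: f_def abs_mult intro: mult_right_mono)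
      moreover have "f u x = 0" if "u \<notin> {a..T}" for x
        using that by (auto simp: f_def k_def)
      ultimately have "(\<integral>\<^sup>+x. ennreal (norm (f u x)) \<partial>lborel) \<le> (\<integral>\<^sup>+x. ennreal (D * k u x) * indicator {a..T} u \<partial>lborel)"
        by (intro nn_integral_mono) (auto intro!: ennreal_leI split: split_indicator)
      also have "\<dots> \<le> ennreal (D * ?\<Gamma>) * indicator {a..T} u"
      proof (cases "u \<in> {a..T}")
        case True
        then have "0 \<le> D" using D[of u] by auto
        have "(\<lambda>x. ennreal (k u x)) \<in> borel_measurable lborel" unfolding k_def by simp
        then have "(\<integral>\<^sup>+x. ennreal (D * k u x) \<partial>lborel) = ennreal D * (\<integral>\<^sup>+x. ennreal (k u x) \<partial>lborel)"
          using \<open>0 \<le> D\<close> by (simp add: ennreal_mult' nn_integral_cmult)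
        also have "\<dots> \<le> ennreal D * ennreal ?\<Gamma>"
          unfolding nk by (intro mult_left_mono) (auto split: split_indicator)
        also have "\<dots> = ennreal (D * ?\<Gamma>)"
          using \<open>0 \<le> D\<close> by (simp only: ennreal_mult')
        finally show ?thesis using True by simp
      qed simp
      finally show "(\<integral>\<^sup>+x. ennreal (norm (f u x)) \<partial>lborel) \<le> ennreal (D * ?\<Gamma>) * indicator {a..T} u" .
    qed
    also have "\<dots> < \<infinity>" using \<open>a < T\<close> by (simp add: nn_integral_cmult ennreal_mult_less_top)
    finally show "(\<integral>\<^sup>+p. ennreal (norm (case_prod f p)) \<partial>(lborel \<Otimes>\<^sub>M lborel)) < \<infinity>" .
  qed
  then have fub: "(LINT x|lborel. (LINT u|lborel. f u x)) = (LINT u|lborel. (LINT x|lborel. f u x))"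
    by (rule lborel_pair.Fubini_integral)
  have "(LINT x:{a<..<T}|lborel. (x - a) powr (\<beta> - 1) * frac_deriv_right \<beta> T h x) = (LINT x|lborel. - 1 / Gamma (1 - \<beta>) * (LINT u|lborel. f u x))"
    unfolding set_lebesgue_integral_def
  proof (intro Bochner_Integration.integral_cong refl)
    fix x
    show "indicat_real {a<..<T} x *\<^sub>R ((x - a) powr (\<beta> - 1) * frac_deriv_right \<beta> T h x) = - 1 / Gamma (1 - \<beta>) * (LINT u|lborel. f u x)"
    proof (cases "x \<in> {a<..<T}")
      case True
      have "(LINT u|lborel. f u x) = (LINT u|lborel. (x - a) powr (\<beta> - 1) * (indicat_real {x<..<T} u *\<^sub>R (h' u * (u - x) powr (- \<beta>))))"
        using True by (intro Bochner_Integration.integral_cong) (auto simp: f_def k_def)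
      also have "\<dots> = (x - a) powr (\<beta> - 1) * (LINT u:{x<..<T}|lborel. h' u * (u - x) powr (- \<beta>))"
        by (simp add: set_lebesgue_integral_def)
      finally have "(LINT u|lborel. f u x) = (x - a) powr (\<beta> - 1) * (LINT u:{x<..<T}|lborel. h' u * (u - x) powr (- \<beta>))" .
      then show ?thesis using frac_deriv_right_smooth[OF der cont, of x] True by simp
    next
      case False
      then have "f u x = 0" for u by (auto simp: f_def k_def)
      then show ?thesis using False by simp
    qed
  qed
  also have "\<dots> = - 1 / Gamma (1 - \<beta>) * (LINT u|lborel. (LINT x|lborel. f u x))"
    unfolding fub[symmetric] by (rule integral_mult_right_zero)
  also have "(LINT u|lborel. (LINT x|lborel. f u x)) = (LINT u|lborel. ?\<Gamma> * (indicat_real {a<..<T} u *\<^sub>R h' u))"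
    by (intro Bochner_Integration.integral_cong) (auto simp: f_def lk split: split_indicator)
  also have "\<dots> = Gamma \<beta> * Gamma (1 - \<beta>) * (LINT u:{a<..<T}|lborel. h' u)"
    by (simp only: integral_mult_right_zero set_lebesgue_integral_def)
  also have "(LINT u:{a<..<T}|lborel. h' u) = h T - h a"
  proof -
    have "set_integrable lborel {a..T} h'"
      by (rule borel_integrable_atLeastAtMost') (rule continuous_on_subset[OF cont], simp)
    then have "set_integrable lborel {a<..<T} h'" by (rule set_integrable_subset) auto
    then have "(LINT u:{a<..<T}|lborel. h' u) = integral {a<..<T} h'" by (rule set_borel_integral_eq_integral(2))
    also have "(h' has_integral (h T - h a)) {a..T}"
      using \<open>a < T\<close> der by (intro fundamental_theorem_of_calculus)
        (auto simp: has_real_derivative_iff_has_vector_derivative[symmetric] intro: DERIV_subset)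
    then have "integral {a<..<T} h' = h T - h a"
      unfolding has_integral_Icc_iff_Ioo by (rule integral_unique)
    finally show ?thesis .
  qed
  finally show ?thesis using G hT by simp
qed

text \<open>The right-sided fractional integral inverts the right-sided fractional derivative. The
  averages of \<open>h\<close> over \<open>[x, x + 1/n]\<close> are continuously differentiable, inherit the Hoelder bound with the
  same constants, and still vanish at \<open>T\<close>; so the smooth case passes to the limit by dominated
  convergence, once in the inner and once in the outer integral.\<close>

theorem inversion:
  assumes zero: "\<And>x. T \<le> x \<Longrightarrow> h x = 0" and a: "0 \<le> a" "a < T"
  shows "(LINT x:{a<..<T}|lborel. (x - a) powr (\<beta> - 1) * frac_deriv_right \<beta> T h x) = Gamma \<beta> * h a"
proof -
  let ?I = "\<lambda>h. LINT x:{a<..<T}|lborel. (x - a) powr (\<beta> - 1) * frac_deriv_right \<beta> T h x"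
  have "\<exists>P. \<forall>x. - \<infinity> < ereal x \<longrightarrow> ereal x < \<infinity> \<longrightarrow> (P has_vector_derivative h x) (at x)"
    using h_continuous[of UNIV] by (intro einterval_antiderivative) (auto simp: continuous_on_eq_continuous_at)
  then obtain P where P: "\<And>x. (P has_real_derivative h x) (at x)"
    by (auto simp: has_real_derivative_iff_has_vector_derivative)
  define \<epsilon> where "\<epsilon> = (\<lambda>n. 1 / real (Suc n))"
  have \<epsilon>: "0 < \<epsilon> n" "\<epsilon> n * real (Suc n) = 1" for n unfolding \<epsilon>_def by auto
  define hm where "hm = (\<lambda>n x. real (Suc n) * (P (x + \<epsilon> n) - P x))"
  have der_shift: "((\<lambda>t. P (x + t)) has_real_derivative h (x + t)) (at t)" for x t
  proof -
    have "((\<lambda>t. P (x + t)) has_real_derivative h (x + t) * (0 + 1)) (at t)"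
      by (intro DERIV_chain2[OF P] DERIV_add DERIV_const DERIV_ident)
    then show ?thesis by simp
  qed
  have mean: "\<exists>z>x. z < x + \<epsilon> n \<and> hm n x = h z" for n x
  proof -
    have "\<exists>z>x. z < x + \<epsilon> n \<and> P (x + \<epsilon> n) - P x = (x + \<epsilon> n - x) * h z"
      using \<epsilon>[of n] P by (intro MVT2) auto
    then show ?thesis using \<epsilon>[of n] unfolding hm_def by (auto simp: mult.assoc[symmetric] mult.commute)
  qed
  have hm_holder: "\<bar>hm n x - hm n y\<bar> \<le> K * \<bar>x - y\<bar> powr \<gamma>" for n x y
  proof -
    have "\<exists>z>0. z < \<epsilon> n \<and> (P (x + \<epsilon> n) - P (y + \<epsilon> n)) - (P (x + 0) - P (y + 0)) = (\<epsilon> n - 0) * (h (x + z) - h (y + z))"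
      using \<epsilon>[of n] by (intro MVT2 DERIV_diff der_shift) auto
    then obtain z where z: "(P (x + \<epsilon> n) - P (y + \<epsilon> n)) - (P x - P y) = \<epsilon> n * (h (x + z) - h (y + z))"
      by auto
    have "hm n x - hm n y = real (Suc n) * ((P (x + \<epsilon> n) - P (y + \<epsilon> n)) - (P x - P y))"
      unfolding hm_def by (simp add: algebra_simps)
    also have "\<dots> = h (x + z) - h (y + z)"
      unfolding z using \<epsilon>[of n] by (simp add: mult.assoc[symmetric] mult.commute)
    finally show ?thesis using holder[of "x + z" "y + z"] by simp
  qed
  have hmT: "hm n T = 0" for n using mean[of T n] zero by auto
  have inst: "holder_fun (hm n) K \<gamma> \<beta> T" for n
    using hm_holder hmT K \<beta> \<gamma> by unfold_locales auto
  have \<epsilon>0: "\<epsilon> \<longlonglongrightarrow> 0" unfolding \<epsilon>_def by (rule LIMSEQ_Suc[OF lim_1_over_n])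
  have hm_lim: "(\<lambda>n. hm n x) \<longlonglongrightarrow> h x" for x
  proof -
    have "(\<lambda>n. K * \<epsilon> n powr \<gamma>) \<longlonglongrightarrow> K * 0 powr \<gamma>"
      using \<gamma> \<beta> \<epsilon>0 \<epsilon>(1)
      by (intro tendsto_mult tendsto_const tendsto_powr') (auto intro!: always_eventually less_imp_le)
    then have lim: "(\<lambda>n. K * \<epsilon> n powr \<gamma>) \<longlonglongrightarrow> 0" by simp
    have "\<bar>hm n x - h x\<bar> \<le> K * \<epsilon> n powr \<gamma>" for n
    proof -
      obtain z where z: "x < z" "z < x + \<epsilon> n" "hm n x = h z" using mean by blast
      have "\<bar>hm n x - h x\<bar> \<le> K * \<bar>z - x\<bar> powr \<gamma>" using holder[of z x] z by simp
      also have "\<dots> \<le> K * \<epsilon> n powr \<gamma>" using z K \<gamma> \<beta> by (intro mult_left_mono powr_mono2) auto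
      finally show ?thesis .
    qed
    then have "(\<lambda>n. hm n x - h x) \<longlonglongrightarrow> 0"
      by (intro Lim_null_comparison[OF _ lim]) (auto intro!: always_eventually)
    then show ?thesis by (simp add: LIM_zero_iff)
  qed
  have [measurable]: "hm n \<in> borel_measurable borel" for n
    by (rule holder_fun.h_measurable[OF inst])
  have fdr_lim: "(\<lambda>n. frac_deriv_right \<beta> T (hm n) x) \<longlonglongrightarrow> frac_deriv_right \<beta> T h x" if "x < T" for x
  proof -
    have "(\<lambda>n. LINT u:{x<..<T}|lborel. rker \<beta> (hm n) x u)
      \<longlonglongrightarrow> (LINT u:{x<..<T}|lborel. rker \<beta> h x u)"
      unfolding set_lebesgue_integral_def
    proof (rule integral_dominated_convergence)
      show "integrable lborel (\<lambda>u. indicat_real {x<..<T} u *\<^sub>R (K * (u - x) powr (\<gamma> - \<beta> - 1)))"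
        using powr_above_integral(1)[of "\<gamma> - \<beta> - 1" x T] \<gamma> that
        unfolding set_integrable_def[symmetric] by simp
      show "AE u in lborel. (\<lambda>n. indicat_real {x<..<T} u *\<^sub>R (rker \<beta> (hm n) x u))
        \<longlonglongrightarrow> indicat_real {x<..<T} u *\<^sub>R (rker \<beta> h x u)"
        by (intro AE_I2) (auto split: split_indicator intro!: tendsto_intros hm_lim)
      show "AE u in lborel. norm (indicat_real {x<..<T} u *\<^sub>R (rker \<beta> (hm n) x u))
        \<le> indicat_real {x<..<T} u *\<^sub>R (K * (u - x) powr (\<gamma> - \<beta> - 1))" for n
        using holder_fun.kernel_bound[OF inst, of x _ n] by (intro AE_I2) (auto split: split_indicator)
    qed simp_all
    then show ?thesis
      unfolding frac_deriv_right_lborel[OF h_measurable] frac_deriv_right_lborel[OF holder_fun.h_measurable[OF inst]]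
      using that by (intro tendsto_intros hm_lim) auto
  qed
  have "(\<lambda>n. LINT x:{a<..<T}|lborel. (x - a) powr (\<beta> - 1) * frac_deriv_right \<beta> T (hm n) x)
     \<longlonglongrightarrow> (?I h)"
    unfolding set_lebesgue_integral_def
  proof (rule integral_dominated_convergence)
    show "integrable lborel (\<lambda>x. indicat_real {a<..<T} x *\<^sub>R ((x - a) powr (\<beta> - 1) * wbound))"
      using powr_above_integral(1)[of "\<beta> - 1" a T] \<beta> a
      unfolding set_integrable_def[symmetric] by simp
    show "AE x in lborel. (\<lambda>n. indicat_real {a<..<T} x *\<^sub>R ((x - a) powr (\<beta> - 1) * frac_deriv_right \<beta> T (hm n) x))
      \<longlonglongrightarrow> indicat_real {a<..<T} x *\<^sub>R ((x - a) powr (\<beta> - 1) * frac_deriv_right \<beta> T h x)"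
      by (intro AE_I2) (auto split: split_indicator intro!: tendsto_intros fdr_lim)
    show "AE x in lborel. norm (indicat_real {a<..<T} x *\<^sub>R ((x - a) powr (\<beta> - 1) * frac_deriv_right \<beta> T (hm n) x))
      \<le> indicat_real {a<..<T} x *\<^sub>R ((x - a) powr (\<beta> - 1) * wbound)" for n
      using holder_fun.frac_deriv_right_bound[OF inst, of _ n] a
      by (intro AE_I2) (auto split: split_indicator simp: abs_mult intro!: mult_left_mono)
  qed simp_all
  moreover have "(LINT x:{a<..<T}|lborel. (x - a) powr (\<beta> - 1) * frac_deriv_right \<beta> T (hm n) x) = Gamma \<beta> * hm n a" for n
  proof (rule holder_fun.inversion_smooth[OF inst])
    show "(hm n has_real_derivative real (Suc n) * (h (x + \<epsilon> n) - h x)) (at x)" for x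
    proof -
      have "((\<lambda>x. P (x + \<epsilon> n)) has_real_derivative h (x + \<epsilon> n)) (at x)"
        using der_shift[of "\<epsilon> n" x] by (simp add: add.commute)
      then show ?thesis unfolding hm_def by (intro DERIV_cmult DERIV_diff P)
    qed
    show "continuous_on UNIV (\<lambda>x. real (Suc n) * (h (x + \<epsilon> n) - h x))"
      by (intro continuous_intros continuous_on_compose2[OF h_continuous[of UNIV]] h_continuous) auto
  qed (use a in auto)
  ultimately have "(\<lambda>n. Gamma \<beta> * hm n a) \<longlonglongrightarrow> (?I h)"
    by simp
  moreover have "(\<lambda>n. Gamma \<beta> * hm n a) \<longlonglongrightarrow> Gamma \<beta> * h a"
    by (intro tendsto_intros hm_lim)
  ultimately show ?thesis by (rule LIMSEQ_unique)
qed

end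

section \<open>The chain rule for the square of a path\<close>

lemma integral_powr_below_Ioo:
  fixes a x p :: real
  assumes "0 \<le> a" "a < x" "p + 1 \<noteq> 0"
  shows "(LINT u:{0<..<a}|lborel. (x - u) powr p) = (x powr (p + 1) - (x - a) powr (p + 1)) / (p + 1)"
proof -
  let ?F = "\<lambda>u. - ((x - u) powr (p + 1)) / (p + 1)"
  have cont: "continuous_on {0..a} (\<lambda>u. (x - u) powr p)"
    using assms by (intro continuous_intros) auto
  have "set_integrable lborel {0..a} (\<lambda>u. (x - u) powr p)"
    by (rule borel_integrable_atLeastAtMost'[OF cont])
  then have "set_integrable lborel {0<..<a} (\<lambda>u. (x - u) powr p)" by (rule set_integrable_subset) auto
  then have "(LINT u:{0<..<a}|lborel. (x - u) powr p) = integral {0<..<a} (\<lambda>u. (x - u) powr p)"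
    by (rule set_borel_integral_eq_integral(2))
  also have "((\<lambda>u. (x - u) powr p) has_integral (?F a - ?F 0)) {0..a}"
  proof (rule fundamental_theorem_of_calculus)
    fix u assume u: "u \<in> {0..a}"
    have "(?F has_real_derivative (x - u) powr p) (at u within {0..a})"
    proof -
      have "((\<lambda>u. (x - u) powr (p + 1)) has_real_derivative ((p + 1) * (x - u) powr (p + 1 - 1)) * (0 - 1)) (at u within {0..a})"
        using assms u by (intro DERIV_chain2[where g = "\<lambda>u. x - u"] has_real_derivative_powr DERIV_diff DERIV_ident DERIV_const) auto
      then have "(?F has_real_derivative - (((p + 1) * (x - u) powr (p + 1 - 1)) * (0 - 1)) / (p + 1)) (at u within {0..a})"
        by (intro DERIV_cdivide DERIV_minus)
      then show ?thesis using assms by simp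
    qed
    then show "(?F has_vector_derivative (x - u) powr p) (at u within {0..a})"
      by (simp add: has_real_derivative_iff_has_vector_derivative)
  qed (use assms in auto)
  then have "integral {0<..<a} (\<lambda>u. (x - u) powr p) = ?F a - ?F 0"
    unfolding has_integral_Icc_iff_Ioo by (rule integral_unique)
  finally show ?thesis by (simp add: diff_divide_distrib)
qed

text \<open>The jump from 0 to 1 cancels the contribution of the origin, so that only the distance to the
  jump remains. This is exactly the kernel in the inversion formula.\<close>

lemma frac_deriv_left_indicator:
  assumes \<alpha>: "0 < \<alpha>" "\<alpha> < 1" and a: "0 \<le> a" and x: "x \<in> {0<..<T}" "x \<noteq> a"
  shows "frac_deriv_left \<alpha> 0 (indicat_real {a..<T}) x =
    (if a < x then 1 / Gamma (1 - \<alpha>) * (x - a) powr (- \<alpha>) else 0)"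
proof (cases "a < x")
  case True
  have pw: "1 / (x - u) powr (1 + \<alpha>) = (x - u) powr (- 1 - \<alpha>)" for u
    by (simp add: powr_minus_divide[symmetric])
  have "(LINT u:{0<..<x}|lborel. (indicat_real {a..<T} x - indicat_real {a..<T} u) / (x - u) powr (1 + \<alpha>))
     = (LINT u:{0<..<a}|lborel. (x - u) powr (- 1 - \<alpha>))"
    unfolding set_lebesgue_integral_def
    by (intro Bochner_Integration.integral_cong) (use True x in \<open>auto split: split_indicator simp: pw[symmetric]\<close>)
  also have "\<dots> = (x powr (- \<alpha>) - (x - a) powr (- \<alpha>)) / (- \<alpha>)"
    using integral_powr_below_Ioo[of a x "- 1 - \<alpha>"] a True \<alpha> by simp
  finally have "\<alpha> * (LINT u:{0<..<x}|lborel. (indicat_real {a..<T} x - indicat_real {a..<T} u) / (x - u) powr (1 + \<alpha>))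
     = (x - a) powr (- \<alpha>) - x powr (- \<alpha>)"
    using \<alpha> by (simp add: field_simps)
  moreover have "indicat_real {a..<T} x / (x - 0) powr \<alpha> = x powr (- \<alpha>)"
    using True x by (simp add: powr_minus_divide)
  ultimately show ?thesis
    using True by (subst frac_deriv_left_lborel) auto
next
  case False
  then have lt: "x < a" using x by auto
  have "(LINT u:{0<..<x}|lborel. (indicat_real {a..<T} x - indicat_real {a..<T} u) / (x - u) powr (1 + \<alpha>))
     = (LINT u:{0<..<x}|lborel. 0)"
    using lt by (intro set_lebesgue_integral_cong) auto
  then show ?thesis
    using lt by (subst frac_deriv_left_lborel) auto
qed

text \<open>The exponent \<open>\<gamma>\<close>
  must exceed \<open>1 - \<alpha>\<close> to integrate against the path, and \<open>\<alpha>\<close> to integrate the path itself.\<close>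

locale gls_path =
  fixes g :: "real \<Rightarrow> real" and K \<gamma> \<alpha> T :: real
  assumes holder_g: "\<And>x y. \<bar>g x - g y\<bar> \<le> K * \<bar>x - y\<bar> powr \<gamma>"
    and const: "\<And>x. T \<le> x \<Longrightarrow> g x = g T"
    and K0: "0 \<le> K" and T: "0 < T" and \<alpha>01: "0 < \<alpha>" "\<alpha> < 1" and \<gamma>\<alpha>: "1 - \<alpha> < \<gamma>" "\<alpha> < \<gamma>"
begin

sublocale h: holder_fun "\<lambda>x. g x - g T" K \<gamma> "1 - \<alpha>" T
  using holder_g K0 \<alpha>01 \<gamma>\<alpha> by unfold_locales auto

sublocale bounded_weight \<alpha> T "h.wbound" "frac_deriv_right (1 - \<alpha>) T (\<lambda>x. g x - g T)"
  using \<alpha>01 h.frac_deriv_right_bound h.wbound_nonneg by unfold_locales auto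

lemma g_continuous: "continuous_on UNIV g"
  using holder_continuous[OF _ holder_g] \<gamma>\<alpha> \<alpha>01 by auto

lemma g_measurable [measurable]: "g \<in> borel_measurable borel"
  by (intro borel_measurable_continuous_onI g_continuous)

lemma indicator_finite:
  assumes "0 \<le> a" "a \<le> b"
  shows "frac_nn \<alpha> T (indicat_real {a..<b}) < \<infinity>"
proof -
  have "frac_nn \<alpha> T (indicat_real {a..<b}) \<le> ennreal ((1 + 2 / \<alpha>) / (1 - \<alpha>) * 1 * (b - a) powr (1 - \<alpha>)
    + 1 / (\<gamma> - \<alpha>) * 0 * (b - a) powr (1 + \<gamma> - \<alpha>))"
    using assms \<alpha>01 \<gamma>\<alpha> by (intro frac_nn_piece_bound) auto
  then show ?thesis by (rule order_le_less_trans) simp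
qed

lemma L_indicator_to_end:
  assumes "0 \<le> a" "a \<le> T"
  shows "L (indicat_real {a..<T}) = g a - g T"
proof (cases "a = T")
  case True
  have "indicat_real {T..<T} = (\<lambda>_. 0)" by auto
  then show ?thesis using True L_zero by simp
next
  case False
  then have aT: "a < T" using assms by simp
  let ?w = "frac_deriv_right (1 - \<alpha>) T (\<lambda>x. g x - g T)"
  have "L (indicat_real {a..<T}) = (LINT x|lborel. 1 / Gamma (1 - \<alpha>) * (indicat_real {a<..<T} x *\<^sub>R ((x - a) powr (1 - \<alpha> - 1) * ?w x)))"
    unfolding L_def set_lebesgue_integral_def
  proof (rule integral_cong_AE)
    show "AE x in lborel. indicat_real {0<..<T} x *\<^sub>R (frac_deriv_left \<alpha> 0 (indicat_real {a..<T}) x * ?w x) =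
      1 / Gamma (1 - \<alpha>) * (indicat_real {a<..<T} x *\<^sub>R ((x - a) powr (1 - \<alpha> - 1) * ?w x))"
      using AE_lborel_singleton[of a]
    proof eventually_elim
      case (elim x)
      then show ?case
        using frac_deriv_left_indicator[OF \<alpha>01 assms(1), of x T] assms by (auto split: split_indicator)
    qed
  qed measurable
  also have "\<dots> = 1 / Gamma (1 - \<alpha>) * (LINT x:{a<..<T}|lborel. (x - a) powr (1 - \<alpha> - 1) * ?w x)"
    unfolding set_lebesgue_integral_def by (rule integral_mult_right_zero)
  also have "\<dots> = 1 / Gamma (1 - \<alpha>) * (Gamma (1 - \<alpha>) * (g a - g T))"
  proof -
    have "g x - g T = 0" if "T \<le> x" for x using const[OF that] by linarith
    from h.inversion[OF this assms(1) aT] show ?thesis by (simp only:)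
  qed
  also have "Gamma (1 - \<alpha>) > 0" using \<alpha>01 by (intro Gamma_real_pos) auto
  then have "1 / Gamma (1 - \<alpha>) * (Gamma (1 - \<alpha>) * (g a - g T)) = g a - g T" by simp
  finally show ?thesis .
qed

lemma L_indicator:
  assumes "0 \<le> a" "a \<le> b" "b \<le> T"
  shows "L (indicat_real {a..<b}) = g a - g b"
proof -
  have "indicat_real {a..<b} = (\<lambda>s. indicat_real {a..<T} s + (- 1) * indicat_real {b..<T} s)"
    using assms by (auto simp: fun_eq_iff split: split_indicator)
  then have "L (indicat_real {a..<b}) = L (\<lambda>s. indicat_real {a..<T} s + (- 1) * indicat_real {b..<T} s)" by simp
  also have "\<dots> = L (indicat_real {a..<T}) + L (\<lambda>s. (- 1) * indicat_real {b..<T} s)"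
  proof (intro L_add)
    show "frac_nn \<alpha> T (\<lambda>s. (- 1) * indicat_real {b..<T} s) < \<infinity>"
      using assms indicator_finite[of b T] by (subst frac_nn_cmult) auto
  qed (use assms indicator_finite[of a T] in auto)
  also have "L (\<lambda>s. (- 1) * indicat_real {b..<T} s) = (-1) * L (indicat_real {b..<T})"
    by (rule L_cmult)
  finally show ?thesis using assms by (simp add: L_indicator_to_end)
qed

text \<open>The integrand used on one cell, whose integral is quadratic in the increment of the path.\<close>

definition piece :: "real \<Rightarrow> real \<Rightarrow> real \<Rightarrow> real" where
  "piece a b s = indicat_real {a..<b} s * (g s - g a)"

lemma piece_measurable [measurable]: "piece a b \<in> borel_measurable borel"
  unfolding piece_def by measurable

definition piece_const :: real where
  "piece_const = (1 + 2 / \<alpha>) / (1 - \<alpha>) + 1 / (\<gamma> - \<alpha>)"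

lemma piece_const_nonneg: "0 \<le> piece_const"
  unfolding piece_const_def using \<alpha>01 \<gamma>\<alpha> by (intro add_nonneg_nonneg) auto

lemma frac_nn_piece:
  assumes "0 \<le> a" "a \<le> b"
  shows "frac_nn \<alpha> T (piece a b) \<le> ennreal (piece_const * K * (b - a) powr (1 + \<gamma> - \<alpha>))"
proof -
  have "frac_nn \<alpha> T (piece a b) \<le> ennreal ((1 + 2 / \<alpha>) / (1 - \<alpha>) * (K * (b - a) powr \<gamma>) * (b - a) powr (1 - \<alpha>)
    + 1 / (\<gamma> - \<alpha>) * K * (b - a) powr (1 + \<gamma> - \<alpha>))"
  proof (rule frac_nn_piece_bound)
    show "\<bar>piece a b s\<bar> \<le> K * (b - a) powr \<gamma>" if "s \<in> {a..<b}" for s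
    proof -
      have "\<bar>piece a b s\<bar> \<le> K * \<bar>s - a\<bar> powr \<gamma>" using that holder_g[of s a] by (simp add: piece_def)
      also have "\<dots> \<le> K * (b - a) powr \<gamma>"
        using that K0 \<gamma>\<alpha> \<alpha>01 by (intro mult_left_mono powr_mono2) auto
      finally show ?thesis .
    qed
    show "\<bar>piece a b s - piece a b z\<bar> \<le> K * \<bar>s - z\<bar> powr \<gamma>" if "s \<in> {a..<b}" "z \<in> {a..<b}" for s z
      using that holder_g[of s z] by (simp add: piece_def)
  qed (use assms \<alpha>01 \<gamma>\<alpha> K0 in \<open>auto simp: piece_def\<close>)
  also have "(1 + 2 / \<alpha>) / (1 - \<alpha>) * (K * (b - a) powr \<gamma>) * (b - a) powr (1 - \<alpha>)
    + 1 / (\<gamma> - \<alpha>) * K * (b - a) powr (1 + \<gamma> - \<alpha>) = piece_const * K * (b - a) powr (1 + \<gamma> - \<alpha>)"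
  proof -
    have "(b - a) powr \<gamma> * (b - a) powr (1 - \<alpha>) = (b - a) powr (1 + \<gamma> - \<alpha>)"
      by (simp add: powr_add[symmetric] add.commute add_diff_eq)
    then have "(1 + 2 / \<alpha>) / (1 - \<alpha>) * (K * (b - a) powr \<gamma>) * (b - a) powr (1 - \<alpha>) = (1 + 2 / \<alpha>) / (1 - \<alpha>) * K * (b - a) powr (1 + \<gamma> - \<alpha>)"
      by (simp only: mult.assoc)
    then show ?thesis unfolding piece_const_def by (simp add: distrib_right)
  qed
  finally show ?thesis .
qed

lemma frac_nn_piece_finite:
  assumes "0 \<le> a" "a \<le> b"
  shows "frac_nn \<alpha> T (piece a b) < \<infinity>"
  by (rule order_le_less_trans[OF frac_nn_piece[OF assms]]) simp

lemma L_le: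
  assumes "f \<in> borel_measurable borel" "frac_nn \<alpha> T f \<le> ennreal c" "0 \<le> c"
  shows "\<bar>L f\<bar> \<le> h.wbound / Gamma (1 - \<alpha>) * c"
proof -
  have "0 < Gamma (1 - \<alpha>)" using \<alpha>01 by (intro Gamma_real_pos) auto
  then have nn: "0 \<le> h.wbound / Gamma (1 - \<alpha>)" using h.wbound_nonneg by simp
  have "frac_nn \<alpha> T f < \<infinity>" using assms(2) by (rule order_le_less_trans) simp
  then have "ennreal \<bar>L f\<bar> \<le> ennreal (h.wbound / Gamma (1 - \<alpha>)) * frac_nn \<alpha> T f"
    by (rule L_bound[OF assms(1)])
  also have "\<dots> \<le> ennreal (h.wbound / Gamma (1 - \<alpha>)) * ennreal c"
    by (rule mult_left_mono[OF assms(2)]) simp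
  also have "\<dots> = ennreal (h.wbound / Gamma (1 - \<alpha>) * c)"
    using nn by (simp only: ennreal_mult')
  finally show ?thesis using mult_nonneg_nonneg[OF nn assms(3)] by (simp only: ennreal_le_iff)
qed

text \<open>Replace the integrand by its left-point step function on \<open>m + 1\<close> equal intervals. The error is a
  sum of functions of the same shape on these shorter intervals, hence of size
  \<open>m\<close> times a power of \<open>1/m\<close> greater than 1. The integral of the step function telescopes
  up to half the sum of the squared increments, which vanishes in the limit for the same reason.
  The minus sign is that of the sign convention for the integral.\<close>

theorem L_piece:
  assumes ab: "0 \<le> a" "a \<le> b" "b \<le> T"
  shows "L (piece a b) = - (g b - g a)\<^sup>2 / 2"
proof -
  define x where "x = (\<lambda>m i. a + real i * ((b - a) / real (Suc m)))"
  have x0: "x m 0 = a" and xm: "x m (Suc m) = b" for m unfolding x_def by auto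
  have xstep: "x m (Suc i) - x m i = (b - a) / real (Suc m)" for m i
    unfolding x_def of_nat_Suc distrib_right by simp
  have xmono: "x m i \<le> x m j" if "i \<le> j" for m i j
    unfolding x_def using that ab by (intro add_left_mono mult_right_mono) auto
  have xpos: "0 \<le> x m i" for m i using xmono[of 0 i m] x0[of m] ab by simp
  have xle: "x m i \<le> T" if "i \<le> Suc m" for m i using xmono[OF that, of m] xm[of m] ab by simp
  let ?c = "\<lambda>m i. g (x m i) - g a" and ?d = "\<lambda>m i. g (x m (Suc i)) - g (x m i)"
  let ?e = "\<lambda>m. (b - a) / real (Suc m)"
  let ?E = "\<lambda>m. piece_const * K * ?e m powr (1 + \<gamma> - \<alpha>)"
  let ?p = "\<lambda>m i. piece (x m i) (x m (Suc i))" and ?i = "\<lambda>m i. indicat_real {x m i..<x m (Suc i)}"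
  have ind: "indicat_real {a..<b} s = (\<Sum>i<Suc m. ?i m i s)" for m s
  proof -
    have "indicat_real {x m 0..<x m n} s = (\<Sum>i<n. ?i m i s)" for n
    proof (induction n)
      case (Suc n)
      have "indicat_real {x m 0..<x m (Suc n)} s = indicat_real {x m 0..<x m n} s + indicat_real {x m n..<x m (Suc n)} s"
        using xmono[of 0 n m] xmono[of n "Suc n" m] by (auto split: split_indicator)
      then show ?case using Suc by simp
    qed simp
    from this[of "Suc m"] show ?thesis by (simp only: x0 xm)
  qed
  have split: "piece a b s = (\<Sum>i<Suc m. ?c m i * ?i m i s) + (\<Sum>i<Suc m. ?p m i s)" for m s
  proof -
    have "piece a b s = (\<Sum>i<Suc m. ?i m i s * (g s - g a))"
      unfolding piece_def ind[of s m] by (rule sum_distrib_right)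
    also have "\<dots> = (\<Sum>i<Suc m. ?c m i * ?i m i s + ?p m i s)"
      by (intro sum.cong) (auto simp: piece_def algebra_simps)
    finally show ?thesis by (simp only: sum.distrib)
  qed
  have fin1: "frac_nn \<alpha> T (\<lambda>s. ?c m i * ?i m i s) < \<infinity>" for m i
    using indicator_finite[OF xpos[of m i] xmono[of i "Suc i" m]] by (simp add: frac_nn_cmult ennreal_mult_less_top)
  have fin2: "frac_nn \<alpha> T (?p m i) < \<infinity>" for m i
    by (intro frac_nn_piece_finite xpos xmono) simp
  have Lsplit: "L (piece a b) = (\<Sum>i<Suc m. ?c m i * - ?d m i) + (\<Sum>i<Suc m. L (?p m i))" for m
  proof -
    have "L (piece a b) = L (\<lambda>s. (\<Sum>i<Suc m. ?c m i * ?i m i s) + (\<Sum>i<Suc m. ?p m i s))"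
      using split[of _ m] by presburger
    also have "\<dots> = L (\<lambda>s. \<Sum>i<Suc m. ?c m i * ?i m i s) + L (\<lambda>s. \<Sum>i<Suc m. ?p m i s)"
      by (intro L_add frac_nn_sum_finite fin1 fin2 borel_measurable_sum) auto
    also have "L (\<lambda>s. \<Sum>i<Suc m. ?c m i * ?i m i s) = (\<Sum>i<Suc m. L (\<lambda>s. ?c m i * ?i m i s))"
      by (intro L_sum fin1) auto
    also have "\<dots> = (\<Sum>i<Suc m. ?c m i * - ?d m i)"
      by (intro sum.cong refl) (simp add: L_cmult L_indicator xpos xmono xle)
    also have "L (\<lambda>s. \<Sum>i<Suc m. ?p m i s) = (\<Sum>i<Suc m. L (?p m i))"
      by (intro L_sum fin2) auto
    finally show ?thesis .
  qed
  have telescope: "(\<Sum>i<n. ?c m i * - ?d m i) = - (g (x m n) - g a)\<^sup>2 / 2 + (\<Sum>i<n. (?d m i)\<^sup>2) / 2" for m n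
  proof (induction n)
    case (Suc n)
    show ?case unfolding sum.lessThan_Suc Suc by (simp add: power2_eq_square field_simps)
  qed (simp add: x0)
  let ?D = "h.wbound / Gamma (1 - \<alpha>)"
  have "0 < Gamma (1 - \<alpha>)" using \<alpha>01 by (intro Gamma_real_pos) auto
  then have D0: "0 \<le> ?D" using h.wbound_nonneg by simp
  have err: "\<bar>L (piece a b) + (g b - g a)\<^sup>2 / 2\<bar> \<le> real (Suc m) * (K\<^sup>2 * ?e m powr (2 * \<gamma>) / 2 + ?D * (?E m))" for m
  proof -
    have d: "(?d m i)\<^sup>2 \<le> K\<^sup>2 * ?e m powr (2 * \<gamma>)" for i
    proof -
      have "\<bar>?d m i\<bar> \<le> K * ?e m powr \<gamma>"
        using holder_g[of "x m (Suc i)" "x m i"] ab unfolding xstep by simp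
      then have "(?d m i)\<^sup>2 \<le> (K * ?e m powr \<gamma>)\<^sup>2"
        by (metis abs_ge_zero power2_abs power_mono)
      also have "\<dots> = K\<^sup>2 * ?e m powr (2 * \<gamma>)"
        by (simp add: power_mult_distrib power2_eq_square powr_add[symmetric])
      finally show ?thesis .
    qed
    have p: "\<bar>L (?p m i)\<bar> \<le> ?D * (?E m)" for i
      using frac_nn_piece[OF xpos[of m i] xmono[of i "Suc i" m]] piece_const_nonneg K0 unfolding xstep
      by (intro L_le) auto
    have "L (piece a b) + (g b - g a)\<^sup>2 / 2 = (\<Sum>i<Suc m. (?d m i)\<^sup>2) / 2 + (\<Sum>i<Suc m. L (?p m i))"
    proof -
      have gen: "l + G / 2 = e + r" if "l = t + r" "t = - G / 2 + e" for l t r G e :: real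
        using that by linarith
      show ?thesis by (rule gen[OF Lsplit[of m] telescope[of m "Suc m", unfolded xm]])
    qed
    also have "\<dots> = (\<Sum>i<Suc m. (?d m i)\<^sup>2 / 2 + L (?p m i))"
      by (simp only: sum.distrib sum_divide_distrib)
    finally have "\<bar>L (piece a b) + (g b - g a)\<^sup>2 / 2\<bar> = \<bar>\<Sum>i<Suc m. (?d m i)\<^sup>2 / 2 + L (?p m i)\<bar>"
      by (simp only:)
    also have "\<dots> \<le> (\<Sum>i<Suc m. K\<^sup>2 * ?e m powr (2 * \<gamma>) / 2 + ?D * (?E m))"
    proof (rule order_trans[OF sum_abs], rule sum_mono)
      fix i
      show "\<bar>(?d m i)\<^sup>2 / 2 + L (?p m i)\<bar> \<le> K\<^sup>2 * ?e m powr (2 * \<gamma>) / 2 + ?D * (?E m)"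
      proof -
        have gen: "\<bar>A / 2 + B\<bar> \<le> X / 2 + Y" if "0 \<le> A" "A \<le> X" "\<bar>B\<bar> \<le> Y" for A B X Y :: real
          using that by linarith
        show ?thesis by (rule gen[OF zero_le_power2 d p])
      qed
    qed
    also have "\<dots> = real (Suc m) * (K\<^sup>2 * ?e m powr (2 * \<gamma>) / 2 + ?D * (?E m))"
      by (simp only: sum_constant card_lessThan)
    finally show ?thesis .
  qed
  have "(\<lambda>m. real (Suc m) * (K\<^sup>2 * ?e m powr (2 * \<gamma>) / 2 + ?D * (?E m))) \<longlonglongrightarrow> 0"
  proof -
    have pw: "(\<lambda>m. real (Suc m) * ?e m powr q) \<longlonglongrightarrow> 0" if "1 < q" for q
    proof -
      have "real (Suc m) * ?e m powr q = (b - a) powr q * real (Suc m) powr (1 - q)" for m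
        using ab by (simp add: powr_divide powr_diff)
      moreover have "(\<lambda>m. (b - a) powr q * real (Suc m) powr (1 - q)) \<longlonglongrightarrow> (b - a) powr q * 0"
        using that by (intro tendsto_mult tendsto_const tendsto_neg_powr filterlim_compose[OF filterlim_real_sequentially filterlim_Suc]) auto
      ultimately show ?thesis by simp
    qed
    have "(\<lambda>m. K\<^sup>2 / 2 * (real (Suc m) * ?e m powr (2 * \<gamma>)) + ?D * piece_const * K * (real (Suc m) * ?e m powr (1 + \<gamma> - \<alpha>)))
      \<longlonglongrightarrow> K\<^sup>2 / 2 * 0 + ?D * piece_const * K * 0"
      using \<gamma>\<alpha> \<alpha>01 by (intro tendsto_add tendsto_mult[OF tendsto_const pw]) auto
    moreover have "K\<^sup>2 / 2 * (N * A) + W * piece_const * K * (N * B) = N * (K\<^sup>2 * A / 2 + W * (piece_const * K * B))" for N A B W :: real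
      by (simp add: algebra_simps)
    ultimately show ?thesis by (simp only: mult_zero_right add_0_right)
  qed
  then have "\<bar>L (piece a b) + (g b - g a)\<^sup>2 / 2\<bar> \<le> 0"
    by (rule LIMSEQ_le_const) (use err in blast)
  then show ?thesis by simp
qed

lemma gls_integral_eq_L:
  assumes [measurable]: "f \<in> borel_measurable borel"
  shows "gls_integral \<alpha> 0 T f g = L f"
  unfolding gls_integral_def L_def by (intro set_integral_lebesgue_eq_lborel) auto

lemma gls_integrableI:
  assumes [measurable]: "f \<in> borel_measurable borel" and "frac_nn \<alpha> T f < \<infinity>"
  shows "gls_integrable \<alpha> 0 T f g"
  unfolding gls_integrable_def frac_deriv_right_Linf_def
proof (intro conjI)
  show "frac_deriv_left_L1 \<alpha> 0 T f" by (rule frac_deriv_left_L1I(1)[OF assms(1) \<alpha>01 assms(2)])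
  show "AE x in lebesgue. x \<in> {0<..<T} \<longrightarrow>
     set_integrable lebesgue {x<..<T} (\<lambda>u. (g x - g T - (g u - g T)) / (u - x) powr (1 + (1 - \<alpha>)))"
    using h.kernel_integrable by (intro AE_I2) (auto simp: set_integrable_lebesgue_eq_lborel)
  show "set_borel_measurable lebesgue {0<..<T} (frac_deriv_right (1 - \<alpha>) T (\<lambda>x. g x - g T))"
    unfolding set_borel_measurable_def by (rule measurable_completion) simp
  show "\<exists>C. AE x in lebesgue. x \<in> {0<..<T} \<longrightarrow> \<bar>frac_deriv_right (1 - \<alpha>) T (\<lambda>x. g x - g T) x\<bar> \<le> C"
    using h.frac_deriv_right_bound by (intro exI[of _ h.wbound] AE_I2) auto
qed

end

section \<open>Gaussian moments and dyadic chaining\<close>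

text \<open>The deterministic half of Kolmogorov's continuity theorem. Each point is the limit of its
  left dyadic approximations, and consecutive approximations coincide or are neighbours on the finer
  level. For two points, start the chains on the level whose mesh is comparable to their distance.\<close>

lemma dyadic_chaining:
  fixes f :: "real \<Rightarrow> real"
  assumes T: "0 < T" and cont: "continuous_on {0..T} f" and \<gamma>: "0 < \<gamma>" and C: "0 \<le> C"
    and inc: "\<And>n k. k < 2 ^ n \<Longrightarrow> \<bar>f (T * real (Suc k) / 2 ^ n) - f (T * real k / 2 ^ n)\<bar> \<le> C * (2 powr (- \<gamma>)) ^ n"
  shows "\<exists>C'\<ge>0. \<forall>s\<in>{0..T}. \<forall>t\<in>{0..T}. \<bar>f t - f s\<bar> \<le> C' * \<bar>t - s\<bar> powr \<gamma>"
proof -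
  define q :: real where "q = 2 powr (- \<gamma>)"
  have "2 powr (- \<gamma>) < (2 :: real) powr 0" using \<gamma> by (intro powr_less_mono) auto
  then have q: "0 < q" "q < 1" unfolding q_def by auto
  define k where "k = (\<lambda>n x. nat \<lfloor>2 ^ n * x / T\<rfloor>)"
  define d where "d = (\<lambda>n x. T * real (k n x) / 2 ^ n)"
  have k_real: "real (k n x) = real_of_int \<lfloor>2 ^ n * x / T\<rfloor>" if "0 \<le> x" for n x
    using that T unfolding k_def by simp
  have k_bounds: "real (k n x) \<le> 2 ^ n * x / T" "2 ^ n * x / T < real (k n x) + 1" if "0 \<le> x" for n x
    by (simp_all add: k_real[OF that] real_of_int_floor_add_one_gt)
  have k_le: "k n x \<le> 2 ^ n" if "x \<in> {0..T}" for n x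
  proof -
    have "2 ^ n * x / T \<le> 2 ^ n * T / T" using that T by (intro divide_right_mono mult_left_mono) auto
    then have "2 ^ n * x / T \<le> 2 ^ n" using T by simp
    then have "real (k n x) \<le> 2 ^ n" using k_bounds(1)[of x n] that by (meson atLeastAtMost_iff order_trans)
    then show ?thesis by (metis of_nat_le_iff of_nat_numeral of_nat_power)
  qed
  have d_bounds: "d n x \<le> x" "x - T / 2 ^ n < d n x" if "0 \<le> x" for n x
  proof -
    show "d n x \<le> x" using k_bounds[OF that, of n] T unfolding d_def by (simp add: field_simps)
    have "x < T * (real (k n x) + 1) / 2 ^ n" using k_bounds(2)[OF that, of n] T by (simp add: field_simps)
    then show "x - T / 2 ^ n < d n x" unfolding d_def by (simp add: distrib_left add_divide_distrib)
  qed
  have d_in: "d n x \<in> {0..T}" if "x \<in> {0..T}" for n x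
    using d_bounds(1)[of x n] that T unfolding d_def by auto
  have step: "\<bar>f (d (Suc n) x) - f (d n x)\<bar> \<le> C * q ^ Suc n" if x: "x \<in> {0..T}" for n x
  proof -
    have "k (Suc n) x = 2 * k n x \<or> k (Suc n) x = Suc (2 * k n x)"
    proof -
      have "real (k (Suc n) x) \<le> 2 * (2 ^ n * x / T)" "2 * (2 ^ n * x / T) < real (k (Suc n) x) + 1"
        using k_bounds[of x "Suc n"] x by simp_all
      then have "real (k (Suc n) x) < 2 * real (k n x) + 2" "2 * real (k n x) < real (k (Suc n) x) + 1"
        using k_bounds[of x n] x by auto
      then show ?thesis by linarith
    qed
    then show ?thesis
    proof
      assume "k (Suc n) x = 2 * k n x"
      then have "d (Suc n) x = d n x" unfolding d_def by simp
      then show ?thesis using C q by simp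
    next
      assume e: "k (Suc n) x = Suc (2 * k n x)"
      then have lt: "2 * k n x < 2 ^ Suc n" using k_le[OF x, of "Suc n"] by linarith
      have "d (Suc n) x = T * real (Suc (2 * k n x)) / 2 ^ Suc n" "d n x = T * real (2 * k n x) / 2 ^ Suc n"
        unfolding d_def e by simp_all
      then show ?thesis using inc[OF lt] unfolding q_def by simp
    qed
  qed
  define D where "D = C / (1 - q)"
  have D: "0 \<le> D" "C = D * (1 - q)" unfolding D_def using C q by auto
  have multi: "\<bar>f (d (n + j) x) - f (d n x)\<bar> \<le> D * q ^ n * (1 - q ^ j)" if x: "x \<in> {0..T}" for n j x
  proof (induction j)
    case (Suc j)
    have "\<bar>f (d (n + Suc j) x) - f (d n x)\<bar> \<le> C * q ^ Suc (n + j) + D * q ^ n * (1 - q ^ j)"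
      using step[OF x, of "n + j"] Suc by simp
    also have "C * q ^ Suc (n + j) \<le> C * q ^ (n + j)"
      using C q by (intro mult_left_mono power_decreasing) auto
    also have "C * q ^ (n + j) + D * q ^ n * (1 - q ^ j) = D * q ^ n * (1 - q ^ Suc j)"
      unfolding D(2) by (simp add: power_add algebra_simps)
    finally show ?case by simp
  qed simp
  have approx: "\<bar>f x - f (d n x)\<bar> \<le> D * q ^ n" if x: "x \<in> {0..T}" for n x
  proof (rule LIMSEQ_le_const2)
    have "(\<lambda>j. T * (1 / 2) ^ j) \<longlonglongrightarrow> T * 0"
      by (intro tendsto_mult tendsto_const LIMSEQ_power_zero) simp
    then have lim0: "(\<lambda>j. T * (1 / 2) ^ j) \<longlonglongrightarrow> 0" by simp
    have "(\<lambda>j. d j x - x) \<longlonglongrightarrow> 0"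
    proof (rule Lim_null_comparison[OF _ lim0])
      have "norm (d j x - x) \<le> T * (1 / 2) ^ j" for j
        using d_bounds[of x j] x by (simp add: power_one_over field_simps)
      then show "\<forall>\<^sub>F j in sequentially. norm (d j x - x) \<le> T * (1 / 2) ^ j"
        by (simp add: always_eventually)
    qed
    then have "(\<lambda>j. d j x) \<longlonglongrightarrow> x" by (simp add: LIM_zero_iff)
    then have "(\<lambda>j. d (n + j) x) \<longlonglongrightarrow> x" using LIMSEQ_ignore_initial_segment[of _ x n] by (simp add: add.commute)
    then have "(\<lambda>j. f (d (n + j) x)) \<longlonglongrightarrow> f x"
      using cont d_in[OF x] x unfolding continuous_on_sequentially by (auto simp: o_def)
    then show "(\<lambda>j. \<bar>f (d (n + j) x) - f (d n x)\<bar>) \<longlonglongrightarrow> \<bar>f x - f (d n x)\<bar>"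
      by (intro tendsto_intros)
    have "\<bar>f (d (n + j) x) - f (d n x)\<bar> \<le> D * q ^ n" for j
    proof -
      have "D * q ^ n * (1 - q ^ j) \<le> D * q ^ n * 1" using D q by (intro mult_left_mono) auto
      then show ?thesis using multi[OF x, of n j] by simp
    qed
    then show "\<exists>N. \<forall>j\<ge>N. \<bar>f (d (n + j) x) - f (d n x)\<bar> \<le> D * q ^ n" by blast
  qed
  \<comment> \<open>\<open>2 * D\<close> for the two chains and \<open>C\<close> for the step between their starting points; \<open>2 powr \<gamma>\<close>
    compensates the factor 2 between the distance of the points and the mesh.\<close>
  define C' where "C' = (2 * D + C) * 2 powr \<gamma> / T powr \<gamma>"
  have C': "0 \<le> C'" unfolding C'_def using D C by simp
  have main: "\<bar>f t - f s\<bar> \<le> C' * \<bar>t - s\<bar> powr \<gamma>" if st: "s \<in> {0..T}" "t \<in> {0..T}" "s < t" for s t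
  proof -
    have "\<exists>n. T / 2 ^ Suc n < t - s"
    proof -
      obtain n where "(1 / 2) ^ n < (t - s) / T"
        using real_arch_pow_inv[of "(t - s) / T" "1 / 2"] st T by auto
      moreover have "(1 / 2 :: real) ^ Suc n \<le> (1 / 2) ^ n" by simp
      ultimately have "(1 / 2) ^ Suc n < (t - s) / T" by linarith
      then show ?thesis using T by (intro exI[of _ n]) (simp add: field_simps power_one_over)
    qed
    then obtain n where n: "T / 2 ^ Suc n < t - s" and least: "\<And>m. m < n \<Longrightarrow> \<not> T / 2 ^ Suc m < t - s"
      using exists_least_iff[of "\<lambda>n. T / 2 ^ Suc n < t - s"] by blast
    have le: "t - s \<le> T / 2 ^ n"
    proof (cases n)
      case 0 then show ?thesis using st by auto
    next
      case (Suc m) then show ?thesis using least[of m] by auto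
    qed
    have close: "\<bar>f (d n t) - f (d n s)\<bar> \<le> C * q ^ n"
    proof -
      have "2 ^ n * t / T \<le> 2 ^ n * s / T + 1" using le T by (simp add: field_simps)
      moreover have "2 ^ n * s / T \<le> 2 ^ n * t / T" using st T by (intro divide_right_mono mult_left_mono) auto
      ultimately have "real (k n t) < real (k n s) + 2" "real (k n s) < real (k n t) + 1"
        using k_bounds[of s n] k_bounds[of t n] st by auto
      then have "k n t = k n s \<or> k n t = Suc (k n s)" by linarith
      then show ?thesis
      proof
        assume "k n t = k n s"
        then show ?thesis using C q unfolding d_def by simp
      next
        assume e: "k n t = Suc (k n s)"
        then have lt: "k n s < 2 ^ n" using k_le[OF st(2), of n] by linarith
        show ?thesis using inc[OF lt] unfolding d_def e q_def by simp
      qed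
    qed
    have "\<bar>f t - f s\<bar> \<le> (2 * D + C) * q ^ n"
      using approx[OF st(1), of n] approx[OF st(2), of n] close by (simp add: algebra_simps)
    also have "q ^ n \<le> 2 powr \<gamma> / T powr \<gamma> * (t - s) powr \<gamma>"
    proof -
      have "q ^ n = 2 powr (- \<gamma> * real n)"
        unfolding q_def by (simp add: powr_power mult.commute)
      also have "\<dots> = 2 powr \<gamma> / T powr \<gamma> * (T / 2 ^ Suc n) powr \<gamma>"
        using T by (simp add: powr_divide powr_mult powr_realpow[symmetric] powr_powr powr_minus field_simps)
      also have "\<dots> \<le> 2 powr \<gamma> / T powr \<gamma> * (t - s) powr \<gamma>"
        using n T \<gamma> by (intro mult_left_mono powr_mono2) auto
      finally show ?thesis .
    qed
    then have "(2 * D + C) * q ^ n \<le> (2 * D + C) * (2 powr \<gamma> / T powr \<gamma> * (t - s) powr \<gamma>)"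
      using D C by (intro mult_left_mono) auto
    also have "\<dots> = C' * \<bar>t - s\<bar> powr \<gamma>" unfolding C'_def using st by simp
    finally show ?thesis .
  qed
  show ?thesis
  proof (intro exI[of _ C'] conjI C' ballI)
    fix s t assume "s \<in> {0..T}" "t \<in> {0..T}"
    then show "\<bar>f t - f s\<bar> \<le> C' * \<bar>t - s\<bar> powr \<gamma>"
      using main[of s t] main[of t s] \<gamma> by (cases s t rule: linorder_cases) (auto simp: abs_minus_commute)
  qed
qed

text \<open>The expected sum is finite by monotone convergence; this serves in place of the Borel--Cantelli
  lemma.\<close>

lemma (in prob_space) AE_summable_of_expectation:
  fixes Y :: "nat \<Rightarrow> 'a \<Rightarrow> real"
  assumes Y: "\<And>n. integrable M (Y n)" "\<And>n w. 0 \<le> Y n w" and le: "\<And>n. expectation (Y n) \<le> a n" and a: "summable a"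
  shows "AE w in M. summable (\<lambda>n. Y n w)"
proof -
  have [measurable]: "Y n \<in> borel_measurable M" for n using Y(1) by auto
  have "(\<integral>\<^sup>+w. (\<Sum>n. ennreal (Y n w)) \<partial>M) = (\<Sum>n. (\<integral>\<^sup>+w. ennreal (Y n w) \<partial>M))"
    by (rule nn_integral_suminf) simp
  also have "\<dots> = (\<Sum>n. ennreal (expectation (Y n)))"
    using Y by (simp add: nn_integral_eq_integral)
  also have "\<dots> \<noteq> \<top>"
  proof -
    have nn: "0 \<le> expectation (Y n)" for n using Y(2) by simp
    have "summable (\<lambda>n. expectation (Y n))"
      using a by (rule summable_comparison_test_ev[rotated]) (use nn le in \<open>auto intro!: always_eventually\<close>)
    then show ?thesis using nn by (simp add: suminf_ennreal2)
  qed
  finally have "AE w in M. (\<Sum>n. ennreal (Y n w)) \<noteq> \<infinity>"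
    by (intro nn_integral_noteq_infinite) auto
  then show ?thesis
    by eventually_elim (auto intro: summable_suminf_not_top Y(2))
qed

text \<open>The even moments \<open>(2k - 1)!!\<close> of the standard normal law.\<close>

definition gauss_coeff :: "nat \<Rightarrow> real" where
  "gauss_coeff k = fact (2 * k) / (2 ^ k * fact k)"

lemma (in prob_space) centered_gaussian_moment_aux:
  assumes "centered_gaussian M X"
  shows "\<exists>v\<ge>0. \<forall>k. integrable M (\<lambda>w. X w ^ (2 * k)) \<and> expectation (\<lambda>w. X w ^ (2 * k)) = gauss_coeff k * v ^ k"
proof -
  let ?X = "\<lambda>k. \<lambda>w. X w ^ (2 * k)"
  have [measurable]: "X \<in> borel_measurable M" using assms unfolding centered_gaussian_def by auto
  consider "AE w in M. X w = 0" | \<sigma> where "0 < \<sigma>" "distributed M lborel X (\<lambda>x. ennreal (normal_density 0 \<sigma> x))"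
    using assms unfolding centered_gaussian_def by auto
  then show ?thesis
  proof cases
    case 1
    show ?thesis
    proof (intro exI[of _ 0] conjI allI)
      fix k
      have ae: "AE w in M. X w ^ (2 * k) = (if k = 0 then 1 else 0)"
        using 1 by eventually_elim auto
      show "integrable M (?X k)"
        using integrable_cong_AE[OF _ _ ae] by auto
      have "expectation (?X k) = expectation (\<lambda>w. if k = 0 then 1 else 0)"
        by (rule integral_cong_AE[OF _ _ ae]) auto
      also have "\<dots> = gauss_coeff k * 0 ^ k" by (auto simp: gauss_coeff_def prob_space)
      finally show "expectation (?X k) = gauss_coeff k * 0 ^ k" .
    qed simp
  next
    case 2
    show ?thesis
    proof (intro exI[of _ "\<sigma>\<^sup>2"] conjI allI)
      fix k
      have m: "has_bochner_integral lborel (\<lambda>x. normal_density 0 \<sigma> x * x ^ (2 * k)) (fact (2 * k) / ((2 / \<sigma>\<^sup>2) ^ k * fact k))"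
        using normal_moment_even[OF 2(1), of 0 k] by simp
      show "integrable M (?X k)"
        using distributed_integrable[OF 2(2), of "\<lambda>x. x ^ (2 * k)"] m by (auto simp: has_bochner_integral_iff)
      have "expectation (?X k) = (\<integral>x. normal_density 0 \<sigma> x * x ^ (2 * k) \<partial>lborel)"
        using distributed_integral[OF 2(2), of "\<lambda>x. x ^ (2 * k)"] by auto
      also have "\<dots> = fact (2 * k) / ((2 / \<sigma>\<^sup>2) ^ k * fact k)" using m by (simp add: has_bochner_integral_iff)
      also have "\<dots> = gauss_coeff k * \<sigma>\<^sup>2 ^ k" using 2(1) by (simp add: gauss_coeff_def power_divide)
      finally show "expectation (?X k) = gauss_coeff k * \<sigma>\<^sup>2 ^ k" .
    qed simp
  qed
qed

lemma (in prob_space) centered_gaussian_even_moment: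
  assumes "centered_gaussian M X"
  shows "integrable M (\<lambda>w. X w ^ (2 * k))"
    and "expectation (\<lambda>w. X w ^ (2 * k)) = gauss_coeff k * (expectation (\<lambda>w. (X w)\<^sup>2)) ^ k"
proof -
  let ?X = "\<lambda>k. \<lambda>w. X w ^ (2 * k)"
  obtain v where v: "\<And>k. integrable M (?X k)" "\<And>k. expectation (?X k) = gauss_coeff k * v ^ k"
    using centered_gaussian_moment_aux[OF assms] by blast
  have "gauss_coeff 1 = 1" by (simp add: gauss_coeff_def fact_numeral)
  then have "expectation (\<lambda>w. (X w)\<^sup>2) = v" using v(2)[of 1] by simp
  then show "integrable M (?X k)"
    "expectation (?X k) = gauss_coeff k * (expectation (\<lambda>w. (X w)\<^sup>2)) ^ k"
    using v by auto
qed

lemma (in prob_space) centered_gaussian_square_integrable: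
  assumes "centered_gaussian M X"
  shows "integrable M (\<lambda>w. (X w)\<^sup>2)"
  using centered_gaussian_even_moment(1)[OF assms, of 1] by simp

lemma (in prob_space) centered_gaussian_fourth_moment:
  assumes "centered_gaussian M X"
  shows "integrable M (\<lambda>w. (X w) ^ 4)" "expectation (\<lambda>w. (X w) ^ 4) = 3 * (expectation (\<lambda>w. (X w)\<^sup>2))\<^sup>2"
  using centered_gaussian_even_moment[OF assms, of 2] by (auto simp: gauss_coeff_def fact_numeral)

text \<open>Wick's formula for two squares, by polarization: the fourth moments of the sum and of the
  difference are known in terms of their variances.\<close>

lemma (in prob_space) gaussian_product_moment:
  assumes X: "centered_gaussian M X" and Y: "centered_gaussian M Y"
    and P: "centered_gaussian M (\<lambda>w. X w + Y w)" and D: "centered_gaussian M (\<lambda>w. X w - Y w)"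
  shows "integrable M (\<lambda>w. X w * Y w)" "integrable M (\<lambda>w. (X w)\<^sup>2 * (Y w)\<^sup>2)"
    "expectation (\<lambda>w. (X w)\<^sup>2 * (Y w)\<^sup>2) =
       expectation (\<lambda>w. (X w)\<^sup>2) * expectation (\<lambda>w. (Y w)\<^sup>2) + 2 * (expectation (\<lambda>w. X w * Y w))\<^sup>2"
proof -
  let ?X2 = "\<lambda>w. (X w)\<^sup>2 * (Y w)\<^sup>2"
  note i2 = centered_gaussian_square_integrable[OF X] centered_gaussian_square_integrable[OF Y]
    centered_gaussian_square_integrable[OF P] centered_gaussian_square_integrable[OF D]
  note i4 = centered_gaussian_fourth_moment(1)[OF X] centered_gaussian_fourth_moment(1)[OF Y]
    centered_gaussian_fourth_moment(1)[OF P] centered_gaussian_fourth_moment(1)[OF D]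
  note e4 = centered_gaussian_fourth_moment(2)[OF X] centered_gaussian_fourth_moment(2)[OF Y]
    centered_gaussian_fourth_moment(2)[OF P] centered_gaussian_fourth_moment(2)[OF D]
  have xy: "X w * Y w = ((X w + Y w)\<^sup>2 - (X w - Y w)\<^sup>2) / 4" for w
    by (simp add: power2_eq_square algebra_simps)
  have x2y2: "(X w)\<^sup>2 * (Y w)\<^sup>2 = ((X w + Y w) ^ 4 + (X w - Y w) ^ 4 - 2 * (X w) ^ 4 - 2 * (Y w) ^ 4) / 12" for w
    by (simp add: power2_eq_square power4_eq_xxxx algebra_simps)
  show ixy: "integrable M (\<lambda>w. X w * Y w)"
    unfolding xy using i2 by auto
  show "integrable M ?X2"
    unfolding x2y2 using i4 by auto
  let ?a = "expectation (\<lambda>w. (X w)\<^sup>2)" and ?b = "expectation (\<lambda>w. (Y w)\<^sup>2)" and ?c = "expectation (\<lambda>w. X w * Y w)"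
  have p: "expectation (\<lambda>w. (X w + Y w)\<^sup>2) = ?a + ?b + 2 * ?c"
  proof -
    have "expectation (\<lambda>w. (X w + Y w)\<^sup>2) = expectation (\<lambda>w. (X w)\<^sup>2 + (Y w)\<^sup>2 + 2 * (X w * Y w))"
      by (intro Bochner_Integration.integral_cong) (auto simp: power2_sum)
    then show ?thesis using i2 ixy by simp
  qed
  have m: "expectation (\<lambda>w. (X w - Y w)\<^sup>2) = ?a + ?b - 2 * ?c"
  proof -
    have "expectation (\<lambda>w. (X w - Y w)\<^sup>2) = expectation (\<lambda>w. (X w)\<^sup>2 + (Y w)\<^sup>2 - 2 * (X w * Y w))"
      by (intro Bochner_Integration.integral_cong) (auto simp: power2_diff)
    then show ?thesis using i2 ixy by simp
  qed
  have "expectation ?X2 = (3 * (?a + ?b + 2 * ?c)\<^sup>2 + 3 * (?a + ?b - 2 * ?c)\<^sup>2 - 2 * (3 * ?a\<^sup>2) - 2 * (3 * ?b\<^sup>2)) / 12"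
    unfolding x2y2 using i4 by (simp add: e4 p m)
  also have "\<dots> = ?a * ?b + 2 * ?c\<^sup>2"
    by (simp add: power2_eq_square algebra_simps)
  finally show "expectation ?X2 = ?a * ?b + 2 * ?c\<^sup>2" .
qed

section \<open>Gaussian increments: path regularity and sums of squares\<close>

text \<open>If the process is centered Gaussian, so are the sums and differences of any two elements; this is
  what Wick's formula requires.\<close>

definition gspan :: "real \<Rightarrow> (real \<Rightarrow> 'a \<Rightarrow> real) \<Rightarrow> ('a \<Rightarrow> real) set" where
  "gspan T G = {X. \<exists>I c. finite I \<and> I \<subseteq> {0..T} \<and> X = (\<lambda>w. \<Sum>t\<in>I. c t * G t w)}"

lemma gspan_base: "t \<in> {0..T} \<Longrightarrow> G t \<in> gspan T G"
  unfolding gspan_def by (auto intro!: exI[of _ "{t}"] exI[of _ "\<lambda>_. 1"])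

lemma gspan_scale: "X \<in> gspan T G \<Longrightarrow> (\<lambda>w. a * X w) \<in> gspan T G"
proof -
  assume "X \<in> gspan T G"
  then obtain I c where "finite I" "I \<subseteq> {0..T}" "X = (\<lambda>w. \<Sum>t\<in>I. c t * G t w)"
    unfolding gspan_def by blast
  then show ?thesis
    unfolding gspan_def
    by (auto intro!: exI[of _ I] exI[of _ "\<lambda>t. a * c t"] simp: sum_distrib_left mult.assoc)
qed

lemma gspan_add:
  assumes "X \<in> gspan T G" "Y \<in> gspan T G"
  shows "(\<lambda>w. X w + Y w) \<in> gspan T G"
proof -
  obtain I c where I: "finite I" "I \<subseteq> {0..T}" "X = (\<lambda>w. \<Sum>t\<in>I. c t * G t w)"
    using assms(1) unfolding gspan_def by blast
  obtain J d where J: "finite J" "J \<subseteq> {0..T}" "Y = (\<lambda>w. \<Sum>t\<in>J. d t * G t w)"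
    using assms(2) unfolding gspan_def by blast
  define e where "e = (\<lambda>t. (if t \<in> I then c t else 0) + (if t \<in> J then d t else 0))"
  have "X w + Y w = (\<Sum>t\<in>I \<union> J. e t * G t w)" for w
  proof -
    have "X w = (\<Sum>t\<in>I \<union> J. (if t \<in> I then c t else 0) * G t w)"
      unfolding I(3) using I(1) J(1) by (intro sum.mono_neutral_cong_left) auto
    moreover have "Y w = (\<Sum>t\<in>I \<union> J. (if t \<in> J then d t else 0) * G t w)"
      unfolding J(3) using I(1) J(1) by (intro sum.mono_neutral_cong_left) auto
    ultimately show ?thesis by (simp add: e_def distrib_right sum.distrib)
  qed
  then show ?thesis
    unfolding gspan_def using I(1,2) J(1,2) by (intro CollectI exI[of _ "I \<union> J"] exI[of _ e]) auto
qed

lemma gspan_diff: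
  assumes "X \<in> gspan T G" "Y \<in> gspan T G"
  shows "(\<lambda>w. X w - Y w) \<in> gspan T G"
  using gspan_add[OF assms(1) gspan_scale[OF assms(2), of "-1"]] by simp

lemma gspan_gaussian:
  "centered_gaussian_process M T G \<Longrightarrow> X \<in> gspan T G \<Longrightarrow> centered_gaussian M X"
  unfolding centered_gaussian_process_def gspan_def by blast

text \<open>The variance of the sum of squares is twice the sum of the squared covariances. A
  nonnegative covariance is at most \<open>v\<close>, so its square is at most \<open>v\<close> times itself, and the sum of
  the covariances is the second moment of the sum.\<close>

lemma (in prob_space) gaussian_square_sum_variance:
  assumes G: "centered_gaussian_process M T G"
    and X: "\<And>j. j < N \<Longrightarrow> X j \<in> gspan T G"
    and pos: "\<And>j k. j < N \<Longrightarrow> k < N \<Longrightarrow> 0 \<le> expectation (\<lambda>w. X j w * X k w)"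
    and v: "\<And>j. j < N \<Longrightarrow> expectation (\<lambda>w. (X j w)\<^sup>2) \<le> v"
  defines "S \<equiv> \<Sum>j<N. expectation (\<lambda>w. (X j w)\<^sup>2)"
  shows "integrable M (\<lambda>w. ((\<Sum>j<N. (X j w)\<^sup>2) - S)\<^sup>2)"
    and "expectation (\<lambda>w. ((\<Sum>j<N. (X j w)\<^sup>2) - S)\<^sup>2) \<le> 2 * v * expectation (\<lambda>w. (\<Sum>j<N. X j w)\<^sup>2)"
proof -
  let ?v = "\<lambda>j. expectation (\<lambda>w. (X j w)\<^sup>2)" and ?c = "\<lambda>j k. expectation (\<lambda>w. X j w * X k w)"
  let ?M = "\<Sum>j<N. \<Sum>k<N. ?v j * ?v k + 2 * (?c j k)\<^sup>2" and ?V = "\<lambda>w. ((\<Sum>j<N. (X j w)\<^sup>2) - S)\<^sup>2"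
    and ?X = "\<lambda>w. \<Sum>j<N. \<Sum>k<N. (X j w)\<^sup>2 * (X k w)\<^sup>2"
  have g: "centered_gaussian M Y" if "Y \<in> gspan T G" for Y using gspan_gaussian[OF G that] .
  have pm: "integrable M (\<lambda>w. X j w * X k w)" "integrable M (\<lambda>w. (X j w)\<^sup>2 * (X k w)\<^sup>2)"
    "expectation (\<lambda>w. (X j w)\<^sup>2 * (X k w)\<^sup>2) = ?v j * ?v k + 2 * (?c j k)\<^sup>2" if "j < N" "k < N" for j k
    using gaussian_product_moment[OF g[OF X] g[OF X] g[OF gspan_add[OF X X]] g[OF gspan_diff[OF X X]], of j k] that
    by blast+
  have sq: "integrable M (\<lambda>w. (X j w)\<^sup>2)" if "j < N" for j
    using centered_gaussian_square_integrable[OF g[OF X[OF that]]] .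
  have expand: "((\<Sum>j<N. (X j w)\<^sup>2) - S)\<^sup>2 = (\<Sum>j<N. \<Sum>k<N. (X j w)\<^sup>2 * (X k w)\<^sup>2) - 2 * S * (\<Sum>j<N. (X j w)\<^sup>2) + S\<^sup>2" for w
    by (simp add: power2_diff power2_eq_square[of "\<Sum>j<N. (X j w)\<^sup>2"] sum_product)
  show "integrable M ?V"
    unfolding expand by (intro Bochner_Integration.integrable_add Bochner_Integration.integrable_diff
      Bochner_Integration.integrable_sum integrable_mult_right pm sq integrable_const) auto
  have "expectation ?V =
      ?M - 2 * S * S + S\<^sup>2"
  proof -
    have i1: "integrable M ?X"
      by (intro Bochner_Integration.integrable_sum pm) auto
    have i2: "integrable M (\<lambda>w. 2 * S * (\<Sum>j<N. (X j w)\<^sup>2))"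
      by (intro integrable_mult_right Bochner_Integration.integrable_sum sq) auto
    have e1: "expectation ?X = ?M"
    proof -
      have "expectation ?X = (\<Sum>j<N. expectation (\<lambda>w. \<Sum>k<N. (X j w)\<^sup>2 * (X k w)\<^sup>2))"
        by (intro Bochner_Integration.integral_sum Bochner_Integration.integrable_sum pm) auto
      also have "\<dots> = (\<Sum>j<N. \<Sum>k<N. expectation (\<lambda>w. (X j w)\<^sup>2 * (X k w)\<^sup>2))"
        by (intro sum.cong refl Bochner_Integration.integral_sum pm) auto
      also have "\<dots> = ?M"
        by (intro sum.cong refl pm) auto
      finally show ?thesis .
    qed
    have e2: "expectation (\<lambda>w. \<Sum>j<N. (X j w)\<^sup>2) = S"
      unfolding S_def by (intro Bochner_Integration.integral_sum sq) auto
    show ?thesis unfolding expand using i1 i2 by (simp add: e1 e2 prob_space)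
  qed
  also have "\<dots> = 2 * (\<Sum>j<N. \<Sum>k<N. (?c j k)\<^sup>2)"
  proof -
    have "?M = S * S + 2 * (\<Sum>j<N. \<Sum>k<N. (?c j k)\<^sup>2)"
      unfolding S_def sum_product by (simp only: sum.distrib sum_distrib_left)
    then show ?thesis by (simp add: power2_eq_square)
  qed
  also have "\<dots> \<le> 2 * (\<Sum>j<N. \<Sum>k<N. v * ?c j k)"
  proof (intro mult_left_mono sum_mono)
    fix j k assume "j \<in> {..<N}" "k \<in> {..<N}"
    then have jk: "j < N" "k < N" by auto
    have "?c j k \<le> expectation (\<lambda>w. ((X j w)\<^sup>2 + (X k w)\<^sup>2) / 2)"
    proof (intro integral_mono pm jk)
      show "integrable M (\<lambda>w. ((X j w)\<^sup>2 + (X k w)\<^sup>2) / 2)" using sq[OF jk(1)] sq[OF jk(2)] by simp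
      fix w
      show "X j w * X k w \<le> ((X j w)\<^sup>2 + (X k w)\<^sup>2) / 2"
        using zero_le_power2[of "X j w - X k w"] by (simp add: power2_diff)
    qed
    also have "\<dots> = (?v j + ?v k) / 2" using sq[OF jk(1)] sq[OF jk(2)] by simp
    also have "\<dots> \<le> v" using v[OF jk(1)] v[OF jk(2)] by simp
    finally show "(?c j k)\<^sup>2 \<le> v * ?c j k"
      using pos[OF jk] by (simp add: power2_eq_square mult_right_mono)
  qed simp
  also have "\<dots> = 2 * v * (\<Sum>j<N. \<Sum>k<N. ?c j k)"
    by (simp only: sum_distrib_left mult.assoc)
  also have "(\<Sum>j<N. \<Sum>k<N. ?c j k) = expectation (\<lambda>w. (\<Sum>j<N. X j w)\<^sup>2)"
  proof -
    have "expectation (\<lambda>w. (\<Sum>j<N. X j w)\<^sup>2) = expectation (\<lambda>w. \<Sum>j<N. \<Sum>k<N. X j w * X k w)"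
      by (simp add: power2_eq_square sum_product)
    also have "\<dots> = (\<Sum>j<N. expectation (\<lambda>w. \<Sum>k<N. X j w * X k w))"
      by (intro Bochner_Integration.integral_sum Bochner_Integration.integrable_sum pm) auto
    also have "\<dots> = (\<Sum>j<N. \<Sum>k<N. ?c j k)"
      by (intro sum.cong refl Bochner_Integration.integral_sum pm) auto
    finally show ?thesis by simp
  qed
  finally show "expectation ?V \<le> 2 * v * expectation (\<lambda>w. (\<Sum>j<N. X j w)\<^sup>2)" .
qed

text \<open>The probabilistic half of Kolmogorov's continuity theorem. Moments of order \<open>2k\<close> with
  \<open>2k (H - \<gamma>) > 1\<close> outweigh the \<open>2^n\<close> increments on level \<open>n\<close>.\<close>

lemma (in prob_space) gaussian_holder_paths:
  assumes G: "centered_gaussian_process M T G" and cont: "continuous_process M T G" and T: "0 < T"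
    and C2: "0 < C2" and up: "\<And>s t. s \<in> {0..T} \<Longrightarrow> t \<in> {0..T} \<Longrightarrow>
      expectation (\<lambda>w. (G t w - G s w)\<^sup>2) \<le> C2 * \<bar>t - s\<bar> powr (2 * H)"
    and \<gamma>: "0 < \<gamma>" "\<gamma> < H"
  shows "AE w in M. \<exists>C\<ge>0. \<forall>s\<in>{0..T}. \<forall>t\<in>{0..T}. \<bar>G t w - G s w\<bar> \<le> C * \<bar>t - s\<bar> powr \<gamma>"
proof -
  obtain k :: nat where k: "1 / (2 * (H - \<gamma>)) < real k" using reals_Archimedean2 by blast
  have k1: "1 < 2 * real k * (H - \<gamma>)" using k \<gamma> by (simp add: field_simps)
  have k0: "0 < k" using k1 by (cases k) auto
  define q :: real where "q = 2 powr (- \<gamma>)"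
  have q: "0 < q" unfolding q_def by simp
  define p where "p = (\<lambda>n j. T * real j / 2 ^ n)"
  define X where "X = (\<lambda>n j w. G (p n (Suc j)) w - G (p n j) w)"
  have pT: "p n j \<in> {0..T}" if "j \<le> 2 ^ n" for n j
  proof -
    have "real j \<le> 2 ^ n" using that by (metis of_nat_le_iff of_nat_numeral of_nat_power)
    then have "T * real j / 2 ^ n \<le> T * 2 ^ n / 2 ^ n" using T by (intro divide_right_mono mult_left_mono) auto
    then show ?thesis unfolding p_def using T by auto
  qed
  have pstep: "p n (Suc j) - p n j = T / 2 ^ n" for n j
    unfolding p_def by (simp add: field_simps)
  have gX: "centered_gaussian M (X n j)" if "j < 2 ^ n" for n j
    unfolding X_def using that by (intro gspan_gaussian[OF G] gspan_diff gspan_base pT) auto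
  define Y where "Y = (\<lambda>n w. \<Sum>j<2 ^ n. (X n j w / q ^ n) ^ (2 * k))"
  let ?Z = "\<lambda>n j w. (X n j w / q ^ n) ^ (2 * k)"
  have iX: "integrable M (?Z n j)" if "j < 2 ^ n" for n j
    unfolding power_divide using centered_gaussian_even_moment(1)[OF gX[OF that], of k] by simp
  have iY: "integrable M (Y n)" for n
    unfolding Y_def by (intro Bochner_Integration.integrable_sum iX) auto
  define A where "A = gauss_coeff k * (C2 * T powr (2 * H)) ^ k"
  define h :: real where "h = 2 powr (- (2 * H))"
  define \<rho> where "\<rho> = 2 * (h ^ k / q ^ (2 * k))"
  have \<rho>: "0 < \<rho>" "\<rho> < 1"
  proof -
    have "h ^ k / q ^ (2 * k) = 2 powr (- (2 * real k * (H - \<gamma>)))"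
      unfolding h_def q_def by (simp add: powr_power powr_diff[symmetric] algebra_simps)
    then have e: "\<rho> = 2 powr (1 - 2 * real k * (H - \<gamma>))"
      unfolding \<rho>_def by (simp add: powr_diff powr_minus_divide)
    then show "0 < \<rho>" by simp
    have "2 powr (1 - 2 * real k * (H - \<gamma>)) < (2 :: real) powr 0" using k1 by (intro powr_less_mono) auto
    then show "\<rho> < 1" unfolding e by simp
  qed
  have gc: "0 \<le> gauss_coeff k" unfolding gauss_coeff_def by simp
  have eX: "expectation (?Z n j) \<le> A * \<rho> ^ n / 2 ^ n" if j: "j < 2 ^ n" for n j
  proof -
    have "expectation (\<lambda>w. (X n j w)\<^sup>2) \<le> C2 * (T / 2 ^ n) powr (2 * H)"
      using up[OF pT pT, of j n "Suc j" n] j T unfolding X_def pstep by simp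
    then have "gauss_coeff k * expectation (\<lambda>w. (X n j w)\<^sup>2) ^ k \<le> gauss_coeff k * (C2 * (T / 2 ^ n) powr (2 * H)) ^ k"
      using gc by (intro mult_left_mono power_mono) auto
    then have "expectation (\<lambda>w. (X n j w) ^ (2 * k)) \<le> gauss_coeff k * (C2 * (T / 2 ^ n) powr (2 * H)) ^ k"
      using centered_gaussian_even_moment(2)[OF gX[OF j], of k] by simp
    moreover have "expectation (?Z n j) = expectation (\<lambda>w. (X n j w) ^ (2 * k)) / (q ^ n) ^ (2 * k)"
      unfolding power_divide by simp
    ultimately have "expectation (?Z n j) \<le> gauss_coeff k * (C2 * (T / 2 ^ n) powr (2 * H)) ^ k / (q ^ n) ^ (2 * k)"
      using q by (simp add: divide_right_mono)
    also have "\<dots> = A * \<rho> ^ n / 2 ^ n"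
    proof -
      have "(1 / 2 ^ n) powr (2 * H) = h ^ n"
        unfolding h_def by (simp add: powr_divide powr_power powr_minus_divide powr_powr powr_realpow[symmetric] mult_ac)
      then have "(T / 2 ^ n) powr (2 * H) = T powr (2 * H) * h ^ n"
        using powr_mult[of T "1 / 2 ^ n" "2 * H"] by simp
      then show ?thesis
        unfolding A_def \<rho>_def by (simp add: power_mult_distrib power_divide power_mult[symmetric] mult_ac)
    qed
    finally show ?thesis .
  qed
  have eY: "expectation (Y n) \<le> A * \<rho> ^ n" for n
  proof -
    have "expectation (Y n) = (\<Sum>j<2 ^ n. expectation (?Z n j))"
      unfolding Y_def by (intro Bochner_Integration.integral_sum iX) auto
    also have "\<dots> \<le> (\<Sum>j<(2 :: nat) ^ n. A * \<rho> ^ n / 2 ^ n)"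
      by (intro sum_mono eX) auto
    also have "\<dots> = A * \<rho> ^ n" by simp
    finally show ?thesis .
  qed
  have "AE w in M. summable (\<lambda>n. Y n w)"
  proof (rule AE_summable_of_expectation[OF iY])
    show "0 \<le> Y n w" for n w unfolding Y_def by (intro sum_nonneg) (simp add: power_mult)
    show "summable (\<lambda>n. A * \<rho> ^ n)" using \<rho> by (intro summable_mult summable_geometric) simp
  qed (rule eY)
  then show ?thesis
    using cont unfolding continuous_process_def
  proof eventually_elim
    case (elim w)
    have "bounded (range (\<lambda>n. Y n w))"
      using elim(1) summable_LIMSEQ_zero convergent_imp_Bseq Bseq_eq_bounded convergentI by metis
    then obtain B0 where B0: "\<And>n. \<bar>Y n w\<bar> \<le> B0" by (auto simp: bounded_iff)
    \<comment> \<open>The bound 1 lets a power bounded by \<open>B\<close> be replaced by its base without taking roots.\<close>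
    define B where "B = max 1 B0"
    have "\<exists>C'\<ge>0. \<forall>s\<in>{0..T}. \<forall>t\<in>{0..T}. \<bar>G t w - G s w\<bar> \<le> C' * \<bar>t - s\<bar> powr \<gamma>"
    proof (rule dyadic_chaining[where f = "\<lambda>t. G t w", OF T elim(2) \<gamma>(1)])
      show "0 \<le> B" unfolding B_def by simp
      fix n j assume j: "j < (2 :: nat) ^ n"
      have XY: "(X n j w / q ^ n) ^ (2 * k) \<le> Y n w"
        unfolding Y_def using j by (intro member_le_sum) (auto simp: power_mult)
      have le: "\<bar>X n j w / q ^ n\<bar> ^ (2 * k) \<le> B"
      proof -
        have "\<bar>X n j w / q ^ n\<bar> ^ (2 * k) = (X n j w / q ^ n) ^ (2 * k)" by (rule power_even_abs) simp
        then show ?thesis using XY B0[of n] unfolding B_def by linarith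
      qed
      have "\<bar>X n j w / q ^ n\<bar> \<le> B"
      proof (cases "\<bar>X n j w / q ^ n\<bar> \<le> 1")
        case True then show ?thesis unfolding B_def by linarith
      next
        case False
        then have "\<bar>X n j w / q ^ n\<bar> ^ 1 \<le> \<bar>X n j w / q ^ n\<bar> ^ (2 * k)"
          using k0 by (intro power_increasing) auto
        then show ?thesis using le by simp
      qed
      then have "\<bar>X n j w\<bar> \<le> B * q ^ n" using q by (simp add: abs_divide divide_le_eq)
      then show "\<bar>G (T * real (Suc j) / 2 ^ n) w - G (T * real j / 2 ^ n) w\<bar> \<le> B * (2 powr (- \<gamma>)) ^ n"
        unfolding X_def p_def q_def .
    qed
    then show ?case .
  qed
qed

section \<open>Integrands assembled from cells, and the residual recursion\<close>

lemma sum_indicator_partition: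
  fixes u :: "nat \<Rightarrow> real" and c :: "nat \<Rightarrow> real"
  assumes mono: "\<And>k. u k \<le> u (Suc k)"
  shows "(\<Sum>k<N. indicat_real {u k..<u (Suc k)} s * c k) = 0 \<or>
    (\<exists>k<N. s \<in> {u k..<u (Suc k)} \<and> (\<Sum>k<N. indicat_real {u k..<u (Suc k)} s * c k) = c k)"
proof (induction N)
  case (Suc N)
  show ?case
  proof (cases "s \<in> {u N..<u (Suc N)}")
    case True
    have z: "indicat_real {u k..<u (Suc k)} s * c k = 0" if "k < N" for k
    proof -
      have "u (Suc k) \<le> u N" by (rule lift_Suc_mono_le[of u, OF mono]) (use that in simp)
      then show ?thesis using True by simp
    qed
    have "(\<Sum>k<N. indicat_real {u k..<u (Suc k)} s * c k) = 0" by (intro sum.neutral ballI z) simp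
    then have "(\<Sum>k<Suc N. indicat_real {u k..<u (Suc k)} s * c k) = c N" using True by simp
    then show ?thesis using True by blast
  next
    case False
    then have "(\<Sum>k<Suc N. indicat_real {u k..<u (Suc k)} s * c k) = (\<Sum>k<N. indicat_real {u k..<u (Suc k)} s * c k)" by simp
    then show ?thesis using Suc less_SucI by metis
  qed
qed simp

text \<open>At each time at most one block is active, so the series defining the integrand is a finite sum.\<close>

lemma sums_of_disjoint_blocks:
  fixes t :: "nat \<Rightarrow> real" and b :: "nat \<Rightarrow> real"
  assumes mono: "\<And>n. t n \<le> t (Suc n)" and supp: "\<And>n. s \<notin> {t n..<t (Suc n)} \<Longrightarrow> b n = 0"
  shows "summable b" "suminf b = 0 \<or> (\<exists>n. suminf b = b n)"
proof -
  have "\<exists>n. \<forall>m. m \<noteq> n \<longrightarrow> b m = 0"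
  proof (cases "\<exists>n. s \<in> {t n..<t (Suc n)}")
    case True
    then obtain n where n: "s \<in> {t n..<t (Suc n)}" by blast
    have "s \<notin> {t m..<t (Suc m)}" if "m \<noteq> n" for m
    proof (cases "m < n")
      case True
      then have "t (Suc m) \<le> t n" by (intro lift_Suc_mono_le[of t, OF mono]) simp
      then show ?thesis using n by auto
    next
      case False
      then have "t (Suc n) \<le> t m" using that by (intro lift_Suc_mono_le[of t, OF mono]) simp
      then show ?thesis using n by auto
    qed
    then show ?thesis using supp by blast
  qed (use supp in blast)
  then obtain n where n: "\<And>m. m \<noteq> n \<Longrightarrow> b m = 0" by blast
  have "b sums (\<Sum>m\<in>{n}. b m)" by (rule sums_finite) (use n in auto)
  then have "b sums b n" by simp
  then show "summable b" "suminf b = 0 \<or> (\<exists>n. suminf b = b n)"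
    by (auto simp: sums_iff)
qed

text \<open>Infinitely many blocks, the \<open>n\<close>-th one consisting of \<open>N n\<close> cells of length \<open>d n\<close> that start
  at \<open>u n 0\<close>, and an amplitude \<open>m n\<close> for each block.\<close>

locale step_grid = gls_path +
  fixes u :: "nat \<Rightarrow> nat \<Rightarrow> real" and N :: "nat \<Rightarrow> nat" and m d :: "nat \<Rightarrow> real"
  assumes u0: "0 \<le> u 0 0" and u_mono: "\<And>n k. u n k \<le> u n (Suc k)" and chain: "\<And>n. u n (N n) = u (Suc n) 0"
    and u_le: "\<And>n. u n 0 \<le> T" and u_step: "\<And>n k. u n (Suc k) - u n k = d n"
begin

definition block :: "nat \<Rightarrow> real \<Rightarrow> real" where
  "block n s = (\<Sum>k<N n. m n * piece (u n k) (u n (Suc k)) s)"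

definition \<psi> :: "real \<Rightarrow> real" where
  "\<psi> s = (\<Sum>n. block n s)"

lemma u_mono': "j \<le> k \<Longrightarrow> u n j \<le> u n k"
  by (rule lift_Suc_mono_le[of "u n", OF u_mono])

lemma start_mono: "u n 0 \<le> u (Suc n) 0"
  using u_mono'[of 0 "N n" n] chain by simp

lemma u_nonneg: "0 \<le> u n k"
proof -
  have "u 0 0 \<le> u n 0" by (rule lift_Suc_mono_le[of "\<lambda>n. u n 0", OF start_mono]) simp
  then show ?thesis using u0 u_mono'[of 0 k n] by simp
qed

lemma u_le_T: "k \<le> N n \<Longrightarrow> u n k \<le> T"
  using u_mono'[of k "N n" n] chain[of n] u_le[of "Suc n"] by simp

lemma block_measurable [measurable]: "block n \<in> borel_measurable borel"
  unfolding block_def by measurable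

lemma block_cases:
  "block n s = 0 \<or> (\<exists>k<N n. s \<in> {u n k..<u n (Suc k)} \<and> block n s = m n * (g s - g (u n k)))"
proof -
  have "block n s = (\<Sum>k<N n. indicat_real {u n k..<u n (Suc k)} s * (m n * (g s - g (u n k))))"
    unfolding block_def piece_def by (intro sum.cong) auto
  then show ?thesis using sum_indicator_partition[of "u n", OF u_mono, where c = "\<lambda>k. m n * (g s - g (u n k))" and N = "N n" and s = s]
    by auto
qed

lemma block_support: "s \<notin> {u n 0..<u (Suc n) 0} \<Longrightarrow> block n s = 0"
proof -
  assume s: "s \<notin> {u n 0..<u (Suc n) 0}"
  have "s \<notin> {u n k..<u n (Suc k)}" if "k < N n" for k
    using s u_mono'[of 0 k n] u_mono'[of "Suc k" "N n" n] that chain[of n] by auto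
  then show ?thesis using block_cases by blast
qed

lemma block_sums: "(\<lambda>n. block n s) sums \<psi> s"
  unfolding \<psi>_def
  by (intro summable_sums sums_of_disjoint_blocks(1)[of "\<lambda>n. u n 0" s, OF start_mono block_support])

lemma \<psi>_measurable [measurable]: "\<psi> \<in> borel_measurable borel"
  by (rule borel_measurable_LIMSEQ_real[OF block_sums[unfolded sums_def]]) simp

lemma \<psi>_bound:
  assumes B: "\<And>n. \<bar>m n\<bar> * K * d n powr \<gamma> \<le> B"
  shows "\<bar>\<psi> s\<bar> \<le> B"
proof -
  have "0 \<le> \<bar>m 0\<bar> * K * d 0 powr \<gamma>" using K0 by simp
  then have B0: "0 \<le> B" using B[of 0] by linarith
  have "\<bar>block n s\<bar> \<le> B" for n
    using block_cases[of n s]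
  proof
    assume "\<exists>k<N n. s \<in> {u n k..<u n (Suc k)} \<and> block n s = m n * (g s - g (u n k))"
    then obtain k where k: "s \<in> {u n k..<u n (Suc k)}" "block n s = m n * (g s - g (u n k))" by blast
    have "\<bar>g s - g (u n k)\<bar> \<le> K * \<bar>s - u n k\<bar> powr \<gamma>" by (rule holder_g)
    also have "\<dots> \<le> K * d n powr \<gamma>"
      using k(1) u_step[of n k] \<gamma>\<alpha> \<alpha>01 K0 by (intro mult_left_mono powr_mono2) auto
    finally have "\<bar>block n s\<bar> \<le> \<bar>m n\<bar> * (K * d n powr \<gamma>)"
      unfolding k(2) abs_mult by (intro mult_left_mono) auto
    then show ?thesis using B[of n] by (simp add: mult.assoc)
  qed (use B0 in simp)
  moreover have "\<psi> s = 0 \<or> (\<exists>n. \<psi> s = block n s)"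
    unfolding \<psi>_def by (rule sums_of_disjoint_blocks(2)[of "\<lambda>n. u n 0" s, OF start_mono block_support])
  ultimately show ?thesis using B0 by auto
qed

lemma frac_nn_block:
  "frac_nn \<alpha> T (block n) \<le> ennreal (piece_const * K * (\<bar>m n\<bar> * real (N n) * d n powr (1 + \<gamma> - \<alpha>)))"
proof -
  let ?c = "piece_const * K * d n powr (1 + \<gamma> - \<alpha>)"
  have c0: "0 \<le> piece_const * K * d n powr (1 + \<gamma> - \<alpha>)" using piece_const_nonneg K0 by simp
  have "frac_nn \<alpha> T (block n) \<le> (\<Sum>k<N n. frac_nn \<alpha> T (\<lambda>s. m n * piece (u n k) (u n (Suc k)) s))"
    unfolding block_def by (rule frac_nn_sum) auto
  also have "\<dots> \<le> (\<Sum>k<N n. ennreal (\<bar>m n\<bar> * ?c))"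
  proof (rule sum_mono)
    fix k
    have "frac_nn \<alpha> T (\<lambda>s. m n * piece (u n k) (u n (Suc k)) s) = ennreal \<bar>m n\<bar> * frac_nn \<alpha> T (piece (u n k) (u n (Suc k)))"
      by (rule frac_nn_cmult) simp
    also have "\<dots> \<le> ennreal \<bar>m n\<bar> * ennreal ?c"
      using frac_nn_piece[OF u_nonneg u_mono, of n k] unfolding u_step by (intro mult_left_mono) auto
    also have "\<dots> = ennreal (\<bar>m n\<bar> * ?c)"
      using c0 by (simp only: ennreal_mult'')
    finally show "frac_nn \<alpha> T (\<lambda>s. m n * piece (u n k) (u n (Suc k)) s) \<le> ennreal (\<bar>m n\<bar> * ?c)" .
  qed
  also have "\<dots> = ennreal (\<Sum>k<N n. \<bar>m n\<bar> * ?c)"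
    using c0 by (intro sum_ennreal) simp
  also have "(\<Sum>k<N n. \<bar>m n\<bar> * ?c) = piece_const * K * (\<bar>m n\<bar> * real (N n) * d n powr (1 + \<gamma> - \<alpha>))"
    by (simp add: mult_ac)
  finally show ?thesis .
qed

context
  assumes summ: "summable (\<lambda>n. \<bar>m n\<bar> * real (N n) * d n powr (1 + \<gamma> - \<alpha>))"
begin

lemma frac_nn_blocks_finite: "(\<Sum>n. frac_nn \<alpha> T (block n)) < \<infinity>"
proof -
  have "(\<Sum>n. frac_nn \<alpha> T (block n)) \<le> (\<Sum>n. ennreal (piece_const * K * (\<bar>m n\<bar> * real (N n) * d n powr (1 + \<gamma> - \<alpha>))))"
    by (intro suminf_le frac_nn_block summableI)
  also have "\<dots> = ennreal (\<Sum>n. piece_const * K * (\<bar>m n\<bar> * real (N n) * d n powr (1 + \<gamma> - \<alpha>)))"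
    using piece_const_nonneg K0 by (intro suminf_ennreal2 summable_mult summ) simp
  also have "\<dots> < \<infinity>" by simp
  finally show ?thesis .
qed

lemma frac_nn_\<psi>_finite: "frac_nn \<alpha> T \<psi> < \<infinity>"
  using frac_nn_series[of block \<psi> \<alpha> T, OF _ block_sums] frac_nn_blocks_finite by (simp add: order_le_less_trans)

lemma L_\<psi>_sums: "(\<lambda>n. m n * (- (\<Sum>k<N n. (g (u n (Suc k)) - g (u n k))\<^sup>2) / 2)) sums L \<psi>"
proof -
  have "L (block n) = m n * (- (\<Sum>k<N n. (g (u n (Suc k)) - g (u n k))\<^sup>2) / 2)" for n
  proof -
    have "L (block n) = (\<Sum>k<N n. L (\<lambda>s. m n * piece (u n k) (u n (Suc k)) s))"
      unfolding block_def using frac_nn_piece_finite[OF u_nonneg u_mono, of n]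
      by (intro L_sum) (auto simp: frac_nn_cmult ennreal_mult_less_top)
    also have "\<dots> = (\<Sum>k<N n. m n * (- (g (u n (Suc k)) - g (u n k))\<^sup>2 / 2))"
    proof (intro sum.cong refl)
      fix k assume "k \<in> {..<N n}"
      then have "L (piece (u n k) (u n (Suc k))) = - (g (u n (Suc k)) - g (u n k))\<^sup>2 / 2"
        by (intro L_piece u_nonneg u_mono u_le_T) auto
      then show "L (\<lambda>s. m n * piece (u n k) (u n (Suc k)) s) = m n * (- (g (u n (Suc k)) - g (u n k))\<^sup>2 / 2)"
        by (simp only: L_cmult)
    qed
    finally show ?thesis by (simp only: sum_distrib_left[symmetric] sum_divide_distrib[symmetric] sum_negf)
  qed
  then show ?thesis
    using L_series[of block \<psi>, OF _ block_sums frac_nn_blocks_finite] by simp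
qed

end

end

text \<open>Once \<open>\<eta>\<close> has dropped below \<open>\<rho> / 2\<close>, the quantity \<open>D n / \<rho> ^ n\<close> is at most halved in each step, up
  to a bounded perturbation.\<close>

lemma linear_recursion_bound:
  fixes D \<eta> :: "nat \<Rightarrow> real"
  assumes \<eta>: "\<eta> \<longlonglongrightarrow> 0" and \<rho>: "0 < \<rho>" and c: "0 \<le> c"
    and rec: "\<And>n. \<bar>D (Suc n)\<bar> \<le> \<bar>\<eta> n\<bar> * \<bar>D n\<bar> + c * \<rho> ^ n"
  shows "\<exists>A\<ge>0. \<forall>n. \<bar>D n\<bar> \<le> A * \<rho> ^ n"
proof -
  have "\<forall>\<^sub>F n in sequentially. \<bar>\<eta> n\<bar> < \<rho> / 2"
    using tendsto_rabs[OF \<eta>] \<rho> by (intro order_tendstoD(2)) auto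
  then obtain n0 where n0: "\<And>n. n0 \<le> n \<Longrightarrow> \<bar>\<eta> n\<bar> < \<rho> / 2" by (auto simp: eventually_sequentially)
  define A where "A = (\<Sum>n\<le>n0. \<bar>D n\<bar> / \<rho> ^ n) + 2 * c / \<rho>"
  have A0: "0 \<le> A" unfolding A_def using c \<rho> by (intro add_nonneg_nonneg sum_nonneg) auto
  have cA: "c \<le> A * \<rho> / 2"
  proof -
    have "2 * c / \<rho> \<le> A" unfolding A_def using \<rho> by (simp add: sum_nonneg)
    then show ?thesis using \<rho> by (simp add: field_simps)
  qed
  have small: "\<bar>D n\<bar> \<le> A * \<rho> ^ n" if "n \<le> n0" for n
  proof -
    have "\<bar>D n\<bar> / \<rho> ^ n \<le> (\<Sum>n\<le>n0. \<bar>D n\<bar> / \<rho> ^ n)"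
      using that \<rho> by (intro member_le_sum) auto
    also have "\<dots> \<le> A" unfolding A_def using c \<rho> by simp
    finally show ?thesis using \<rho> by (simp add: divide_le_eq)
  qed
  have "\<bar>D (n0 + j)\<bar> \<le> A * \<rho> ^ (n0 + j)" for j
  proof (induction j)
    case (Suc j)
    have "\<bar>D (Suc (n0 + j))\<bar> \<le> \<bar>\<eta> (n0 + j)\<bar> * \<bar>D (n0 + j)\<bar> + c * \<rho> ^ (n0 + j)" by (rule rec)
    also have "\<dots> \<le> \<rho> / 2 * (A * \<rho> ^ (n0 + j)) + A * \<rho> / 2 * \<rho> ^ (n0 + j)"
      using n0[of "n0 + j"] Suc \<rho> cA by (intro add_mono mult_mono mult_right_mono) auto
    finally show ?case by simp
  qed (simp add: small)
  then have "\<bar>D n\<bar> \<le> A * \<rho> ^ n" for n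
    using small[of n] le_add_diff_inverse[of n0 n] by (metis nat_le_linear)
  then show ?thesis using A0 by blast
qed

section \<open>The time grid and the concentration of squared increments\<close>

text \<open>Only the values of the integrator on \<open>[0, T]\<close> enter, so that a path may be replaced by its
  constant extension.\<close>

lemma gls_cong:
  assumes "0 < T" and eq: "\<And>x. x \<in> {0..T} \<Longrightarrow> g x = g' x"
  shows "gls_integral \<alpha> 0 T f g = gls_integral \<alpha> 0 T f g'"
    and "gls_integrable \<alpha> 0 T f g \<longleftrightarrow> gls_integrable \<alpha> 0 T f g'"
proof -
  let ?w = "\<lambda>g. frac_deriv_right (1 - \<alpha>) T (\<lambda>x. g x - g T)"
    and ?k = "\<lambda>g x u. (g x - g T - (g u - g T)) / (u - x) powr (1 + (1 - \<alpha>))"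
  have d: "g x - g T = g' x - g' T" if "x \<in> {0<..<T}" for x using that eq[of x] eq[of T] assms(1) by simp
  have w: "?w g x = ?w g' x"
    if "x \<in> {0<..<T}" for x
  proof -
    have "(LINT u:{x<..<T}|lebesgue. ?k g x u) =
       (LINT u:{x<..<T}|lebesgue. ?k g' x u)"
      using that d by (intro set_lebesgue_integral_cong) auto
    then show ?thesis unfolding frac_deriv_right_def using d[OF that] by simp
  qed
  show "gls_integral \<alpha> 0 T f g = gls_integral \<alpha> 0 T f g'"
    unfolding gls_integral_def using w by (intro set_lebesgue_integral_cong) auto
  have i: "(x \<in> {0<..<T} \<longrightarrow> set_integrable lebesgue {x<..<T} (?k g x))
    \<longleftrightarrow> (x \<in> {0<..<T} \<longrightarrow> set_integrable lebesgue {x<..<T} (?k g' x))" for x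
    using d by (intro imp_cong refl set_integrable_cong) auto
  have m: "indicat_real {0<..<T} x *\<^sub>R ?w g x
    = indicat_real {0<..<T} x *\<^sub>R ?w g' x" for x
    using w by (auto split: split_indicator)
  have b: "(x \<in> {0<..<T} \<longrightarrow> \<bar>?w g x\<bar> \<le> C) \<longleftrightarrow>
    (x \<in> {0<..<T} \<longrightarrow> \<bar>?w g' x\<bar> \<le> C)" for x C
    using w by auto
  show "gls_integrable \<alpha> 0 T f g \<longleftrightarrow> gls_integrable \<alpha> 0 T f g'"
    unfolding gls_integrable_def frac_deriv_right_Linf_def set_borel_measurable_def i m b ..
qed

lemma filtration_measurable_mono:
  fixes X :: "'a \<Rightarrow> real"
  assumes F: "standard_filtration M T F" and "0 \<le> s" "s \<le> t" "t \<le> T" and X: "X \<in> borel_measurable (F s)"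
  shows "X \<in> borel_measurable (F t)"
proof -
  have "subalgebra M (F s)" "subalgebra M (F t)" "sets (F s) \<subseteq> sets (F t)"
    using assms unfolding standard_filtration_def by auto
  then have "subalgebra (F t) (F s)" unfolding subalgebra_def by auto
  then show ?thesis using X by (rule measurable_from_subalg)
qed

text \<open>Block \<open>n\<close> starts at \<open>T (1 - 2^(-n))\<close> and has length \<open>(T / 2) 2^(-n)\<close>, which is \<open>2^(p n)\<close> times the cell
  length; the step \<open>k = 2^(p n)\<close> therefore reaches the next block exactly.\<close>

definition grid :: "real \<Rightarrow> nat \<Rightarrow> nat \<Rightarrow> nat \<Rightarrow> real" where
  "grid T p n k = T * (1 - (1 / 2) ^ n) + real k * (T / 2 * (1 / 2) ^ (Suc p * n))"

lemma grid_step: "grid T p n (Suc k) - grid T p n k = T / 2 * (1 / 2) ^ (Suc p * n)"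
  unfolding grid_def of_nat_Suc distrib_right by simp

lemma grid_start: "grid T p n 0 = T * (1 - (1 / 2) ^ n)"
  unfolding grid_def by simp

lemma grid_length: "real (2 ^ (p * n)) * (T / 2 * (1 / 2) ^ (Suc p * n)) = T / 2 * (1 / 2) ^ n"
proof -
  have "real (2 ^ (p * n)) * (1 / 2) ^ (p * n) = 1"
    by (simp add: power_one_over)
  then show ?thesis by (simp add: power_add mult_ac)
qed

lemma grid_chain: "grid T p n (2 ^ (p * n)) = grid T p (Suc n) 0"
  unfolding grid_def grid_length by (simp add: algebra_simps)

lemma grid_start_tendsto: "(\<lambda>n. grid T p n 0) \<longlonglongrightarrow> T"
proof -
  have "(\<lambda>n. T * (1 - (1 / 2) ^ n)) \<longlonglongrightarrow> T * (1 - 0)"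
    by (intro tendsto_intros LIMSEQ_power_zero) simp
  then show ?thesis unfolding grid_start by simp
qed

lemma grid_step_powr:
  "(T / 2 * (1 / 2) ^ (l * n)) powr e = (T / 2) powr e * (2 powr (- (real l * e))) ^ n"
proof -
  have "(1 / 2 :: real) ^ (l * n) = 2 powr (- real (l * n))"
  proof -
    have "(2 :: real) powr real (l * n) = 2 ^ (l * n)" by (rule powr_realpow) simp
    then show ?thesis unfolding powr_minus by (simp add: power_one_over inverse_eq_divide)
  qed
  moreover have "(T / 2 * 2 powr (- real (l * n))) powr e = (T / 2) powr e * (2 powr (- real (l * n))) powr e"
    by (rule powr_mult)
  ultimately have "(T / 2 * (1 / 2) ^ (l * n)) powr e = (T / 2) powr e * 2 powr (- real (l * n) * e)"
    by (simp only: powr_powr)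
  also have "2 powr (- real (l * n) * e) = (2 powr (- (real l * e)) :: real) ^ n"
    by (simp add: powr_power mult_ac)
  finally show ?thesis .
qed

text \<open>What is missing from the target \<open>z n\<close> when a fraction \<open>q\<close> of the amount missing is supplied in
  each step.\<close>

fun residual :: "(nat \<Rightarrow> real) \<Rightarrow> (nat \<Rightarrow> real) \<Rightarrow> nat \<Rightarrow> real" where
  "residual q z 0 = z 0"
| "residual q z (Suc n) = residual q z n * (1 - q n) + (z (Suc n) - z n)"

lemma residual_sum: "(\<Sum>i<n. residual q z i * q i) = z n - residual q z n"
  by (induction n) (auto simp: algebra_simps)

text \<open>Such processes are known as quasi-helices; here their increments are nonnegatively correlated.\<close>

locale helix = prob_space M for M :: "'a measure" +
  fixes T H C1 C2 :: real and G :: "real \<Rightarrow> 'a \<Rightarrow> real"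
  assumes T: "0 < T" and H: "1 / 2 < H" "H < 1" and C: "0 < C1" "0 < C2"
    and gauss: "centered_gaussian_process M T G"
    and low: "\<And>s t. s \<in> {0..T} \<Longrightarrow> t \<in> {0..T} \<Longrightarrow> C1 * \<bar>t - s\<bar> powr (2 * H) \<le> expectation (\<lambda>\<omega>. (G t \<omega> - G s \<omega>)\<^sup>2)"
    and up: "\<And>s t. s \<in> {0..T} \<Longrightarrow> t \<in> {0..T} \<Longrightarrow> expectation (\<lambda>\<omega>. (G t \<omega> - G s \<omega>)\<^sup>2) \<le> C2 * \<bar>t - s\<bar> powr (2 * H)"
    and pos: "\<And>s1 t1 s2 t2. 0 \<le> s1 \<Longrightarrow> s1 \<le> t1 \<Longrightarrow> t1 \<le> s2 \<Longrightarrow> s2 \<le> t2 \<Longrightarrow> t2 \<le> T \<Longrightarrow>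
        0 \<le> expectation (\<lambda>\<omega>. (G t1 \<omega> - G s1 \<omega>) * (G t2 \<omega> - G s2 \<omega>))"
begin

lemma increment_gspan: "s \<in> {0..T} \<Longrightarrow> t \<in> {0..T} \<Longrightarrow> (\<lambda>\<omega>. G t \<omega> - G s \<omega>) \<in> gspan T G"
  by (intro gspan_diff gspan_base)

end

locale helix_grid = helix +
  fixes u :: "nat \<Rightarrow> nat \<Rightarrow> real" and N :: "nat \<Rightarrow> nat" and d :: "nat \<Rightarrow> real"
  assumes u0: "\<And>n. 0 \<le> u n 0" and u_end: "\<And>n. u n (N n) \<le> T" and d: "\<And>n. 0 < d n" and N: "\<And>n. 0 < N n"
    and u_step: "\<And>n k. u n (Suc k) - u n k = d n"
begin

definition X :: "nat \<Rightarrow> nat \<Rightarrow> 'a \<Rightarrow> real" where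
  "X n k \<omega> = G (u n (Suc k)) \<omega> - G (u n k) \<omega>"

definition Q :: "nat \<Rightarrow> 'a \<Rightarrow> real" where
  "Q n \<omega> = (\<Sum>k<N n. (X n k \<omega>)\<^sup>2)"

definition S :: "nat \<Rightarrow> real" where
  "S n = (\<Sum>k<N n. expectation (\<lambda>\<omega>. (X n k \<omega>)\<^sup>2))"

lemma u_mono: "j \<le> k \<Longrightarrow> u n j \<le> u n k"
  by (rule lift_Suc_mono_le[of "u n"]) (use u_step[of n] d[of n] in \<open>smt (verit)\<close>)

lemma u_in: "k \<le> N n \<Longrightarrow> u n k \<in> {0..T}"
  using u_mono[of 0 k n] u_mono[of k "N n" n] u0[of n] u_end[of n] by auto

lemma u_diff: "u n k - u n 0 = real k * d n"
proof (induction k)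
  case (Suc k)
  then show ?case using u_step[of n k] by (simp add: algebra_simps)
qed simp

lemma S_lower: "C1 * real (N n) * d n powr (2 * H) \<le> S n"
proof -
  have "(\<Sum>k<N n. C1 * d n powr (2 * H)) \<le> S n"
    unfolding S_def
  proof (rule sum_mono)
    fix k assume "k \<in> {..<N n}"
    then show "C1 * d n powr (2 * H) \<le> expectation (\<lambda>\<omega>. (X n k \<omega>)\<^sup>2)"
      using low[OF u_in u_in, of k n "Suc k" n] d[of n] unfolding X_def u_step by simp
  qed
  then show ?thesis by (simp add: mult_ac)
qed

lemma S_pos: "0 < S n"
proof -
  have "0 < C1 * real (N n) * d n powr (2 * H)" using C N[of n] d[of n] by simp
  then show ?thesis using S_lower[of n] by linarith
qed

text \<open>With \<open>S\<close> at least \<open>C1 N d^(2 H)\<close>, the powers of \<open>d\<close> cancel and a negative power of the number of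
  cells remains.\<close>

lemma ratio_variance:
  "integrable M (\<lambda>\<omega>. (Q n \<omega> / S n - 1)\<^sup>2)"
  "expectation (\<lambda>\<omega>. (Q n \<omega> / S n - 1)\<^sup>2) \<le> 2 * C2\<^sup>2 / C1\<^sup>2 * real (N n) powr (2 * H - 2)"
proof -
  let ?R = "\<lambda>\<omega>. (Q n \<omega> / S n - 1)\<^sup>2"
  have Xs: "X n k \<in> gspan T G" if "k < N n" for k
    unfolding X_def[abs_def] using that by (intro increment_gspan u_in) auto
  have cov: "0 \<le> expectation (\<lambda>\<omega>. X n j \<omega> * X n k \<omega>)" if jk: "j < N n" "k < N n" for j k
  proof -
    have lt: "0 \<le> expectation (\<lambda>\<omega>. X n j \<omega> * X n k \<omega>)" if "j < k" "k < N n" for j k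
      unfolding X_def using u_in[of j n] u_in[of "Suc k" n] u_mono[of j "Suc j" n] u_mono[of "Suc j" k n] u_mono[of k "Suc k" n] that
      by (intro pos) auto
    consider "j < k" | "j = k" | "k < j" by linarith
    then show ?thesis
    proof cases
      case 3
      then show ?thesis using lt[of k j] jk by (simp add: mult.commute)
    qed (use lt jk in \<open>auto simp flip: power2_eq_square\<close>)
  qed
  have vX: "expectation (\<lambda>\<omega>. (X n k \<omega>)\<^sup>2) \<le> C2 * d n powr (2 * H)" if "k < N n" for k
    using up[OF u_in u_in, of k n "Suc k" n] d[of n] that unfolding X_def u_step by simp
  note var = gaussian_square_sum_variance[where X = "X n" and N = "N n", OF gauss Xs cov vX, folded Q_def S_def]
  have eq: "(Q n \<omega> / S n - 1)\<^sup>2 = (Q n \<omega> - S n)\<^sup>2 / (S n)\<^sup>2" for \<omega>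
    using S_pos[of n] by (simp add: power_divide[symmetric] diff_divide_distrib)
  show "integrable M ?R"
    unfolding eq using var(1) by simp
  have W: "expectation (\<lambda>\<omega>. (\<Sum>k<N n. X n k \<omega>)\<^sup>2) \<le> C2 * (real (N n) * d n) powr (2 * H)"
  proof -
    have "(\<Sum>k<N n. X n k \<omega>) = G (u n (N n)) \<omega> - G (u n 0) \<omega>" for \<omega>
      unfolding X_def by (rule sum_lessThan_telescope)
    then show ?thesis using up[OF u_in u_in, of 0 n "N n" n] d[of n] unfolding u_diff by simp
  qed
  have "expectation ?R = expectation (\<lambda>\<omega>. (Q n \<omega> - S n)\<^sup>2) / (S n)\<^sup>2"
    unfolding eq by simp
  also have "\<dots> \<le> (2 * (C2 * d n powr (2 * H)) * (C2 * (real (N n) * d n) powr (2 * H))) / (C1 * real (N n) * d n powr (2 * H))\<^sup>2"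
  proof (rule frac_le)
    show "expectation (\<lambda>\<omega>. (Q n \<omega> - S n)\<^sup>2) \<le> 2 * (C2 * d n powr (2 * H)) * (C2 * (real (N n) * d n) powr (2 * H))"
    proof -
      have "expectation (\<lambda>\<omega>. (Q n \<omega> - S n)\<^sup>2) \<le> 2 * (C2 * d n powr (2 * H)) * expectation (\<lambda>\<omega>. (\<Sum>k<N n. X n k \<omega>)\<^sup>2)"
        by (rule var(2))
      also have "\<dots> \<le> 2 * (C2 * d n powr (2 * H)) * (C2 * (real (N n) * d n) powr (2 * H))"
        using W C by (intro mult_left_mono) auto
      finally show ?thesis .
    qed
    show "0 < (C1 * real (N n) * d n powr (2 * H))\<^sup>2" using C N[of n] d[of n] by simp
    show "(C1 * real (N n) * d n powr (2 * H))\<^sup>2 \<le> (S n)\<^sup>2"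
      using S_lower[of n] C by (intro power_mono) auto
  qed (use C in simp)
  also have "\<dots> = 2 * C2\<^sup>2 / C1\<^sup>2 * real (N n) powr (2 * H - 2)"
  proof -
    have n2: "real (N n) powr (2 * H - 2) = real (N n) powr (2 * H) / (real (N n))\<^sup>2"
      using N[of n] by (simp add: powr_diff)
    have "0 < d n powr (2 * H)" using d[of n] by simp
    then show ?thesis unfolding n2 using C N[of n] d[of n]
      by (simp add: powr_mult power2_eq_square field_simps)
  qed
  finally show "expectation ?R \<le> 2 * C2\<^sup>2 / C1\<^sup>2 * real (N n) powr (2 * H - 2)" .
qed

lemma ratio_tendsto:
  assumes "summable (\<lambda>n. real (N n) powr (2 * H - 2))"
  shows "AE \<omega> in M. (\<lambda>n. 1 - Q n \<omega> / S n) \<longlonglongrightarrow> 0"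
proof -
  have "AE \<omega> in M. summable (\<lambda>n. (Q n \<omega> / S n - 1)\<^sup>2)"
    by (rule AE_summable_of_expectation[OF ratio_variance(1) _ ratio_variance(2)])
      (use assms in \<open>auto intro!: summable_mult\<close>)
  then show ?thesis
  proof eventually_elim
    case (elim \<omega>)
    have "(\<lambda>n. sqrt ((Q n \<omega> / S n - 1)\<^sup>2)) \<longlonglongrightarrow> sqrt 0"
      by (intro tendsto_real_sqrt summable_LIMSEQ_zero elim)
    then have "(\<lambda>n. \<bar>1 - Q n \<omega> / S n\<bar>) \<longlonglongrightarrow> 0" by (simp add: abs_minus_commute)
    then show ?case by (rule tendsto_rabs_zero_cancel)
  qed
qed

end

section \<open>The representation theorem\<close>

theorem theorem1:
  fixes M :: "'a measure" and F :: "real \<Rightarrow> 'a measure" and T H :: real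
    and G :: "real \<Rightarrow> 'a \<Rightarrow> real" and \<xi> :: "'a \<Rightarrow> real"
  assumes "prob_space M" and "complete_measure M"
    and "0 < T" and "standard_filtration M T F"
    and "1 / 2 < H" and "H < 1"
    and "continuous_process M T G" and "adapted_process T F G"
    and "centered_gaussian_process M T G"
    and A: "\<exists>C\<^sub>1>0. \<exists>C\<^sub>2>0. \<forall>s\<in>{0..T}. \<forall>t\<in>{0..T}.
        C\<^sub>1 * \<bar>t - s\<bar> powr (2 * H) \<le> prob_space.expectation M (\<lambda>\<omega>. \<bar>G t \<omega> - G s \<omega>\<bar>\<^sup>2) \<and>
        prob_space.expectation M (\<lambda>\<omega>. \<bar>G t \<omega> - G s \<omega>\<bar>\<^sup>2) \<le> C\<^sub>2 * \<bar>t - s\<bar> powr (2 * H)"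
    and B: "\<And>s\<^sub>1 t\<^sub>1 s\<^sub>2 t\<^sub>2. 0 \<le> s\<^sub>1 \<Longrightarrow> s\<^sub>1 \<le> t\<^sub>1 \<Longrightarrow> t\<^sub>1 \<le> s\<^sub>2 \<Longrightarrow> s\<^sub>2 \<le> t\<^sub>2 \<Longrightarrow> t\<^sub>2 \<le> T \<Longrightarrow>
        0 \<le> prob_space.expectation M (\<lambda>\<omega>. (G t\<^sub>1 \<omega> - G s\<^sub>1 \<omega>) * (G t\<^sub>2 \<omega> - G s\<^sub>2 \<omega>))"
    and "\<xi> \<in> borel_measurable M"
    and "\<exists>r>0. \<exists>Z. adapted_process T F Z \<and> hoelder_process M T r Z \<and> (AE \<omega> in M. Z T \<omega> = \<xi> \<omega>)"
  shows "\<exists>\<psi>. bounded_process M T \<psi> \<and> adapted_process T F \<psi> \<and>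
    (\<exists>\<alpha>\<in>{1 - H<..<1}.
       (AE \<omega> in M. finite_frac_norm \<alpha> T (\<lambda>t. \<psi> t \<omega>)) \<and>
       (AE \<omega> in M. gls_integrable \<alpha> 0 T (\<lambda>t. \<psi> t \<omega>) (\<lambda>t. G t \<omega>) \<and>
          \<xi> \<omega> = gls_integral \<alpha> 0 T (\<lambda>t. \<psi> t \<omega>) (\<lambda>t. G t \<omega>)))"
proof -
  interpret prob_space M by fact
  note T = \<open>0 < T\<close> and H = \<open>1 / 2 < H\<close> \<open>H < 1\<close> and filt = \<open>standard_filtration M T F\<close>
  obtain C1 C2 where C: "0 < C1" "0 < C2" and
    lowup: "\<And>s t. s \<in> {0..T} \<Longrightarrow> t \<in> {0..T} \<Longrightarrow> C1 * \<bar>t - s\<bar> powr (2 * H) \<le> expectation (\<lambda>\<omega>. (G t \<omega> - G s \<omega>)\<^sup>2)"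
    "\<And>s t. s \<in> {0..T} \<Longrightarrow> t \<in> {0..T} \<Longrightarrow> expectation (\<lambda>\<omega>. (G t \<omega> - G s \<omega>)\<^sup>2) \<le> C2 * \<bar>t - s\<bar> powr (2 * H)"
    using A unfolding power2_abs by blast
  obtain r Z where r: "0 < r" and Z: "adapted_process T F Z" "hoelder_process M T r Z" "AE \<omega> in M. Z T \<omega> = \<xi> \<omega>"
    using assms by blast
  have hx: "helix M T H C1 C2 G"
    by unfold_locales (use T H C lowup B assms in auto)

  \<comment> \<open>\<open>p\<close> makes the cells so short that the integrand stays bounded; \<open>\<epsilon>\<close> is the loss in the exponents
    that the decay \<open>2^(-r n)\<close> of the residuals can absorb.\<close>
  obtain p :: nat where p: "1 / (1 - H) \<le> real p" using real_arch_simple by blast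
  have p1: "1 \<le> p"
  proof -
    have "0 < 1 / (1 - H)" using H by simp
    then show ?thesis using p by (cases p) auto
  qed
  define \<kappa> where "\<kappa> = real (Suc p)"
  have \<kappa>: "1 \<le> \<kappa> * (1 - H)" "0 < \<kappa>" "\<kappa> = 1 + real p"
  proof -
    have "1 \<le> real p * (1 - H)" using p H by (simp add: field_simps)
    then show "1 \<le> \<kappa> * (1 - H)" unfolding \<kappa>_def using H by (simp add: distrib_right)
  qed (auto simp: \<kappa>_def)
  define \<epsilon> where "\<epsilon> = min ((2 * H - 1) / 4) (r / (4 * \<kappa>))"
  have \<epsilon>: "0 < \<epsilon>" "4 * \<epsilon> \<le> 2 * H - 1" "4 * (\<kappa> * \<epsilon>) \<le> r"
  proof -
    show "0 < \<epsilon>" unfolding \<epsilon>_def using H r \<kappa> by simp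
    have "\<epsilon> \<le> (2 * H - 1) / 4" unfolding \<epsilon>_def by (rule min.cobounded1)
    then show "4 * \<epsilon> \<le> 2 * H - 1" by simp
    have "\<epsilon> \<le> r / (4 * \<kappa>)" unfolding \<epsilon>_def by (rule min.cobounded2)
    then show "4 * (\<kappa> * \<epsilon>) \<le> r" using \<kappa> by (simp add: field_simps)
  qed
  define \<gamma> where "\<gamma> = H - \<epsilon>"
  define \<alpha> where "\<alpha> = 1 - H + 2 * \<epsilon>"
  have exps: "0 < \<alpha>" "\<alpha> < 1" "1 - \<alpha> < \<gamma>" "\<alpha> < \<gamma>" "0 < \<gamma>" "\<gamma> < H" "1 - H < \<alpha>"
    using \<epsilon> H unfolding \<alpha>_def \<gamma>_def by auto

  define u where "u = grid T p"
  define N where "N = (\<lambda>n. (2 :: nat) ^ (p * n))"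
  define d where "d = (\<lambda>n. T / 2 * (1 / 2) ^ (Suc p * n))"
  have d: "0 < d n" for n unfolding d_def using T by simp
  have N: "0 < N n" for n unfolding N_def by simp
  have u_step: "u n (Suc k) - u n k = d n" for n k unfolding u_def d_def by (rule grid_step)
  have u_chain: "u n (N n) = u (Suc n) 0" for n unfolding u_def N_def by (rule grid_chain)
  have u_start: "u n 0 = T * (1 - (1 / 2) ^ n)" for n unfolding u_def by (rule grid_start)
  have u0: "0 \<le> u n 0" for n unfolding u_start using T by (simp add: power_le_one)
  have u_le: "u n 0 \<le> T" for n unfolding u_start using T by (simp add: mult_left_le)
  have u_end: "u n (N n) \<le> T" for n unfolding u_chain by (rule u_le)
  interpret grid: helix_grid M T H C1 C2 G u N d
    using u0 u_end d N u_step by (intro helix_grid.intro hx helix_grid_axioms.intro)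
  define S where "S = grid.S"
  define Q where "Q = grid.Q"
  have Q_eq: "Q n \<omega> = (\<Sum>k<N n. (G (u n (Suc k)) \<omega> - G (u n k) \<omega>)\<^sup>2)" for n \<omega>
    unfolding Q_def grid.Q_def grid.X_def by (rule refl)
  note S_pos = grid.S_pos[folded S_def] and S_lower = grid.S_lower[folded S_def]
    and u_in = grid.u_in and u_mono = grid.u_mono

  define D where "D = (\<lambda>n \<omega>. residual (\<lambda>n. Q n \<omega> / S n) (\<lambda>n. Z (u n 0) \<omega>) n)"
  \<comment> \<open>The factor -2 undoes the factor \<open>-1/2\<close> of the chain rule.\<close>
  define m where "m = (\<lambda>n \<omega>. - 2 * D n \<omega> / S n)"
  define \<psi> where "\<psi> = (\<lambda>t \<omega>. \<Sum>n. \<Sum>k<N n. m n \<omega> * (indicat_real {u n k..<u n (Suc k)} t * (G t \<omega> - G (u n k) \<omega>)))"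

  have G_meas: "G s \<in> borel_measurable (F t)" if "0 \<le> s" "s \<le> t" "t \<le> T" for s t
  proof (rule filtration_measurable_mono[OF filt that])
    show "G s \<in> borel_measurable (F s)" using \<open>adapted_process T F G\<close> that unfolding adapted_process_def by simp
  qed
  have Z_meas: "Z s \<in> borel_measurable (F t)" if "0 \<le> s" "s \<le> t" "t \<le> T" for s t
  proof (rule filtration_measurable_mono[OF filt that])
    show "Z s \<in> borel_measurable (F s)" using Z(1) that unfolding adapted_process_def by simp
  qed
  have Q_meas: "Q n \<in> borel_measurable (F t)" if t: "u (Suc n) 0 \<le> t" "t \<le> T" for n t
  proof -
    have "G (u n k) \<in> borel_measurable (F t)" if "k \<le> N n" for k
      using u_in[OF that] u_mono[OF that, of n] t unfolding u_chain by (intro G_meas) auto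
    then show ?thesis unfolding Q_eq[abs_def]
      by (intro borel_measurable_sum borel_measurable_power borel_measurable_diff) auto
  qed
  have D_meas: "D n \<in> borel_measurable (F t)" if "u n 0 \<le> t" "t \<le> T" for n t
    using that
  proof (induction n)
    case 0
    then show ?case unfolding D_def using Z_meas[of "u 0 0" t] u0[of 0] by simp
  next
    case (Suc n)
    have le: "u n 0 \<le> u (Suc n) 0" using u_mono[of 0 "N n" n] u_chain by simp
    have "(\<lambda>\<omega>. D n \<omega> * (1 - Q n \<omega> / S n) + (Z (u (Suc n) 0) \<omega> - Z (u n 0) \<omega>)) \<in> borel_measurable (F t)"
      using Suc le u0[of n] u0[of "Suc n"]
      by (intro borel_measurable_add borel_measurable_times borel_measurable_diff borel_measurable_divide
        borel_measurable_const Q_meas Z_meas Suc.IH) auto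
    then show ?case unfolding D_def by simp
  qed
  have adapted: "adapted_process T F \<psi>"
    unfolding adapted_process_def
  proof
    fix t assume t: "t \<in> {0..T}"
    have "(\<lambda>\<omega>. m n \<omega> * (indicat_real {u n k..<u n (Suc k)} t * (G t \<omega> - G (u n k) \<omega>))) \<in> borel_measurable (F t)" for n k
    proof (cases "t \<in> {u n k..<u n (Suc k)}")
      case True
      have le: "u n 0 \<le> u n k" using u_mono[of 0 k n] by simp
      then have "D n \<in> borel_measurable (F t)" "G (u n k) \<in> borel_measurable (F t)" "G t \<in> borel_measurable (F t)"
        using True t u0[of n] by (auto intro!: D_meas G_meas)
      then show ?thesis unfolding m_def by simp
    qed simp
    then show "\<psi> t \<in> borel_measurable (F t)"
      unfolding \<psi>_def by (intro borel_measurable_suminf borel_measurable_sum)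
  qed

  have ratio: "AE \<omega> in M. (\<lambda>n. 1 - Q n \<omega> / S n) \<longlonglongrightarrow> 0"
  proof -
    have "real (N n) powr (2 * H - 2) = (2 powr (real p * (2 * H - 2))) ^ n" for n
    proof -
      have "real (N n) = 2 powr (real (p * n))" unfolding N_def by (subst powr_realpow) auto
      then show ?thesis by (simp add: powr_powr powr_power mult_ac)
    qed
    moreover have "2 powr (real p * (2 * H - 2)) < (2 :: real) powr 0"
      using p1 H by (intro powr_less_mono) (auto simp: mult_less_0_iff)
    ultimately have "summable (\<lambda>n. real (N n) powr (2 * H - 2))"
      by (simp add: summable_geometric)
    then show ?thesis unfolding Q_def S_def by (rule grid.ratio_tendsto)
  qed
  have paths: "AE \<omega> in M. \<exists>C\<ge>0. \<forall>s\<in>{0..T}. \<forall>t\<in>{0..T}. \<bar>G t \<omega> - G s \<omega>\<bar> \<le> C * \<bar>t - s\<bar> powr \<gamma>"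
    using gaussian_holder_paths[OF assms(9,7) T C(2) lowup(2) exps(5,6)] .

  have main: "AE \<omega> in M. bounded ((\<lambda>t. \<psi> t \<omega>) ` {0..T}) \<and> finite_frac_norm \<alpha> T (\<lambda>t. \<psi> t \<omega>) \<and>
    gls_integrable \<alpha> 0 T (\<lambda>t. \<psi> t \<omega>) (\<lambda>t. G t \<omega>) \<and> \<xi> \<omega> = gls_integral \<alpha> 0 T (\<lambda>t. \<psi> t \<omega>) (\<lambda>t. G t \<omega>)"
    using ratio paths Z(2)[unfolded hoelder_process_def] Z(3)
  proof eventually_elim
    case (elim \<omega>)
    obtain K where K: "0 \<le> K" "\<And>s t. s \<in> {0..T} \<Longrightarrow> t \<in> {0..T} \<Longrightarrow> \<bar>G t \<omega> - G s \<omega>\<bar> \<le> K * \<bar>t - s\<bar> powr \<gamma>"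
      using elim(2) by blast
    obtain CZ where CZ: "\<And>s t. s \<in> {0..T} \<Longrightarrow> t \<in> {0..T} \<Longrightarrow> \<bar>Z t \<omega> - Z s \<omega>\<bar> \<le> CZ * \<bar>t - s\<bar> powr r"
      using elim(3) by blast
    define \<rho> :: real where "\<rho> = 2 powr (- r)"
    have \<rho>: "0 < \<rho>" "\<rho> < 1"
    proof -
      have "2 powr (- r) < (2 :: real) powr 0" using r by (intro powr_less_mono) auto
      then show "\<rho> < 1" unfolding \<rho>_def by simp
    qed (simp add: \<rho>_def)
    have u0T: "u n 0 \<in> {0..T}" for n using u0 u_le by simp

    have "\<exists>A\<ge>0. \<forall>n. \<bar>D n \<omega>\<bar> \<le> A * \<rho> ^ n"
    proof (rule linear_recursion_bound[OF elim(1) \<rho>(1)])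
      show "0 \<le> \<bar>CZ\<bar> * (T / 2) powr r" by simp
      fix n
      have e: "u (Suc n) 0 - u n 0 = T / 2 * (1 / 2) ^ (1 * n)" unfolding u_start by (simp add: algebra_simps)
      have "\<bar>u (Suc n) 0 - u n 0\<bar> powr r = (T / 2 * (1 / 2) ^ (1 * n)) powr r"
        unfolding e using T by simp
      also have "\<dots> = (T / 2) powr r * \<rho> ^ n"
        unfolding grid_step_powr \<rho>_def by simp
      finally have pw: "\<bar>u (Suc n) 0 - u n 0\<bar> powr r = (T / 2) powr r * \<rho> ^ n" .
      have "\<bar>Z (u (Suc n) 0) \<omega> - Z (u n 0) \<omega>\<bar> \<le> CZ * ((T / 2) powr r * \<rho> ^ n)"
        using CZ[OF u0T[of n] u0T[of "Suc n"]] unfolding pw .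
      also have "\<dots> \<le> \<bar>CZ\<bar> * ((T / 2) powr r * \<rho> ^ n)" using \<rho> by (intro mult_right_mono) auto
      finally have "\<bar>Z (u (Suc n) 0) \<omega> - Z (u n 0) \<omega>\<bar> \<le> \<bar>CZ\<bar> * (T / 2) powr r * \<rho> ^ n" by simp
      moreover have "D (Suc n) \<omega> = D n \<omega> * (1 - Q n \<omega> / S n) + (Z (u (Suc n) 0) \<omega> - Z (u n 0) \<omega>)"
        unfolding D_def by simp
      ultimately show "\<bar>D (Suc n) \<omega>\<bar> \<le> \<bar>1 - Q n \<omega> / S n\<bar> * \<bar>D n \<omega>\<bar> + \<bar>CZ\<bar> * (T / 2) powr r * \<rho> ^ n"
        by (metis abs_mult abs_triangle_ineq add_left_mono mult.commute order_trans)
    qed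
    then obtain A where A: "0 \<le> A" "\<And>n. \<bar>D n \<omega>\<bar> \<le> A * \<rho> ^ n" by blast

    \<comment> \<open>This product, rather than the amplitude alone, is what both estimates below use.\<close>
    have m_bound: "\<bar>m n \<omega>\<bar> * real (N n) \<le> 2 * A / C1 * (\<rho> ^ n * d n powr (- (2 * H)))" for n
    proof -
      have "\<bar>m n \<omega>\<bar> = 2 * \<bar>D n \<omega>\<bar> / S n" unfolding m_def using S_pos[of n] by (simp add: abs_mult)
      also have "\<dots> \<le> 2 * (A * \<rho> ^ n) / (C1 * real (N n) * d n powr (2 * H))"
        using A S_lower[of n] C N[of n] d[of n] \<rho> by (intro frac_le mult_left_mono) auto
      finally have "\<bar>m n \<omega>\<bar> * real (N n) \<le> 2 * (A * \<rho> ^ n) / (C1 * real (N n) * d n powr (2 * H)) * real (N n)"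
        by (intro mult_right_mono) auto
      also have "\<dots> = 2 * A / C1 * (\<rho> ^ n * d n powr (- (2 * H)))"
        using N[of n] by (simp add: powr_minus_divide)
      finally show ?thesis .
    qed
    have dp: "\<rho> ^ n * d n powr e = (T / 2) powr e * (2 powr (- r - \<kappa> * e)) ^ n" for n e
    proof -
      have "d n powr e = (T / 2) powr e * (2 powr (- (\<kappa> * e))) ^ n"
        unfolding d_def \<kappa>_def by (rule grid_step_powr)
      moreover have "(2 :: real) powr (- r - \<kappa> * e) = \<rho> * 2 powr (- (\<kappa> * e))"
        unfolding \<rho>_def by (simp add: powr_add[symmetric])
      ultimately show ?thesis by (simp add: power_mult_distrib)
    qed
    have summ: "summable (\<lambda>n. \<bar>m n \<omega>\<bar> * real (N n) * d n powr (1 + \<gamma> - \<alpha>))"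
    proof (rule summable_comparison_test)
      let ?x = "2 powr (- r - \<kappa> * (- (3 * \<epsilon>))) :: real"
      show "\<exists>n0. \<forall>n\<ge>n0. norm (\<bar>m n \<omega>\<bar> * real (N n) * d n powr (1 + \<gamma> - \<alpha>)) \<le> 2 * A / C1 * ((T / 2) powr (- (3 * \<epsilon>)) * ?x ^ n)"
      proof (intro exI[of _ 0] allI impI)
        fix n
        have "\<bar>m n \<omega>\<bar> * real (N n) * d n powr (1 + \<gamma> - \<alpha>) \<le> 2 * A / C1 * (\<rho> ^ n * d n powr (- (2 * H))) * d n powr (1 + \<gamma> - \<alpha>)"
          by (intro mult_right_mono m_bound) simp
        also have "\<dots> = 2 * A / C1 * (\<rho> ^ n * (d n powr (- (2 * H)) * d n powr (1 + \<gamma> - \<alpha>)))" by (simp only: mult.assoc)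
        also have "d n powr (- (2 * H)) * d n powr (1 + \<gamma> - \<alpha>) = d n powr (- (3 * \<epsilon>))"
          unfolding powr_add[symmetric] \<gamma>_def \<alpha>_def by (simp add: algebra_simps)
        finally show "norm (\<bar>m n \<omega>\<bar> * real (N n) * d n powr (1 + \<gamma> - \<alpha>)) \<le> 2 * A / C1 * ((T / 2) powr (- (3 * \<epsilon>)) * ?x ^ n)"
          unfolding dp by simp
      qed
      have "- r - \<kappa> * (- (3 * \<epsilon>)) < 0" using \<epsilon>(3) r by simp
      then have "?x < 2 powr 0" by (intro powr_less_mono) auto
      then show "summable (\<lambda>n. 2 * A / C1 * ((T / 2) powr (- (3 * \<epsilon>)) * ?x ^ n))"
        by (intro summable_mult summable_geometric) simp
    qed
    define Bd where "Bd = 2 * A / C1 * (T / 2) powr (\<gamma> - 2 * H) * K"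
    have bd: "\<bar>m n \<omega>\<bar> * K * d n powr \<gamma> \<le> Bd" for n
    proof -
      have N2: "real (N n) = (2 powr real p) ^ n" unfolding N_def by (simp add: powr_realpow power_mult)
      have "\<bar>m n \<omega>\<bar> * d n powr \<gamma> * real (N n) \<le> 2 * A / C1 * (\<rho> ^ n * d n powr (- (2 * H))) * d n powr \<gamma>"
        using mult_right_mono[OF m_bound, of "d n powr \<gamma>" n] by (simp add: mult_ac)
      also have "\<dots> = 2 * A / C1 * (\<rho> ^ n * (d n powr (- (2 * H)) * d n powr \<gamma>))" by (simp only: mult.assoc)
      also have "d n powr (- (2 * H)) * d n powr \<gamma> = d n powr (\<gamma> - 2 * H)"
        unfolding powr_add[symmetric] by simp
      also have "\<rho> ^ n * d n powr (\<gamma> - 2 * H) = (T / 2) powr (\<gamma> - 2 * H) * (2 powr (- r - \<kappa> * (\<gamma> - 2 * H))) ^ n"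
        by (rule dp)
      also have "(2 powr (- r - \<kappa> * (\<gamma> - 2 * H))) ^ n \<le> real (N n)"
      proof -
        have "- r - \<kappa> * (\<gamma> - 2 * H) \<le> real p"
        proof -
          have "- r - \<kappa> * (\<gamma> - 2 * H) = - r + \<kappa> * \<epsilon> + \<kappa> - \<kappa> * (1 - H)"
            unfolding \<gamma>_def by (simp add: algebra_simps)
          moreover have "0 \<le> \<kappa> * \<epsilon>" using \<kappa> \<epsilon> by simp
          ultimately show ?thesis using \<epsilon>(3) \<kappa>(1,3) by linarith
        qed
        then show ?thesis unfolding N2 by (intro power_mono powr_mono) auto
      qed
      then have "2 * A / C1 * ((T / 2) powr (\<gamma> - 2 * H) * (2 powr (- r - \<kappa> * (\<gamma> - 2 * H))) ^ n)
        \<le> 2 * A / C1 * ((T / 2) powr (\<gamma> - 2 * H) * real (N n))"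
        using A C by (intro mult_left_mono) auto
      finally have "\<bar>m n \<omega>\<bar> * d n powr \<gamma> * real (N n) \<le> 2 * A / C1 * (T / 2) powr (\<gamma> - 2 * H) * real (N n)"
        by (simp only: mult.assoc)
      then have "\<bar>m n \<omega>\<bar> * d n powr \<gamma> \<le> 2 * A / C1 * (T / 2) powr (\<gamma> - 2 * H)"
        using N[of n] by (simp only: mult_le_cancel_right_pos of_nat_0_less_iff)
      then have "\<bar>m n \<omega>\<bar> * d n powr \<gamma> * K \<le> Bd"
        unfolding Bd_def using K(1) by (rule mult_right_mono)
      then show ?thesis by (simp add: mult_ac)
    qed

    \<comment> \<open>The path, frozen outside \<open>[0, T]\<close>, is Hoelder continuous on the line.\<close>
    define g where "g = (\<lambda>x. G (max 0 (min T x)) \<omega>)"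
    have gG: "g x = G x \<omega>" if "x \<in> {0..T}" for x using that unfolding g_def by simp
    have sg: "step_grid g K \<gamma> \<alpha> T u N d"
    proof unfold_locales
      show "\<bar>g x - g y\<bar> \<le> K * \<bar>x - y\<bar> powr \<gamma>" for x y
      proof -
        have "\<bar>g x - g y\<bar> \<le> K * \<bar>max 0 (min T x) - max 0 (min T y)\<bar> powr \<gamma>"
          unfolding g_def using T by (intro K(2)) auto
        also have "\<dots> \<le> K * \<bar>x - y\<bar> powr \<gamma>" using K(1) exps(5) by (intro mult_left_mono powr_mono2) auto
        finally show ?thesis .
      qed
      show "g x = g T" if "T \<le> x" for x using that unfolding g_def by (simp add: min_absorb1)
    qed (use K(1) T exps u0 u_mono u_chain u_le u_step in auto)
    interpret sg: step_grid g K \<gamma> \<alpha> T u N "\<lambda>n. m n \<omega>" d by (rule sg)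
    define \<phi> where "\<phi> = sg.\<psi>"
    have \<phi>: "\<psi> t \<omega> = \<phi> t" for t
    proof -
      have "m n \<omega> * (indicat_real {u n k..<u n (Suc k)} t * (G t \<omega> - G (u n k) \<omega>)) =
          m n \<omega> * sg.piece (u n k) (u n (Suc k)) t" if "k < N n" for n k
      proof -
        have "u n k \<in> {0..T}" "u n (Suc k) \<in> {0..T}" using that by (auto simp del: atLeastAtMost_iff intro!: u_in)
        then show ?thesis unfolding sg.piece_def by (auto simp: gG split: split_indicator)
      qed
      then show ?thesis
        unfolding \<psi>_def \<phi>_def sg.\<psi>_def sg.block_def
        by (intro suminf_cong sum.cong) auto
    qed
    have \<phi>_meas: "\<phi> \<in> borel_measurable borel" unfolding \<phi>_def by (rule sg.\<psi>_measurable)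
    have \<phi>_fin: "frac_nn \<alpha> T \<phi> < \<infinity>" unfolding \<phi>_def by (rule sg.frac_nn_\<psi>_finite[OF summ])
    have "bounded (\<phi> ` {0..T})"
      unfolding bounded_iff using sg.\<psi>_bound[OF bd] unfolding \<phi>_def by auto
    moreover have "finite_frac_norm \<alpha> T \<phi>"
      unfolding finite_frac_norm_def frac_norm_eq_frac_nn[OF \<phi>_meas]
      using \<phi>_meas \<phi>_fin by (auto intro!: measurable_restrict_space1 measurable_completion)
    moreover have "gls_integrable \<alpha> 0 T \<phi> (\<lambda>t. G t \<omega>)"
      using sg.gls_integrableI[OF \<phi>_meas \<phi>_fin] gls_cong(2)[where g = g and g' = "\<lambda>t. G t \<omega>", OF T gG] by blast
    moreover have "\<xi> \<omega> = gls_integral \<alpha> 0 T \<phi> (\<lambda>t. G t \<omega>)"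
    proof -
      have "gls_integral \<alpha> 0 T \<phi> (\<lambda>t. G t \<omega>) = gls_integral \<alpha> 0 T \<phi> g"
        by (rule gls_cong(1)[OF T gG, symmetric])
      also have "\<dots> = sg.L \<phi>" (is "_ = ?L")
        by (rule sg.gls_integral_eq_L[OF \<phi>_meas])
      finally have Leq: "gls_integral \<alpha> 0 T \<phi> (\<lambda>t. G t \<omega>) = ?L" .
      have "(\<lambda>n. m n \<omega> * (- (\<Sum>k<N n. (g (u n (Suc k)) - g (u n k))\<^sup>2) / 2)) sums ?L"
        unfolding \<phi>_def by (rule sg.L_\<psi>_sums[OF summ])
      moreover have "m n \<omega> * (- (\<Sum>k<N n. (g (u n (Suc k)) - g (u n k))\<^sup>2) / 2) = D n \<omega> * (Q n \<omega> / S n)" for n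
      proof -
        have "(\<Sum>k<N n. (g (u n (Suc k)) - g (u n k))\<^sup>2) = Q n \<omega>"
          unfolding Q_eq by (intro sum.cong refl) (simp add: gG u_in del: atLeastAtMost_iff)
        then show ?thesis unfolding m_def by simp
      qed
      ultimately have "(\<lambda>n. D n \<omega> * (Q n \<omega> / S n)) sums ?L" by simp
      then have lim1: "(\<lambda>n. Z (u n 0) \<omega> - D n \<omega>) \<longlonglongrightarrow> ?L"
        unfolding sums_def D_def residual_sum .
      have D0: "(\<lambda>n. D n \<omega>) \<longlonglongrightarrow> 0"
      proof (rule Lim_null_comparison)
        show "\<forall>\<^sub>F n in sequentially. norm (D n \<omega>) \<le> A * \<rho> ^ n" using A(2) by simp
        have "(\<lambda>n. A * \<rho> ^ n) \<longlonglongrightarrow> A * 0" using \<rho> by (intro tendsto_intros LIMSEQ_power_zero) simp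
        then show "(\<lambda>n. A * \<rho> ^ n) \<longlonglongrightarrow> 0" by simp
      qed
      have "(\<lambda>n. Z (u n 0) \<omega> - Z T \<omega>) \<longlonglongrightarrow> 0"
      proof (rule Lim_null_comparison)
        show "\<forall>\<^sub>F n in sequentially. norm (Z (u n 0) \<omega> - Z T \<omega>) \<le> CZ * \<bar>u n 0 - T\<bar> powr r"
          using CZ[of T "u _ 0"] u0T T by (intro always_eventually) auto
        have "(\<lambda>n. CZ * \<bar>u n 0 - T\<bar> powr r) \<longlonglongrightarrow> CZ * \<bar>T - T\<bar> powr r"
          using r grid_start_tendsto[of T p] unfolding u_def by (intro tendsto_intros tendsto_powr') auto
        then show "(\<lambda>n. CZ * \<bar>u n 0 - T\<bar> powr r) \<longlonglongrightarrow> 0" using r by simp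
      qed
      then have "(\<lambda>n. Z (u n 0) \<omega>) \<longlonglongrightarrow> Z T \<omega>" by (simp add: LIM_zero_iff)
      then have "(\<lambda>n. Z (u n 0) \<omega> - D n \<omega>) \<longlonglongrightarrow> Z T \<omega> - 0" using D0 by (intro tendsto_diff)
      then have "?L = Z T \<omega>" using lim1 LIMSEQ_unique by force
      then show ?thesis using Leq elim(4) by simp
    qed
    ultimately show ?case unfolding \<phi> by blast
  qed
  show ?thesis
  proof (intro exI[of _ \<psi>] conjI bexI[of _ \<alpha>])
    show "bounded_process M T \<psi>" unfolding bounded_process_def using main by eventually_elim blast
    show "adapted_process T F \<psi>" by (rule adapted)
    show "AE \<omega> in M. finite_frac_norm \<alpha> T (\<lambda>t. \<psi> t \<omega>)" using main by eventually_elim blast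
    show "AE \<omega> in M. gls_integrable \<alpha> 0 T (\<lambda>t. \<psi> t \<omega>) (\<lambda>t. G t \<omega>) \<and>
          \<xi> \<omega> = gls_integral \<alpha> 0 T (\<lambda>t. \<psi> t \<omega>) (\<lambda>t. G t \<omega>)" using main by eventually_elim blast
    show "\<alpha> \<in> {1 - H<..<1}" using exps by simp
  qed
qed

end
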